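(* Let $p,q$ be projections in a $\mathrm{II}_1$-factor $(\mathcal{A},\tau)$, and let $(u_t)_{t\ge 0}$ be a free unitary Brownian motion freely independent from $\{p,q\}$; set $p_t=u_tpu_t^\ast$. Let $\tau(p)=\alpha$ and $\tau(q)=\beta$, and let $\mu_t$ denote the spectral measure of $qp_tq$. For $t>0$ and $z$ in the upper half-plane $\mathbb{C}_+$, let $$G(t,z)=\int_0^1\frac{\mu_t(dx)}{z-x}-\frac{1-\min\{\alpha,\beta\}}{z}.$$ Then the function $G$ is analytic in both $z\in\mathbb{C}_+$ and $t>0$, and satisfies the complex PDE $$\frac{\partial}{\partial t}G=\frac{\partial}{\partial z}\left[z(z-1)G^2-(az+b)G\right],$$ where $a=2\min\{\alpha,\beta\}-1$ and $b=|\alpha-\beta|$.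
   Context: $\tau$ is the faithful normal tracial state of $\mathcal{A}$ ($\mathcal A$ is enlarged if necessary so that it contains the process $u_t$). Free independence is in the sense of Voiculescu: $\ast$-subalgebras $A_1,\dots,A_n$ are free if $\tau(a_1\cdots a_m)=0$ whenever each $a_k$ is centered, $\tau(a_k)=0$, $a_k\in A_{i_k}$, and $i_k\ne i_{k+1}$ for all $k$. A free unitary Brownian motion is the unitary-valued process solving the free stochastic differential equation $du_t=iu_t\,dx_t-\frac12u_t\,dt$, $u_0=1$, with $x_t$ a free (semicircular) Brownian motion; it has freely independent stationary multiplicative increments, and $\tau(u_t^k)=e^{-kt/2}\sum_{j=0}^{k-1}\frac{(-t)^j}{j!}\binom{k}{j+1}k^{j-1}$ for $k\ge1$. The spectral measure of a self-adjoint $a\in\mathcal{A}$ is the probability measure $\mu_a$ on $\mathbb{R}$ with $\tau(a^n)=\int x^n\,\mu_a(dx)$ for all $n\ge 0$; $\mu_t$ is supported in $[0,1]$. $\mathbb{C}_+=\{z:\Im z>0\}$. *)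

theory Defs
  imports "HOL-Probability.Probability"
begin

section \<open>Complex Hilbert spaces and their bounded operators\<close>

class complex_vector = ab_group_add +
  fixes scaleC :: "complex \<Rightarrow> 'a \<Rightarrow> 'a"  (infixr "*\<^sub>C" 75)
  assumes scaleC_add_right: "c *\<^sub>C (x + y) = c *\<^sub>C x + c *\<^sub>C y"
    and scaleC_add_left: "(c + d) *\<^sub>C x = c *\<^sub>C x + d *\<^sub>C x"
    and scaleC_scaleC: "c *\<^sub>C d *\<^sub>C x = (c * d) *\<^sub>C x"
    and scaleC_one: "1 *\<^sub>C x = x"

text \<open>The inner product is linear in its first argument; completeness comes from \<^class>\<open>banach\<close>.\<close>

class complex_hilbert = banach + complex_vector +
  fixes cinner :: "'a \<Rightarrow> 'a \<Rightarrow> complex"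
  assumes scaleR_scaleC: "r *\<^sub>R x = complex_of_real r *\<^sub>C x"
    and cinner_commute: "cinner x y = cnj (cinner y x)"
    and cinner_add_left: "cinner (x + y) z = cinner x z + cinner y z"
    and cinner_scaleC_left: "cinner (c *\<^sub>C x) y = c * cinner x y"
    and cinner_self: "cinner x x = complex_of_real ((norm x)\<^sup>2)"

global_interpretation complex_vector: vector_space "scaleC :: complex \<Rightarrow> 'a \<Rightarrow> 'a::complex_vector"
  by unfold_locales (simp_all add: scaleC_add_right scaleC_add_left scaleC_scaleC scaleC_one)

typedef (overloaded) 'h bop =
  "{f :: 'h::complex_hilbert \<Rightarrow> 'h. bounded_linear f \<and> (\<forall>c x. f (c *\<^sub>C x) = c *\<^sub>C f x)}"
  morphisms bop_apply Bop
  by (rule exI[of _ "\<lambda>_. 0"]) (simp add: bounded_linear_zero)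

setup_lifting type_definition_bop

lemma bop_eqI: "(\<And>x. bop_apply a x = bop_apply b x) \<Longrightarrow> a = b"
  by (rule iffD1[OF bop_apply_inject]) (rule ext)

lemma bounded_linear_scaleC: "bounded_linear (\<lambda>x::'h::complex_hilbert. c *\<^sub>C x)"
proof (rule bounded_linear_intro[where K = "cmod c"])
  fix x y :: 'h and r :: real
  show "c *\<^sub>C (x + y) = c *\<^sub>C x + c *\<^sub>C y" by (rule scaleC_add_right)
  show "c *\<^sub>C (r *\<^sub>R x) = r *\<^sub>R (c *\<^sub>C x)"
    by (simp add: scaleR_scaleC scaleC_scaleC mult.commute)
  have "complex_of_real ((norm (c *\<^sub>C x))\<^sup>2) = c * cinner x (c *\<^sub>C x)"
    by (simp only: cinner_self[symmetric] cinner_scaleC_left)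
  also have "cinner x (c *\<^sub>C x) = cnj (c * cinner x x)"
    by (subst cinner_commute) (simp only: cinner_scaleC_left)
  also have "c * cnj (c * cinner x x) = complex_of_real ((cmod c * norm x)\<^sup>2)"
    unfolding cinner_self power_mult_distrib of_real_mult complex_norm_square by simp
  finally have "(norm (c *\<^sub>C x))\<^sup>2 = (cmod c * norm x)\<^sup>2"
    unfolding of_real_eq_iff .
  then show "norm (c *\<^sub>C x) \<le> norm x * cmod c"
    by (simp add: mult.commute)
qed

instantiation bop :: (complex_hilbert) ring
begin

lift_definition zero_bop :: "'a bop" is "\<lambda>_. 0"
  by (simp add: bounded_linear_zero)

lift_definition plus_bop :: "'a bop \<Rightarrow> 'a bop \<Rightarrow> 'a bop" is "\<lambda>f g x. f x + g x"
  by (simp add: bounded_linear_add scaleC_add_right)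

lift_definition uminus_bop :: "'a bop \<Rightarrow> 'a bop" is "\<lambda>f x. - f x"
  by (simp add: bounded_linear_minus)

lift_definition minus_bop :: "'a bop \<Rightarrow> 'a bop \<Rightarrow> 'a bop" is "\<lambda>f g x. f x - g x"
  by (simp add: bounded_linear_sub complex_vector.scale_right_diff_distrib)

lift_definition times_bop :: "'a bop \<Rightarrow> 'a bop \<Rightarrow> 'a bop" is "\<lambda>f g x. f (g x)"
  by (simp add: bounded_linear_compose)

instance
proof
  fix a b c :: "'a bop"
  show "a * b * c = a * (b * c)" by transfer simp
  show "a + b + c = a + (b + c)" by transfer (simp add: add.assoc)
  show "a + b = b + a" by transfer (simp add: add.commute)
  show "0 + a = a" by transfer simp
  show "- a + a = 0" by transfer simp
  show "a - b = a + - b" by transfer simp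
  show "(a + b) * c = a * c + b * c" by transfer simp
  show "a * (b + c) = a * b + a * c"
    by transfer (auto simp: linear_add bounded_linear.linear)
qed

end

instantiation bop :: (complex_hilbert) monoid_mult
begin

lift_definition one_bop :: "'a bop" is "\<lambda>x. x"
  by (simp add: bounded_linear_ident)

instance
proof
  fix a :: "'a bop"
  show "1 * a = a" by transfer simp
  show "a * 1 = a" by transfer simp
qed

end

instantiation bop :: (complex_hilbert) complex_vector
begin

lift_definition scaleC_bop :: "complex \<Rightarrow> 'a bop \<Rightarrow> 'a bop" is "\<lambda>c f x. c *\<^sub>C f x"
proof (intro conjI allI)
  fix c d :: complex and f :: "'a \<Rightarrow> 'a" and x :: 'a
  assume f: "bounded_linear f \<and> (\<forall>c x. f (c *\<^sub>C x) = c *\<^sub>C f x)"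
  then show "bounded_linear (\<lambda>x. c *\<^sub>C f x)"
    using bounded_linear_compose[OF bounded_linear_scaleC, of f c] by blast
  show "c *\<^sub>C f (d *\<^sub>C x) = d *\<^sub>C c *\<^sub>C f x"
    using f by (simp only: scaleC_scaleC mult.commute)
qed

instance
proof
  fix a b :: "'a bop" and c d :: complex
  show "c *\<^sub>C (a + b) = c *\<^sub>C a + c *\<^sub>C b" by transfer (simp add: scaleC_add_right)
  show "(c + d) *\<^sub>C a = c *\<^sub>C a + d *\<^sub>C a" by transfer (simp add: scaleC_add_left)
  show "c *\<^sub>C d *\<^sub>C a = (c * d) *\<^sub>C a" by transfer (simp add: scaleC_scaleC)
  show "1 *\<^sub>C a = a" by transfer (simp add: scaleC_one)
qed

end

definition is_adjoint :: "'h::complex_hilbert bop \<Rightarrow> 'h bop \<Rightarrow> bool" where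
  "is_adjoint a b \<longleftrightarrow> (\<forall>x y. cinner (bop_apply a x) y = cinner x (bop_apply b y))"

definition adj :: "'h::complex_hilbert bop \<Rightarrow> 'h bop" where
  "adj a = (THE b. is_adjoint a b)"

lemma cinner_ext:
  fixes v w :: "'h::complex_hilbert"
  assumes "\<And>x. cinner x v = cinner x w"
  shows "v = w"
proof -
  have "cinner (v - w) z = 0" for z :: 'h
  proof -
    have "cinner v z = cinner w z"
      unfolding cinner_commute[of v z] cinner_commute[of w z] assms ..
    then show ?thesis
      using cinner_add_left[of "v - w" w z] by simp
  qed
  from this[of "v - w"] show ?thesis by (simp add: cinner_self)
qed

lemma adj_eqI:
  assumes b: "is_adjoint a b"
  shows "adj a = b"
  unfolding adj_def
proof (rule the_equality)
  show "is_adjoint a b" by (rule b)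
next
  fix d
  assume d: "is_adjoint a d"
  show "d = b"
  proof (rule bop_eqI, rule cinner_ext)
    fix x y
    show "cinner x (bop_apply d y) = cinner x (bop_apply b y)"
      using b[unfolded is_adjoint_def, rule_format, of x y]
        d[unfolded is_adjoint_def, rule_format, of x y] by simp
  qed
qed

definition projection :: "'h::complex_hilbert bop \<Rightarrow> bool" where
  "projection p \<longleftrightarrow> is_adjoint p p \<and> p * p = p"

definition unitary :: "'h::complex_hilbert bop \<Rightarrow> bool" where
  "unitary u \<longleftrightarrow> (\<exists>v. is_adjoint u v \<and> v * u = 1 \<and> u * v = 1)"

definition bop_le :: "'h::complex_hilbert bop \<Rightarrow> 'h bop \<Rightarrow> bool" where
  "bop_le a b \<longleftrightarrow> (\<forall>x. cinner (bop_apply (b - a) x) x \<in> \<real>\<^sub>\<ge>\<^sub>0)"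


section \<open>Factors of type $\mathrm{II}_1$\<close>

definition commutant :: "'h::complex_hilbert bop set \<Rightarrow> 'h bop set" where
  "commutant S = {b. \<forall>a\<in>S. a * b = b * a}"

text \<open>A self-adjoint set of operators that equals its bicommutant; being a unital subalgebra
  is then automatic.\<close>

definition von_neumann_algebra :: "'h::complex_hilbert bop set \<Rightarrow> bool" where
  "von_neumann_algebra M \<longleftrightarrow>
     (\<forall>a\<in>M. \<exists>b\<in>M. is_adjoint a b) \<and> commutant (commutant M) = M"

definition factor :: "'h::complex_hilbert bop set \<Rightarrow> bool" where
  "factor M \<longleftrightarrow> von_neumann_algebra M \<and> M \<inter> commutant M = range (\<lambda>c. c *\<^sub>C 1)"

definition tracial_state :: "'h::complex_hilbert bop set \<Rightarrow> ('h bop \<Rightarrow> complex) \<Rightarrow> bool" where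
  "tracial_state M \<tau> \<longleftrightarrow>
     (\<forall>a\<in>M. \<forall>b\<in>M. \<tau> (a + b) = \<tau> a + \<tau> b) \<and>
     (\<forall>a\<in>M. \<forall>c. \<tau> (c *\<^sub>C a) = c * \<tau> a) \<and>
     \<tau> 1 = 1 \<and>
     (\<forall>a\<in>M. \<tau> (adj a * a) \<in> \<real>\<^sub>\<ge>\<^sub>0) \<and>
     (\<forall>a\<in>M. \<forall>b\<in>M. \<tau> (a * b) = \<tau> (b * a))"

definition faithful :: "'h::complex_hilbert bop set \<Rightarrow> ('h bop \<Rightarrow> complex) \<Rightarrow> bool" where
  "faithful M \<tau> \<longleftrightarrow> (\<forall>a\<in>M. \<tau> (adj a * a) = 0 \<longrightarrow> a = 0)"

text \<open>Normality: \<open>\<tau> (sup D) = sup \<tau> D\<close> for every upward directed set \<open>D\<close> of self-adjoint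
  elements of \<open>M\<close> that has a supremum \<open>s\<close> among the self-adjoint elements of \<open>M\<close>.\<close>

definition normal :: "'h::complex_hilbert bop set \<Rightarrow> ('h bop \<Rightarrow> complex) \<Rightarrow> bool" where
  "normal M \<tau> \<longleftrightarrow>
     (\<forall>D s. D \<noteq> {} \<and> D \<subseteq> {a\<in>M. is_adjoint a a} \<and>
        (\<forall>a\<in>D. \<forall>b\<in>D. \<exists>c\<in>D. bop_le a c \<and> bop_le b c) \<and>
        s \<in> M \<and> is_adjoint s s \<and> (\<forall>a\<in>D. bop_le a s) \<and>
        (\<forall>s'\<in>M. is_adjoint s' s' \<and> (\<forall>a\<in>D. bop_le a s') \<longrightarrow> bop_le s s') \<longrightarrow>
        Re (\<tau> s) = (SUP a\<in>D. Re (\<tau> a)))"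

text \<open>An infinite-dimensional factor together with its faithful normal tracial state.\<close>

definition II1_factor :: "'h::complex_hilbert bop set \<Rightarrow> ('h bop \<Rightarrow> complex) \<Rightarrow> bool" where
  "II1_factor M \<tau> \<longleftrightarrow>
     factor M \<and> \<not> (\<exists>B. finite B \<and> M \<subseteq> complex_vector.span B) \<and>
     tracial_state M \<tau> \<and> faithful M \<tau> \<and> normal M \<tau>"


section \<open>Free independence and spectral measures\<close>

text \<open>The unital \<open>*\<close>-algebra generated by a set of operators.\<close>

inductive_set star_alg :: "'h::complex_hilbert bop set \<Rightarrow> 'h bop set" for S where
  gen: "a \<in> S \<Longrightarrow> a \<in> star_alg S"
| one: "1 \<in> star_alg S"
| add: "a \<in> star_alg S \<Longrightarrow> b \<in> star_alg S \<Longrightarrow> a + b \<in> star_alg S"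
| mult: "a \<in> star_alg S \<Longrightarrow> b \<in> star_alg S \<Longrightarrow> a * b \<in> star_alg S"
| scale: "a \<in> star_alg S \<Longrightarrow> c *\<^sub>C a \<in> star_alg S"
| adj: "a \<in> star_alg S \<Longrightarrow> is_adjoint a b \<Longrightarrow> b \<in> star_alg S"

text \<open>Freeness of the \<open>*\<close>-subalgebras \<open>As ! 0, As ! 1, \<dots>\<close>. A product \<open>a\<^sub>1 \<cdots> a\<^sub>m\<close> with
  \<open>a\<^sub>k \<in> As ! i\<^sub>k\<close> is encoded as the list of the pairs \<open>(i\<^sub>k, a\<^sub>k)\<close>.\<close>

definition free :: "('h::complex_hilbert bop \<Rightarrow> complex) \<Rightarrow> 'h bop set list \<Rightarrow> bool" where
  "free \<tau> As \<longleftrightarrow>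
     (\<forall>w. w \<noteq> [] \<and> (\<forall>(i, a)\<in>set w. i < length As \<and> a \<in> As ! i \<and> \<tau> a = 0) \<and>
        distinct_adj (map fst w) \<longrightarrow> \<tau> (prod_list (map snd w)) = 0)"

definition spectral_measure ::
    "('h::complex_hilbert bop \<Rightarrow> complex) \<Rightarrow> 'h bop \<Rightarrow> real measure \<Rightarrow> bool" where
  "spectral_measure \<tau> a \<mu> \<longleftrightarrow>
     is_adjoint a a \<and> real_distribution \<mu> \<and>
     (\<forall>n::nat. integrable \<mu> (\<lambda>x. x ^ n) \<and>
        \<tau> (a ^ n) = complex_of_real (\<integral>x. x ^ n \<partial>\<mu>))"


section \<open>Free unitary Brownian motion\<close>

definition semicircle_law :: "real \<Rightarrow> real measure" where
  "semicircle_law v = density lborel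
     (\<lambda>y. ennreal (indicator {- 2 * sqrt v..2 * sqrt v} y * sqrt (4 * v - y\<^sup>2) / (2 * pi * v)))"

definition vn_filtration :: "'h::complex_hilbert bop set \<Rightarrow> (real \<Rightarrow> 'h bop set) \<Rightarrow> bool" where
  "vn_filtration M F \<longleftrightarrow>
     (\<forall>t\<ge>0. von_neumann_algebra (F t) \<and> F t \<subseteq> M) \<and>
     (\<forall>s t. 0 \<le> s \<and> s \<le> t \<longrightarrow> F s \<subseteq> F t)"

text \<open>Free (semicircular) Brownian motion with respect to the filtration \<open>F\<close>.\<close>

definition free_brownian_motion ::
    "('h::complex_hilbert bop \<Rightarrow> complex) \<Rightarrow> (real \<Rightarrow> 'h bop set) \<Rightarrow> (real \<Rightarrow> 'h bop) \<Rightarrow> bool" where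
  "free_brownian_motion \<tau> F x \<longleftrightarrow>
     (\<forall>t\<ge>0. x t \<in> F t \<and> is_adjoint (x t) (x t)) \<and> x 0 = 0 \<and>
     (\<forall>s t. 0 \<le> s \<and> s < t \<longrightarrow>
        free \<tau> [F s, star_alg {x t - x s}] \<and>
        spectral_measure \<tau> (x t - x s) (semicircle_law (t - s)))"

definition norm2 :: "('h::complex_hilbert bop \<Rightarrow> complex) \<Rightarrow> 'h bop \<Rightarrow> real" where
  "norm2 \<tau> a = sqrt (Re (\<tau> (adj a * a)))"

text \<open>\<open>I\<close> is the integral over \<open>[0, t]\<close> of \<open>\<theta>\<^sub>s dX\<^sub>s\<close>: the limit in \<open>L\<^sup>2(\<tau>)\<close>, as the mesh
  of the partition \<open>0 = r\<^sub>0 \<le> \<dots> \<le> r\<^sub>n = t\<close> tends to zero, of the left-endpoint Riemann sums.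
  For an \<open>L\<^sup>2\<close>-continuous adapted \<open>\<theta>\<close> and a free Brownian motion \<open>X\<close> this is the
  free Ito integral; for \<open>X\<^sub>s = s 1\<close> it is the ordinary time integral.\<close>

definition has_stoch_integral ::
    "('h::complex_hilbert bop \<Rightarrow> complex) \<Rightarrow> (real \<Rightarrow> 'h bop) \<Rightarrow> (real \<Rightarrow> 'h bop) \<Rightarrow>
     real \<Rightarrow> 'h bop \<Rightarrow> bool" where
  "has_stoch_integral \<tau> \<theta> X t I \<longleftrightarrow>
     (\<forall>\<epsilon>>0. \<exists>\<delta>>0. \<forall>(n::nat) r.
        r 0 = 0 \<and> r n = t \<and> (\<forall>j<n. r j \<le> r (Suc j) \<and> r (Suc j) - r j < \<delta>) \<longrightarrow>
        norm2 \<tau> ((\<Sum>j<n. \<theta> (r j) * (X (r (Suc j)) - X (r j))) - I) < \<epsilon>)"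

text \<open>A unitary-valued adapted process, continuous in \<open>L\<^sup>2(\<tau>)\<close>, solving
  \<open>du\<^sub>t = i u\<^sub>t dx\<^sub>t - (1/2) u\<^sub>t dt\<close>, \<open>u\<^sub>0 = 1\<close>, in integrated form.\<close>

definition free_unitary_brownian_motion ::
    "'h::complex_hilbert bop set \<Rightarrow> ('h bop \<Rightarrow> complex) \<Rightarrow> (real \<Rightarrow> 'h bop) \<Rightarrow> bool" where
  "free_unitary_brownian_motion M \<tau> u \<longleftrightarrow>
     (\<exists>F x. vn_filtration M F \<and> free_brownian_motion \<tau> F x \<and>
        (\<forall>t\<ge>0. unitary (u t) \<and> u t \<in> F t) \<and>
        (\<forall>t\<ge>0. ((\<lambda>s. norm2 \<tau> (u s - u t)) \<longlongrightarrow> 0) (at t within {0..})) \<and>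
        u 0 = 1 \<and>
        (\<forall>t\<ge>0. \<exists>I\<in>M. \<exists>J\<in>M.
           has_stoch_integral \<tau> u x t I \<and>
           has_stoch_integral \<tau> u (\<lambda>s. complex_of_real s *\<^sub>C 1) t J \<and>
           u t - u 0 = \<i> *\<^sub>C I - (1/2) *\<^sub>C J))"


section \<open>Joint analyticity in a real and a complex variable\<close>

definition jointly_analytic_at :: "(real \<Rightarrow> complex \<Rightarrow> complex) \<Rightarrow> real \<Rightarrow> complex \<Rightarrow> bool" where
  "jointly_analytic_at f t\<^sub>0 z\<^sub>0 \<longleftrightarrow>
     (\<exists>r>0. \<exists>c :: nat \<Rightarrow> nat \<Rightarrow> complex. \<forall>t z. \<bar>t - t\<^sub>0\<bar> < r \<and> cmod (z - z\<^sub>0) < r \<longrightarrow>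
        ((\<lambda>(j, k). c j k * complex_of_real (t - t\<^sub>0) ^ j * (z - z\<^sub>0) ^ k) has_sum f t z) UNIV)"

end

theory Submission
  imports Defs "HOL-Complex_Analysis.Complex_Analysis"
begin

text \<open>
  Write \<open>g\<^sub>n(t) = \<tau>((q p\<^sub>t)\<^sup>n)\<close>. The proof turns the stochastic equation into a closed system of
  ordinary differential equations for the \<open>g\<^sub>n\<close>, reads that system as a partial differential equation
  for a power series, and then finds power series that represent \<open>G\<close> near every point of the half-plane.

  \<^bold>\<open>Moment equations.\<close> For a small step write \<open>u\<^bsub>s+h\<^esub> = u\<^sub>s (1 + w)\<close>. The equation for \<open>u\<close> says that
  \<open>w = i dx + o(\<surd>h)\<close> in \<open>L\<^sup>2(\<tau>)\<close>, where \<open>dx\<close> is semicircular of variance \<open>h\<close> and free from the past, and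
  that \<open>w\<close> has conditional mean \<open>- h/2\<close> up to \<open>o(h)\<close>. Expand \<open>(q p\<^bsub>s+h\<^esub>)\<^sup>n\<close> in \<open>w\<close> and \<open>w\<^sup>*\<close>.
  One factor gives the drift; two factors give the free Ito correction, because
  \<open>\<tau>(c dx c' dx) = h \<tau>(c) \<tau>(c')\<close>; three factors are \<open>o(h)\<close> (\<open>small_family_triple_negligible\<close>).
  All sizes are measured by the \<open>L\<^sup>2\<close>-norm and by the norm of left multiplication on \<open>L\<^sup>2\<close>, so the trace
  is the only analytic tool.

  The coefficients \<open>c, c'\<close> lie in the algebra generated by \<open>u\<^sub>s\<close>, \<open>p\<close> and \<open>q\<close>, whereas \<open>dx\<close> is known to be
  free only from the filtration, which need not contain \<open>p\<close> and \<open>q\<close>. What is free from \<open>{p, q}\<close> is the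
  algebra of all \<open>u\<^sub>t\<close>, and this contains \<open>w\<close>. Splitting a coefficient into alternating centred words
  reduces both estimates to coefficients from \<open>u\<^sub>s\<close> alone (\<open>drift_joint_alg\<close>, \<open>quadratic_joint_alg\<close>).
  The outcome is a right derivative (\<open>moment_increment\<close>); since the moments are continuous, it is a
  derivative (\<open>moment_ode\<close>). With \<open>E = g\<^sub>0 + g\<^sub>1 X + g\<^sub>2 X\<^sup>2 + \<dots>\<close> and \<open>g\<^sub>0 = min \<alpha> \<beta>\<close> the system becomes
  \<open>\<partial>\<^sub>t E = - X \<partial>\<^sub>X [(1 - X) E\<^sup>2 - (a + b X) E]\<close>, which is the asserted equation in the variable \<open>X = 1/z\<close>
  for \<open>G = X E\<close>.

  \<^bold>\<open>Every point of the half-plane.\<close> The series in \<open>1/z\<close> converges only for \<open>|z| > 1\<close>. Expand instead in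
  \<open>\<zeta> = 1/(z - c)\<close> with \<open>c = - i Y\<close>. The interval \<open>[0, 1]\<close>, which carries \<open>\<mu>\<^sub>t\<close>, lies in the disc of radius
  \<open>\<surd>(1 + Y\<^sup>2)\<close> about \<open>c\<close>, and this disc avoids any given \<open>z\<close> with \<open>Im z > 0\<close> once \<open>Y\<close> is large. Moving the
  centre is a Moebius substitution of formal power series, under which the equation keeps its shape
  (\<open>shift_pde\<close>).

  \<^bold>\<open>Analyticity in time.\<close> Differentiating the equation repeatedly expresses all time derivatives of the
  coefficients through the coefficients at the same time. As these are bounded geometrically, uniformly
  in time, the method of majorants bounds the \<open>n\<close>-th Taylor coefficient in time by \<open>C L\<^sup>n\<close> while shrinking
  the radius of convergence in \<open>\<zeta>\<close> as little as desired (\<open>local_solution\<close>). So \<open>G\<close> is the sum of an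
  absolutely convergent double series, and the equation is an identity between its first time
  coefficient and a derivative in \<open>\<zeta>\<close> (\<open>analytic_and_pde_at\<close>).
\<close>

section \<open>Adjoints and star-algebras of operators\<close>

lemma is_adjoint_sym:
  assumes "is_adjoint a b" shows "is_adjoint b a"
  unfolding is_adjoint_def
proof (intro allI)
  fix x y
  have "cinner (bop_apply b x) y = cnj (cinner y (bop_apply b x))" by (rule cinner_commute)
  also have "\<dots> = cnj (cinner (bop_apply a y) x)" using assms by (simp add: is_adjoint_def)
  also have "\<dots> = cinner x (bop_apply a y)" by (rule cinner_commute[symmetric])
  finally show "cinner (bop_apply b x) y = cinner x (bop_apply a y)" .
qed

lemma cinner_add_right: "cinner x (y + z) = cinner x y + cinner x z"
  by (metis cinner_commute cinner_add_left complex_cnj_add)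

lemma cinner_scaleC_right: "cinner x (c *\<^sub>C y) = cnj c * cinner x y"
  by (metis cinner_commute cinner_scaleC_left complex_cnj_mult)

lemma is_adjoint_one: "is_adjoint 1 1"
  by (simp add: is_adjoint_def one_bop.rep_eq)

lemma is_adjoint_add: "is_adjoint a b \<Longrightarrow> is_adjoint c d \<Longrightarrow> is_adjoint (a + c) (b + d)"
  by (simp add: is_adjoint_def plus_bop.rep_eq cinner_add_left cinner_add_right)

lemma is_adjoint_mult: "is_adjoint a b \<Longrightarrow> is_adjoint c d \<Longrightarrow> is_adjoint (a * c) (d * b)"
  by (simp add: is_adjoint_def times_bop.rep_eq)

lemma is_adjoint_scaleC: "is_adjoint a b \<Longrightarrow> is_adjoint (c *\<^sub>C a) (cnj c *\<^sub>C b)"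
  by (simp add: is_adjoint_def scaleC_bop.rep_eq cinner_scaleC_left cinner_scaleC_right)

lemma bop_scaleC_left: "(c *\<^sub>C a) * b = c *\<^sub>C (a * b :: 'h::complex_hilbert bop)"
  by transfer simp

lemma bop_scaleC_right: "a * (c *\<^sub>C b) = c *\<^sub>C (a * b :: 'h::complex_hilbert bop)"
  by transfer simp

lemma commutant_one: "1 \<in> commutant S"
  by (simp add: commutant_def)
lemma commutant_add: "a \<in> commutant S \<Longrightarrow> b \<in> commutant S \<Longrightarrow> a + b \<in> commutant S"
  by (simp add: commutant_def distrib_left distrib_right)
lemma commutant_mult: "a \<in> commutant S \<Longrightarrow> b \<in> commutant S \<Longrightarrow> a * b \<in> commutant S"
  unfolding commutant_def by (auto simp: mult.assoc) (metis mult.assoc)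
lemma commutant_scaleC: "a \<in> commutant S \<Longrightarrow> c *\<^sub>C a \<in> commutant S"
  by (simp add: commutant_def bop_scaleC_left bop_scaleC_right)

text \<open>The ambient algebra, the algebras of the filtration and the algebras generated by a few operators
  are all instances; adjoints behave well only inside such a set, since \<open>adj\<close> is a definite description.\<close>

locale unital_star_algebra =
  fixes N :: "'h::complex_hilbert bop set"
  assumes one_mem [simp, intro]: "1 \<in> N"
    and add_mem [simp, intro]: "a \<in> N \<Longrightarrow> b \<in> N \<Longrightarrow> a + b \<in> N"
    and mult_mem [simp, intro]: "a \<in> N \<Longrightarrow> b \<in> N \<Longrightarrow> a * b \<in> N"
    and scaleC_mem [simp, intro]: "a \<in> N \<Longrightarrow> c *\<^sub>C a \<in> N"
    and has_adjoint: "a \<in> N \<Longrightarrow> \<exists>b\<in>N. is_adjoint a b"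
begin

lemma is_adjoint_adj: "a \<in> N \<Longrightarrow> is_adjoint a (adj a)"
  using has_adjoint adj_eqI by metis
lemma adj_mem [simp, intro]: "a \<in> N \<Longrightarrow> adj a \<in> N"
  using has_adjoint adj_eqI by metis
lemma zero_mem [simp, intro]: "0 \<in> N"
  using scaleC_mem[OF one_mem, of 0] by simp
lemma uminus_mem [simp, intro]: "a \<in> N \<Longrightarrow> - a \<in> N"
  using scaleC_mem[of a "-1"] by simp
lemma diff_mem [simp, intro]: "a \<in> N \<Longrightarrow> b \<in> N \<Longrightarrow> a - b \<in> N"
  using add_mem[of a "- b"] by simp
lemma power_mem [simp, intro]: "a \<in> N \<Longrightarrow> a ^ n \<in> N"
  by (induction n) auto
lemma sum_mem [intro]: "(\<And>i. i \<in> I \<Longrightarrow> f i \<in> N) \<Longrightarrow> sum f I \<in> N"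
  by (induction I rule: infinite_finite_induct) auto

lemma adj_adj [simp]: "a \<in> N \<Longrightarrow> adj (adj a) = a"
  by (rule adj_eqI, rule is_adjoint_sym, rule is_adjoint_adj)
lemma adj_add [simp]: "a \<in> N \<Longrightarrow> b \<in> N \<Longrightarrow> adj (a + b) = adj a + adj b"
  by (rule adj_eqI, rule is_adjoint_add) (rule is_adjoint_adj; assumption)+
lemma adj_mult [simp]: "a \<in> N \<Longrightarrow> b \<in> N \<Longrightarrow> adj (a * b) = adj b * adj a"
  by (rule adj_eqI, rule is_adjoint_mult) (rule is_adjoint_adj; assumption)+
lemma adj_scaleC [simp]: "a \<in> N \<Longrightarrow> adj (c *\<^sub>C a) = cnj c *\<^sub>C adj a"
  by (rule adj_eqI, rule is_adjoint_scaleC) (rule is_adjoint_adj; assumption)+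
lemma adj_uminus [simp]: "a \<in> N \<Longrightarrow> adj (- a) = - adj a"
  using adj_scaleC[of a "-1"] by simp
lemma adj_diff [simp]: "a \<in> N \<Longrightarrow> b \<in> N \<Longrightarrow> adj (a - b) = adj a - adj b"
  using adj_add[of a "- b"] by simp
lemma adj_one [simp]: "adj 1 = 1" by (rule adj_eqI, rule is_adjoint_one)

end

lemma unital_star_algebra_vN:
  assumes "von_neumann_algebra N" shows "unital_star_algebra N"
proof -
  have c: "commutant (commutant N) = N" using assms by (simp add: von_neumann_algebra_def)
  show ?thesis
    by unfold_locales
      (use assms c commutant_one[of "commutant N"] commutant_add[of _ "commutant N"]
        commutant_mult[of _ "commutant N"] commutant_scaleC[of _ "commutant N"]
       in \<open>auto simp: von_neumann_algebra_def\<close>)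
qed

lemma (in unital_star_algebra) star_alg_subset:
  assumes "S \<subseteq> N" shows "star_alg S \<subseteq> N"
proof
  fix a assume "a \<in> star_alg S"
  then show "a \<in> N"
    by induction (use assms adj_eqI adj_mem in auto)
qed

lemma (in unital_star_algebra) unital_star_algebra_star_alg:
  assumes "S \<subseteq> N" shows "unital_star_algebra (star_alg S)"
proof
  fix a assume "a \<in> star_alg S"
  then show "\<exists>b\<in>star_alg S. is_adjoint a b"
    using star_alg_subset[OF assms] is_adjoint_adj star_alg.adj by blast
qed (auto intro: star_alg.intros)

section \<open>The \<open>L\<^sup>2\<close>-norm of a tracial state\<close>

locale tracial_star_algebra = unital_star_algebra M for M :: "'h::complex_hilbert bop set" +
  fixes \<tau> :: "'h bop \<Rightarrow> complex"
  assumes tracial: "tracial_state M \<tau>"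
begin

lemma tr_add: "a \<in> M \<Longrightarrow> b \<in> M \<Longrightarrow> \<tau> (a + b) = \<tau> a + \<tau> b"
  and tr_scaleC: "a \<in> M \<Longrightarrow> \<tau> (c *\<^sub>C a) = c * \<tau> a"
  and tr_one [simp]: "\<tau> 1 = 1"
  and tr_pos: "a \<in> M \<Longrightarrow> \<tau> (adj a * a) \<in> \<real>\<^sub>\<ge>\<^sub>0"
  and tr_comm: "a \<in> M \<Longrightarrow> b \<in> M \<Longrightarrow> \<tau> (a * b) = \<tau> (b * a)"
  using tracial by (auto simp: tracial_state_def)

lemma tr_zero [simp]: "\<tau> 0 = 0" using tr_scaleC[of 1 0] by simp
lemma tr_uminus: "a \<in> M \<Longrightarrow> \<tau> (- a) = - \<tau> a"
  using tr_scaleC[of a "-1"] by simp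
lemma tr_diff: "a \<in> M \<Longrightarrow> b \<in> M \<Longrightarrow> \<tau> (a - b) = \<tau> a - \<tau> b"
  using tr_add[of a "-b"] by (simp add: tr_uminus)
lemma tr_sum: "(\<And>i. i \<in> I \<Longrightarrow> f i \<in> M) \<Longrightarrow> \<tau> (sum f I) = (\<Sum>i\<in>I. \<tau> (f i))"
  by (induction I rule: infinite_finite_induct) (auto simp: tr_add sum_mem)

abbreviation n2 :: "'h bop \<Rightarrow> real" where "n2 \<equiv> norm2 \<tau>"

lemma n2_nonneg [simp]: "n2 a \<ge> 0" if "a \<in> M"
  using tr_pos[OF that] by (auto simp: norm2_def nonneg_Reals_def)

lemma n2_sq: "a \<in> M \<Longrightarrow> \<tau> (adj a * a) = complex_of_real ((n2 a)\<^sup>2)"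
  using tr_pos[of a] by (auto simp: norm2_def nonneg_Reals_def simp flip: of_real_power)

lemma tr_sesqui:
  assumes "a \<in> M" "b \<in> M"
  shows "\<tau> (adj (a + c *\<^sub>C b) * (a + c *\<^sub>C b)) =
    \<tau> (adj a * a) + c * \<tau> (adj a * b) + cnj c * \<tau> (adj b * a) + c * cnj c * \<tau> (adj b * b)"
  using assms
  by (simp add: distrib_left distrib_right bop_scaleC_left bop_scaleC_right tr_add tr_scaleC)

text \<open>Polarisation: the form \<open>\<tau>(a\<^sup>* a)\<close> is real on \<open>a + b\<close> and on \<open>a + i b\<close>.\<close>

lemma tr_adj_mult:
  assumes "a \<in> M" "b \<in> M" shows "\<tau> (adj b * a) = cnj (\<tau> (adj a * b))"
proof -
  let ?A = "\<tau> (adj a * b)" and ?B = "\<tau> (adj b * a)"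
  have re: "Im (\<tau> (adj x * x)) = 0" if "x \<in> M" for x
    using tr_pos[OF that] by (auto simp: nonneg_Reals_def)
  have "Im (c * ?A + cnj c * ?B) = 0" for c
  proof -
    have "Im (\<tau> (adj (a + c *\<^sub>C b) * (a + c *\<^sub>C b))) = 0" using assms by (intro re) auto
    moreover have "Im (c * cnj c * \<tau> (adj b * b)) = 0"
      using re[of b] assms by (simp add: complex_mult_cnj)
    ultimately show ?thesis using assms re[of a] by (simp only: tr_sesqui) auto
  qed
  from this[of 1] this[of \<i>] show ?thesis by (simp add: complex_eq_iff)
qed

lemma tr_adj: "a \<in> M \<Longrightarrow> \<tau> (adj a) = cnj (\<tau> a)"
  using tr_adj_mult[of 1 a] by simp

lemma n2_adj [simp]: "a \<in> M \<Longrightarrow> n2 (adj a) = n2 a"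
  by (simp add: norm2_def tr_comm[of a "adj a"])

lemma cauchy_schwarz_adj:
  assumes "a \<in> M" "b \<in> M" shows "cmod (\<tau> (adj a * b)) \<le> n2 a * n2 b"
proof -
  let ?A = "\<tau> (adj a * b)"
  have pos: "0 \<le> (n2 a)\<^sup>2 + 2 * Re (c * ?A) + (cmod c)\<^sup>2 * (n2 b)\<^sup>2" for c
  proof -
    have "\<tau> (adj (a + c *\<^sub>C b) * (a + c *\<^sub>C b)) = of_real ((n2 a)\<^sup>2) + (c * ?A + cnj (c * ?A)) + of_real ((cmod c)\<^sup>2) * of_real ((n2 b)\<^sup>2)"
      using assms by (simp only: tr_sesqui tr_adj_mult[of a b] n2_sq complex_norm_square) simp
    also have "\<dots> = of_real ((n2 a)\<^sup>2 + 2 * Re (c * ?A) + (cmod c)\<^sup>2 * (n2 b)\<^sup>2)"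
      by (subst complex_add_cnj) (simp only: of_real_add of_real_mult)
    finally show ?thesis using tr_pos[of "a + c *\<^sub>C b"] assms
      by (simp add: nonneg_Reals_def image_iff del: of_real_add of_real_mult of_real_power)
  qed
  have key: "2 * s * cmod ?A \<le> (n2 a)\<^sup>2 + s\<^sup>2 * (n2 b)\<^sup>2" for s :: real
  proof (cases "?A = 0")
    case False
    define c where "c = - (of_real s * cnj ?A / of_real (cmod ?A))"
    have "c * ?A = - of_real s * (?A * cnj ?A) / of_real (cmod ?A)" by (simp add: c_def)
    also have "\<dots> = - of_real (s * cmod ?A)"
      using False by (simp only: complex_norm_square[symmetric]) (simp add: power2_eq_square)
    finally have 1: "Re (c * ?A) = - s * cmod ?A" by simp
    have "(cmod c)\<^sup>2 = s\<^sup>2" using False by (simp add: c_def norm_divide norm_mult)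
    then show ?thesis using pos[of c] 1 by simp
  qed simp
  have [simp]: "n2 a \<ge> 0" "n2 b \<ge> 0" using assms by auto
  show ?thesis
  proof (cases "n2 b = 0")
    case True
    show ?thesis
    proof (rule ccontr)
      assume "\<not> ?thesis"
      then have "cmod ?A > 0" using True by simp
      then have "2 * ((n2 a)\<^sup>2 + 1) \<le> (n2 a)\<^sup>2"
        using key[of "((n2 a)\<^sup>2 + 1) / cmod ?A"] True by simp
      moreover have "\<not> 2 * (y + 1) \<le> y" if "0 \<le> y" for y :: real using that by simp
      ultimately show False using zero_le_power2[of "n2 a"] by blast
    qed
  next
    case False
    then have pos: "(n2 b)\<^sup>2 > 0" by simp
    define s where "s = cmod ?A / (n2 b)\<^sup>2"
    have "s\<^sup>2 * (n2 b)\<^sup>2 = s * cmod ?A"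
      using pos False by (simp add: s_def power2_eq_square)
    then have "s * cmod ?A \<le> (n2 a)\<^sup>2" using key[of s] by simp
    then have "(cmod ?A)\<^sup>2 \<le> (n2 a * n2 b)\<^sup>2"
      using pos by (simp add: s_def power2_eq_square field_simps)
    then show ?thesis by (rule power2_le_imp_le) simp
  qed
qed

lemma cauchy_schwarz: "a \<in> M \<Longrightarrow> b \<in> M \<Longrightarrow> cmod (\<tau> (a * b)) \<le> n2 a * n2 b"
  using cauchy_schwarz_adj[of "adj a" b] by simp

lemma n2_one [simp]: "n2 1 = 1" by (simp add: norm2_def)
lemma n2_zero [simp]: "n2 0 = 0" by (simp add: norm2_def)

lemma tr_le_n2: "a \<in> M \<Longrightarrow> cmod (\<tau> a) \<le> n2 a"
  using cauchy_schwarz[of 1 a] by simp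

lemma n2_scaleC: "a \<in> M \<Longrightarrow> n2 (c *\<^sub>C a) = cmod c * n2 a"
proof -
  assume a: "a \<in> M"
  have "adj (c *\<^sub>C a) * (c *\<^sub>C a) = (c * cnj c) *\<^sub>C (adj a * a)"
    using a by (simp add: bop_scaleC_left bop_scaleC_right scaleC_scaleC mult.commute)
  then have "\<tau> (adj (c *\<^sub>C a) * (c *\<^sub>C a)) = of_real ((cmod c)\<^sup>2 * (n2 a)\<^sup>2)"
    using a by (simp add: tr_scaleC n2_sq complex_norm_square del: of_real_power)
  then show ?thesis using a unfolding norm2_def[of _ "c *\<^sub>C a"]
    by (simp add: real_sqrt_mult del: of_real_mult)
qed

lemma n2_uminus [simp]: "a \<in> M \<Longrightarrow> n2 (- a) = n2 a"
  using n2_scaleC[of a "-1"] by simp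

lemma n2_triangle: 
  assumes a: "a \<in> M" "b \<in> M" shows "n2 (a + b) \<le> n2 a + n2 b"
proof -
  have "of_real ((n2 (a + b))\<^sup>2) = \<tau> (adj (a + 1 *\<^sub>C b) * (a + 1 *\<^sub>C b))"
    using n2_sq[of "a + b"] a by (simp add: scaleC_one)
  also have "\<dots> = of_real ((n2 a)\<^sup>2 + 2 * Re (\<tau> (adj a * b)) + (n2 b)\<^sup>2)"
    using a by (subst tr_sesqui) (simp_all add: tr_adj_mult[of a b] n2_sq complex_eq_iff)
  finally have "(n2 (a + b))\<^sup>2 = (n2 a)\<^sup>2 + 2 * Re (\<tau> (adj a * b)) + (n2 b)\<^sup>2"
    unfolding of_real_eq_iff .
  also have "Re (\<tau> (adj a * b)) \<le> n2 a * n2 b"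
    using cauchy_schwarz_adj[OF a] complex_Re_le_cmod order_trans by blast
  finally have "(n2 (a + b))\<^sup>2 \<le> (n2 a + n2 b)\<^sup>2" by (simp add: power2_eq_square algebra_simps)
  then show ?thesis using a by (meson abs_le_square_iff power2_le_imp_le n2_nonneg add_nonneg_nonneg)
qed

lemma n2_diff: "a \<in> M \<Longrightarrow> b \<in> M \<Longrightarrow> n2 (a - b) \<le> n2 a + n2 b"
  using n2_triangle[of a "- b"] by simp

lemma n2_sum: "(\<And>i. i \<in> I \<Longrightarrow> f i \<in> M) \<Longrightarrow> n2 (sum f I) \<le> (\<Sum>i\<in>I. n2 (f i))"
proof (induction I rule: infinite_finite_induct)
  case (insert x F)
  then have "n2 (f x + sum f F) \<le> n2 (f x) + n2 (sum f F)"
    by (intro n2_triangle sum_mem) auto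
  with insert show ?case by fastforce
qed auto

text \<open>The operator norm of left multiplication on \<open>L\<^sup>2(\<tau>)\<close>. It stands in for the norm on the Hilbert
  space because it can be estimated by traces alone; for isometries, projections and semicircular
  elements this gives the sharp constants.\<close>

definition op_bound :: "real \<Rightarrow> 'h bop \<Rightarrow> bool" where
  "op_bound K a \<longleftrightarrow> a \<in> M \<and> K \<ge> 0 \<and> (\<forall>y\<in>M. n2 (a * y) \<le> K * n2 y)"

lemma op_bound_mem: "op_bound K a \<Longrightarrow> a \<in> M" and op_bound_nonneg: "op_bound K a \<Longrightarrow> 0 \<le> K"
  and op_boundD: "op_bound K a \<Longrightarrow> y \<in> M \<Longrightarrow> n2 (a * y) \<le> K * n2 y"
  by (auto simp: op_bound_def)

lemma op_bound_n2: "op_bound K a \<Longrightarrow> n2 a \<le> K"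
  using op_boundD[of K a 1] by simp

lemma op_bound_mult:
  assumes "op_bound K a" "op_bound L b" shows "op_bound (K * L) (a * b)"
  unfolding op_bound_def
proof (intro conjI ballI)
  fix y assume y: "y \<in> M"
  have "n2 (a * (b * y)) \<le> K * n2 (b * y)" using assms y by (intro op_boundD) (auto simp: op_bound_def)
  also have "\<dots> \<le> K * (L * n2 y)" using assms y by (intro mult_left_mono op_boundD) (auto simp: op_bound_def)
  finally show "n2 (a * b * y) \<le> K * L * n2 y" by (simp add: mult.assoc)
qed (use assms in \<open>auto simp: op_bound_def\<close>)

lemma op_bound_add:
  assumes "op_bound K a" "op_bound L b" shows "op_bound (K + L) (a + b)"
  unfolding op_bound_def
proof (intro conjI ballI)
  fix y assume y: "y \<in> M"
  have "n2 ((a + b) * y) \<le> n2 (a * y) + n2 (b * y)"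
    using assms y by (subst distrib_right, intro n2_triangle) (auto simp: op_bound_def)
  also have "\<dots> \<le> K * n2 y + L * n2 y" using assms y by (intro add_mono op_boundD)
  finally show "n2 ((a + b) * y) \<le> (K + L) * n2 y" by (simp add: algebra_simps)
qed (use assms in \<open>auto simp: op_bound_def\<close>)

lemma op_bound_scaleC: "op_bound K a \<Longrightarrow> op_bound (cmod c * K) (c *\<^sub>C a)"
  unfolding op_bound_def by (auto simp: bop_scaleC_left n2_scaleC mult.assoc intro: mult_left_mono)

text \<open>Since \<open>\<parallel>a\<^sup>* y\<parallel>\<^sup>2 = \<tau>(y\<^sup>* a a\<^sup>* y) \<le> \<parallel>y\<parallel> K \<parallel>a\<^sup>* y\<parallel>\<close>. Together with the trace property it bounds right
  multiplication as well.\<close>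

lemma op_bound_adj:
  assumes "op_bound K a" shows "op_bound K (adj a)"
  unfolding op_bound_def
proof (intro conjI ballI)
  show "adj a \<in> M" "K \<ge> 0" using assms by (auto simp: op_bound_def)
  fix y assume y: "y \<in> M"
  have a: "a \<in> M" using assms by (rule op_bound_mem)
  let ?z = "adj a * y"
  have z: "?z \<in> M" using a y by auto
  have "of_real ((n2 ?z)\<^sup>2) = \<tau> (adj y * (a * ?z))"
    using n2_sq[OF z] a y by (simp add: mult.assoc)
  then have "(n2 ?z)\<^sup>2 = cmod (\<tau> (adj y * (a * ?z)))"
    by (metis norm_of_real abs_of_nonneg zero_le_power2)
  also have "\<dots> \<le> n2 y * n2 (a * ?z)" using a y z by (intro cauchy_schwarz_adj) auto
  also have "\<dots> \<le> n2 y * (K * n2 ?z)" using assms z y by (intro mult_left_mono op_boundD) auto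
  finally have "n2 ?z * n2 ?z \<le> (K * n2 y) * n2 ?z" by (simp add: power2_eq_square mult_ac)
  then show "n2 ?z \<le> K * n2 y"
    using z y assms by (cases "n2 ?z = 0") (auto simp: op_bound_def order_less_le)
qed

lemma op_bound_right:
  assumes "op_bound K a" "y \<in> M" shows "n2 (y * a) \<le> K * n2 y"
  using op_boundD[OF op_bound_adj[OF assms(1)], of "adj y"] assms op_bound_mem[OF assms(1)]
  by (metis adj_mult n2_adj adj_mem mult_mem)

lemma op_bound_one: "op_bound 1 1" by (simp add: op_bound_def)

lemma op_bound_isometry:
  assumes "a \<in> M" "adj a * a = 1" shows "op_bound 1 a"
proof -
  have "n2 (a * y) = n2 y" if "y \<in> M" for y
  proof -
    have "adj (a * y) * (a * y) = adj y * ((adj a * a) * y)" using assms(1) that by (simp add: mult.assoc)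
    then show ?thesis using assms by (simp add: norm2_def)
  qed
  then show ?thesis using assms by (simp add: op_bound_def)
qed

lemma op_bound_projection:
  assumes "a \<in> M" "adj a = a" "a * a = a" shows "op_bound 1 a"
proof -
  have "n2 (a * y) \<le> 1 * n2 y" if y: "y \<in> M" for y
  proof -
    have "of_real ((n2 (a * y))\<^sup>2) = \<tau> (adj y * (a * a * y))"
      using n2_sq[of "a * y"] assms(1,2) y by (simp add: mult.assoc)
    also have "\<dots> = \<tau> (adj y * (a * y))" using assms by simp
    finally have "(n2 (a * y))\<^sup>2 = cmod (\<tau> (adj y * (a * y)))"
      by (metis norm_of_real abs_of_nonneg zero_le_power2)
    also have "\<dots> \<le> n2 y * n2 (a * y)" using assms y by (intro cauchy_schwarz_adj) auto
    finally have "n2 (a * y) * n2 (a * y) \<le> n2 y * n2 (a * y)" by (simp add: power2_eq_square)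
    then show ?thesis using y assms(1) 
      by (cases "n2 (a * y) = 0") (auto simp: order_less_le)
  qed
  then show ?thesis using assms by (auto simp: op_bound_def)
qed

lemma op_bound_power: "op_bound 1 a \<Longrightarrow> op_bound 1 (a ^ n)"
  by (induction n) (use op_bound_one op_bound_mult[of 1 a 1] in auto)

end

section \<open>Operator norms from moments, and freeness\<close>

text \<open>The ratios of a log-convex sequence increase, so the first ratio is at most the exponential growth
  rate.\<close>

lemma log_convex_growth:
  fixes b :: "nat \<Rightarrow> real"
  assumes pos: "\<And>k. 0 \<le> b k" and conv: "\<And>k. (b (Suc k))\<^sup>2 \<le> b k * b (Suc (Suc k))"
    and bd: "\<And>k. b k \<le> C * R ^ k" and R: "0 \<le> R"
  shows "b 1 \<le> R * b 0"
proof (rule ccontr)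
  assume neg: "\<not> ?thesis"
  have b0: "b 0 > 0"
  proof (rule ccontr)
    assume "\<not> b 0 > 0"
    then have "b 0 = 0" using pos[of 0] by simp
    then show False using conv[of 0] neg by simp
  qed
  define \<rho> where "\<rho> = b 1 / b 0"
  have \<rho>: "\<rho> > R" using neg b0 by (simp add: \<rho>_def field_simps)
  have step: "b k > 0 \<and> b (Suc k) \<ge> \<rho> * b k" for k
  proof (induction k)
    case 0 then show ?case using b0 by (simp add: \<rho>_def)
  next
    case (Suc k)
    have 1: "b (Suc k) > 0" using Suc \<rho> R by (smt (verit) mult_pos_pos)
    have "\<rho> * b k * b (Suc k) \<le> b (Suc k) * b (Suc k)" using Suc 1 by (intro mult_right_mono) auto
    also have "\<dots> \<le> b k * b (Suc (Suc k))" using conv[of k] by (simp add: power2_eq_square)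
    finally have "b k * (\<rho> * b (Suc k)) \<le> b k * b (Suc (Suc k))" by (simp add: mult_ac)
    then show ?case using Suc 1 by simp
  qed
  have low: "\<rho> ^ k * b 0 \<le> b k" for k
  proof (induction k)
    case (Suc k)
    have "\<rho> ^ Suc k * b 0 = \<rho> * (\<rho> ^ k * b 0)" by simp
    also have "\<dots> \<le> \<rho> * b k" using Suc \<rho> R by (intro mult_left_mono) auto
    also have "\<dots> \<le> b (Suc k)" using step by blast
    finally show ?case .
  qed simp
  show False
  proof (cases "R = 0")
    case True
    moreover have "\<rho> * b 0 > 0" using True \<rho> b0 by (intro mult_pos_pos) auto
    ultimately show False using low[of 1] bd[of 1] by simp
  next
    case False
    then have R: "R > 0" using R by simp
    have "1 < \<rho> / R" using \<rho> R by simp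
    then obtain n where n: "C / b 0 < (\<rho> / R) ^ n" using real_arch_pow by blast
    have "\<rho> ^ n * b 0 \<le> C * R ^ n" using low[of n] bd[of n] by linarith
    then show False using n R b0 by (simp add: field_simps power_divide)
  qed
qed

context tracial_star_algebra begin

text \<open>The sequence \<open>k \<mapsto> \<parallel>x\<^sup>k y\<parallel>\<close> is log-convex by Cauchy-Schwarz, and its growth rate is at most \<open>R\<close> because
  \<open>\<parallel>x\<^sup>k y\<parallel>\<^sup>2 = \<tau>(y y\<^sup>* x\<^bsup>2k\<^esup>)\<close> is controlled by the moments of \<open>x\<close>; hence already its first ratio is.\<close>

lemma op_bound_of_moments:
  assumes x: "x \<in> M" "adj x = x" and R: "0 \<le> R" and mom: "\<And>k. cmod (\<tau> (x ^ (2 * k))) \<le> R ^ (2 * k)"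
  shows "op_bound R x"
  unfolding op_bound_def
proof (intro conjI ballI x R)
  fix y assume y: "y \<in> M"
  have adjp: "adj (x ^ k) = x ^ k" for k
    by (induction k) (use x in \<open>auto simp: power_commutes\<close>)
  have sq: "(n2 (x ^ k))\<^sup>2 \<le> (R ^ k)\<^sup>2" for k
  proof -
    have "of_real ((n2 (x ^ k))\<^sup>2) = \<tau> (x ^ (2 * k))"
      using n2_sq[of "x ^ k"] x by (simp add: adjp power_add[symmetric] mult_2)
    then have "(n2 (x ^ k))\<^sup>2 = cmod (\<tau> (x ^ (2 * k)))"
      by (metis norm_of_real abs_of_nonneg zero_le_power2)
    also have "\<dots> \<le> (R ^ k)\<^sup>2" using mom[of k] by (simp add: power_mult mult.commute)
    finally show ?thesis .
  qed
  have n2p: "n2 (x ^ k) \<le> R ^ k" for k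
    by (rule power2_le_imp_le[OF sq]) (use R in simp)
  define b where "b k = n2 (x ^ k * y)" for k
  have ip: "\<tau> (adj (x ^ i * y) * (x ^ j * y)) = \<tau> (adj y * x ^ (i + j) * y)" for i j
    using x y by (simp add: adjp mult.assoc power_add)
  have bsq: "of_real ((b k)\<^sup>2) = \<tau> (adj y * x ^ (k + k) * y)" for k
    using n2_sq[of "x ^ k * y"] ip[of k k] x y by (simp add: b_def)
  have "b 1 \<le> R * b 0"
  proof (rule log_convex_growth[where C = "sqrt (n2 (y * adj y))"])
    show "0 \<le> b k" for k using x y by (simp add: b_def)
    show "(b (Suc k))\<^sup>2 \<le> b k * b (Suc (Suc k))" for k
    proof -
      have "of_real ((b (Suc k))\<^sup>2) = \<tau> (adj (x ^ k * y) * (x ^ (Suc (Suc k)) * y))"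
        unfolding bsq ip by simp
      then have "(b (Suc k))\<^sup>2 = cmod (\<tau> (adj (x ^ k * y) * (x ^ (Suc (Suc k)) * y)))"
        by (metis norm_of_real abs_of_nonneg zero_le_power2)
      then show ?thesis using cauchy_schwarz_adj[of "x ^ k * y" "x ^ (Suc (Suc k)) * y"] x y
        by (simp add: b_def)
    qed
    show "b k \<le> sqrt (n2 (y * adj y)) * R ^ k" for k
    proof (rule power2_le_imp_le)
      have "of_real ((b k)\<^sup>2) = \<tau> (y * adj y * x ^ (k + k))"
        unfolding bsq using x y tr_comm[of y "adj y * x ^ (k + k)"] tr_comm[of "adj y * x ^ (k + k)" y]
        by (simp add: mult.assoc)
      then have "(b k)\<^sup>2 = cmod (\<tau> (y * adj y * x ^ (k + k)))"
        by (metis norm_of_real abs_of_nonneg zero_le_power2)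
      also have "\<dots> \<le> n2 (y * adj y) * n2 (x ^ (k + k))" using x y by (intro cauchy_schwarz) auto
      also have "\<dots> \<le> n2 (y * adj y) * R ^ (k + k)" using y by (intro mult_left_mono n2p) auto
      also have "R ^ (k + k) = (R ^ k)\<^sup>2" by (simp add: power_add power2_eq_square)
      finally show "(b k)\<^sup>2 \<le> (sqrt (n2 (y * adj y)) * R ^ k)\<^sup>2"
        using y by (simp add: power_mult_distrib)
      show "0 \<le> sqrt (n2 (y * adj y)) * R ^ k" using y R by auto
    qed
  qed (rule R)
  then show "n2 (x * y) \<le> R * n2 y" by (simp add: b_def)
qed

lemma free_mult:
  assumes fr: "free \<tau> [A, B]" and A: "unital_star_algebra A" "A \<subseteq> M" and B: "unital_star_algebra B" "B \<subseteq> M"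
    and a: "a \<in> A" and b: "b \<in> B"
  shows "\<tau> (a * b) = \<tau> a * \<tau> b"
proof -
  interpret A: unital_star_algebra A by fact
  interpret B: unital_star_algebra B by fact
  have m: "a \<in> M" "b \<in> M" using assms by auto
  let ?a = "a - \<tau> a *\<^sub>C 1" and ?b = "b - \<tau> b *\<^sub>C 1"
  have "\<tau> (prod_list (map snd [(0::nat, ?a), (1, ?b)])) = 0"
    by (rule fr[unfolded free_def, rule_format]) (use a b m in \<open>auto simp: tr_diff tr_scaleC\<close>)
  then show ?thesis using m
    by (simp add: left_diff_distrib right_diff_distrib tr_diff tr_scaleC bop_scaleC_left bop_scaleC_right)
qed

text \<open>The rule behind the free Ito correction: freeness, applied to \<open>a - \<tau>(a)\<close>, \<open>b\<close>, \<open>a' - \<tau>(a')\<close>, \<open>b\<close>, leaves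
  only terms in which the two factors \<open>b\<close> are adjacent.\<close>

lemma free_sandwich:
  assumes fr: "free \<tau> [A, B]" and A: "unital_star_algebra A" "A \<subseteq> M" and B: "unital_star_algebra B" "B \<subseteq> M"
    and a: "a \<in> A" "a' \<in> A" and b: "b \<in> B" "\<tau> b = 0"
  shows "\<tau> (a * b * a' * b) = \<tau> a * \<tau> a' * \<tau> (b * b)"
proof -
  interpret A: unital_star_algebra A by fact
  interpret B: unital_star_algebra B by fact
  have m: "a \<in> M" "a' \<in> M" "b \<in> M" using assms by auto
  let ?a = "a - \<tau> a *\<^sub>C 1" and ?a' = "a' - \<tau> a' *\<^sub>C 1"
  have "\<tau> (prod_list (map snd [(0::nat, ?a), (1, b), (0, ?a'), (1, b)])) = 0"
    by (rule fr[unfolded free_def, rule_format]) (use a b m in \<open>auto simp: tr_diff tr_scaleC\<close>)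
  then have "\<tau> (a * b * a' * b) - \<tau> a * \<tau> (b * a' * b) - (\<tau> a' * \<tau> (a * (b * b)) - \<tau> a' * (\<tau> a * \<tau> (b * b))) = 0"
    using m by (simp add: left_diff_distrib right_diff_distrib tr_diff tr_scaleC bop_scaleC_left bop_scaleC_right
        mult.assoc)
  then have 1: "\<tau> (a * b * a' * b) = \<tau> a * \<tau> (b * a' * b) + \<tau> a' * \<tau> (a * (b * b)) - \<tau> a * \<tau> a' * \<tau> (b * b)"
    by (simp add: algebra_simps)
  have "\<tau> (b * a' * b) = \<tau> (a' * (b * b))" using m tr_comm[of b "a' * b"] by (simp add: mult.assoc)
  also have "\<dots> = \<tau> a' * \<tau> (b * b)" by (rule free_mult[OF fr A B]) (use a b in auto)
  finally have 2: "\<tau> (b * a' * b) = \<tau> a' * \<tau> (b * b)" .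
  have 3: "\<tau> (a * (b * b)) = \<tau> a * \<tau> (b * b)" by (rule free_mult[OF fr A B]) (use a b in auto)
  show ?thesis unfolding 1 2 3 by (simp add: algebra_simps)
qed

end

section \<open>Moments of the semicircle law\<close>

lemma semicircle_second_moment_integral:
  fixes R :: real assumes R: "R > 0"
  shows "((\<lambda>y. y\<^sup>2 * sqrt (R\<^sup>2 - y\<^sup>2)) has_integral pi * R ^ 4 / 8) {-R..R}"
proof -
  \<comment> \<open>an antiderivative, obtained from the substitution \<open>y = R sin \<theta>\<close>\<close>
  define H where "H y = R ^ 4 / 8 * arcsin (y / R) - y * (R\<^sup>2 - 2 * y\<^sup>2) * sqrt (R\<^sup>2 - y\<^sup>2) / 8" for y
  have "((\<lambda>y. y\<^sup>2 * sqrt (R\<^sup>2 - y\<^sup>2)) has_integral (H R - H (-R))) {-R..R}"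
  proof (rule fundamental_theorem_of_calculus_interior)
    show "-R \<le> R" using R by simp
    show "continuous_on {-R..R} H"
      unfolding H_def using R
      by (intro continuous_intros) (auto simp: divide_le_eq le_divide_eq)
    fix y assume y: "y \<in> {-R<..<R}"
    then have lt: "y\<^sup>2 < R\<^sup>2" using R by (intro abs_less_iff[THEN iffD2, THEN power_strict_mono, of y R 2, unfolded power2_abs]) auto
    define s where "s = sqrt (R\<^sup>2 - y\<^sup>2)"
    have s: "s > 0" "s\<^sup>2 = R\<^sup>2 - y\<^sup>2" using lt by (auto simp: s_def)
    have c: "sqrt (1 - (y / R)\<^sup>2) = s / R"
    proof -
      have "1 - (y / R)\<^sup>2 = (R\<^sup>2 - y\<^sup>2) / R\<^sup>2" using R by (simp add: field_simps)
      then show ?thesis using R by (simp add: real_sqrt_divide s_def)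
    qed
    have "(H has_real_derivative (R ^ 4 / 8 * (inverse (sqrt (1 - (y / R)\<^sup>2)) * (1 / R))
       - (((R\<^sup>2 - 2 * y\<^sup>2) + y * (- 4 * y)) * s + y * (R\<^sup>2 - 2 * y\<^sup>2) * (- y / s)) / 8)) (at y)"
      unfolding H_def s_def using y R lt
      by (auto intro!: derivative_eq_intros simp: divide_simps) 
    also have "(R ^ 4 / 8 * (inverse (sqrt (1 - (y / R)\<^sup>2)) * (1 / R))
       - (((R\<^sup>2 - 2 * y\<^sup>2) + y * (- 4 * y)) * s + y * (R\<^sup>2 - 2 * y\<^sup>2) * (- y / s)) / 8)
       = (R ^ 4 - (R\<^sup>2 - 6 * y\<^sup>2) * s\<^sup>2 + y\<^sup>2 * (R\<^sup>2 - 2 * y\<^sup>2)) / (8 * s)"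
      unfolding c using s(1) R by (simp add: field_simps power2_eq_square power4_eq_xxxx)
    also have "\<dots> = 8 * y\<^sup>2 * s\<^sup>2 / (8 * s)"
      unfolding s(2) by (rule arg_cong2[where f = "(/)"]) (simp_all add: algebra_simps power2_eq_square power4_eq_xxxx)
    also have "\<dots> = y\<^sup>2 * s" using s(1) by (simp add: power2_eq_square)
    also have "\<dots> = y\<^sup>2 * sqrt (R\<^sup>2 - y\<^sup>2)" by (simp add: s_def)
    finally show "(H has_vector_derivative y\<^sup>2 * sqrt (R\<^sup>2 - y\<^sup>2)) (at y)"
      by (simp add: has_real_derivative_iff_has_vector_derivative)
  qed
  moreover have "H R - H (-R) = pi * R ^ 4 / 8" using R by (simp add: H_def)
  ultimately show ?thesis by simp
qed

context fixes v :: real assumes v: "v > 0" begin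

definition sc_dens :: "real \<Rightarrow> real" where
  "sc_dens y = indicator {- 2 * sqrt v..2 * sqrt v} y * sqrt (4 * v - y\<^sup>2) / (2 * pi * v)"

lemma sc_dens_nonneg: "sc_dens y \<ge> 0"
proof (cases "y \<in> {- 2 * sqrt v..2 * sqrt v}")
  case True
  then have "\<bar>y\<bar> \<le> 2 * sqrt v" by auto
  then have "\<bar>y\<bar>\<^sup>2 \<le> (2 * sqrt v)\<^sup>2" by (intro power_mono) auto
  then show ?thesis using v by (simp add: sc_dens_def power_mult_distrib)
qed (simp add: sc_dens_def)

lemma sc_dens_measurable [measurable]: "sc_dens \<in> borel_measurable borel"
  unfolding sc_dens_def by measurable

lemma semicircle_eq: "semicircle_law v = density lborel (\<lambda>y. ennreal (sc_dens y))"
  by (simp add: semicircle_law_def sc_dens_def)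

lemma sc_integral: "f \<in> borel_measurable borel \<Longrightarrow> (\<integral>y. f y \<partial>semicircle_law v) = (\<integral>y. sc_dens y * f y \<partial>lborel :: real)"
  unfolding semicircle_eq by (subst integral_density) (auto simp: sc_dens_nonneg)

lemma semicircle_mean: "(\<integral>y. y \<partial>semicircle_law v) = (0::real)"
proof -
  have "(\<integral>y. sc_dens y * y \<partial>lborel) = (\<integral>y. sc_dens (0 + (-1) * y) * (0 + (-1) * y) \<partial>lborel)"
    using lborel_integral_real_affine[of "-1" "\<lambda>y. sc_dens y * y" 0] by simp
  also have "\<dots> = - (\<integral>y. sc_dens y * y \<partial>lborel)"
    by (subst integral_minus[symmetric], intro Bochner_Integration.integral_cong)
      (auto simp: sc_dens_def indicator_def)
  finally show ?thesis by (subst sc_integral) auto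
qed

lemma semicircle_variance: "(\<integral>y. y\<^sup>2 \<partial>semicircle_law v) = v"
proof -
  define R where "R = 2 * sqrt v"
  have R: "R > 0" "R\<^sup>2 = 4 * v" "R ^ 4 = 16 * v\<^sup>2"
    using v by (auto simp: R_def power_mult_distrib power4_eq_xxxx power2_eq_square)
  have "((\<lambda>y. y\<^sup>2 * sqrt (R\<^sup>2 - y\<^sup>2) / (2 * pi * v)) has_integral (pi * R ^ 4 / 8) / (2 * pi * v)) {-R..R}"
    by (intro has_integral_divide semicircle_second_moment_integral R)
  also have "(pi * R ^ 4 / 8) / (2 * pi * v) = v" using v by (simp add: R field_simps power2_eq_square)
  finally have "((\<lambda>y. if y \<in> {-R..R} then y\<^sup>2 * sqrt (R\<^sup>2 - y\<^sup>2) / (2 * pi * v) else 0) has_integral v) UNIV"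
    by (rule has_integral_restrict_UNIV[THEN iffD2])
  also have "(\<lambda>y. if y \<in> {-R..R} then y\<^sup>2 * sqrt (R\<^sup>2 - y\<^sup>2) / (2 * pi * v) else 0) = (\<lambda>y. sc_dens y * y\<^sup>2)"
    unfolding R(2) by (auto simp: sc_dens_def R_def fun_eq_iff)
  finally have "has_bochner_integral lborel (\<lambda>y. sc_dens y * y\<^sup>2) v"
    by (intro has_bochner_integral_nn_integral nn_integral_has_integral_lborel)
      (use v sc_dens_nonneg in auto)
  then show ?thesis by (subst sc_integral) (auto dest: has_bochner_integral_integral_eq)
qed

lemma semicircle_even_moment:
  assumes "real_distribution (semicircle_law v)"
  shows "\<bar>\<integral>y. y ^ (2 * k) \<partial>semicircle_law v\<bar> \<le> (2 * sqrt v) ^ (2 * k)"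
proof -
  interpret real_distribution "semicircle_law v" by fact
  have AE: "AE y in semicircle_law v. \<bar>y\<bar> \<le> 2 * sqrt v"
    unfolding semicircle_eq by (subst AE_density) (auto simp: sc_dens_def indicator_def)
  have le: "AE y in semicircle_law v. y ^ (2 * k) \<le> (2 * sqrt v) ^ (2 * k)"
    using AE
  proof eventually_elim
    case (elim y)
    then have "\<bar>y\<bar> ^ (2 * k) \<le> (2 * sqrt v) ^ (2 * k)" by (intro power_mono) auto
    then show ?case by (simp add: power_even_abs)
  qed
  have 0: "0 \<le> (\<integral>y. y ^ (2 * k) \<partial>semicircle_law v)"
    by (intro integral_nonneg_AE) auto
  have "(\<integral>y. y ^ (2 * k) \<partial>semicircle_law v) \<le> (\<integral>y. (2 * sqrt v) ^ (2 * k) \<partial>semicircle_law v)"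
    using le by (intro integral_mono_AE' ) (auto)
  moreover have "prob UNIV = 1" using prob_space by simp
  ultimately show ?thesis using 0 by simp
qed

end

section \<open>Orders of magnitude for small time steps\<close>

text \<open>The relation \<open>f(h) = o(h)\<close> as \<open>h\<close> decreases to zero.\<close>

definition negligible :: "(real \<Rightarrow> complex) \<Rightarrow> bool" where
  "negligible f \<longleftrightarrow> (\<forall>\<eta>>0. \<forall>\<^sub>F h in at_right 0. cmod (f h) \<le> \<eta> * h)"

lemma eventually_pos_at_right: "\<forall>\<^sub>F h in at_right (0::real). h > 0"
  by (simp add: eventually_at_right_less)

lemma negligible_0 [simp]: "negligible (\<lambda>h. 0)"
  unfolding negligible_def by (auto intro!: eventually_mono[OF eventually_pos_at_right])

lemma negligible_add:
  assumes "negligible f" "negligible g" shows "negligible (\<lambda>h. f h + g h)"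
  unfolding negligible_def
proof (intro allI impI)
  fix \<eta> :: real assume "\<eta> > 0"
  then have "\<forall>\<^sub>F h in at_right 0. cmod (f h) \<le> \<eta> / 2 * h" "\<forall>\<^sub>F h in at_right 0. cmod (g h) \<le> \<eta> / 2 * h"
    using assms unfolding negligible_def by (metis half_gt_zero)+
  then show "\<forall>\<^sub>F h in at_right 0. cmod (f h + g h) \<le> \<eta> * h"
  proof eventually_elim
    case (elim h)
    then show ?case using norm_triangle_ineq[of "f h" "g h"] by (simp add: field_simps)
  qed
qed

lemma negligible_bound:
  assumes g: "negligible g" and le: "\<forall>\<^sub>F h in at_right 0. cmod (f h) \<le> C * cmod (g h)"
  shows "negligible f"
  unfolding negligible_def
proof (intro allI impI)
  fix \<eta> :: real assume \<eta>: "\<eta> > 0"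
  define C' where "C' = max 1 C"
  have C': "C' > 0" "C \<le> C'" by (auto simp: C'_def)
  have "\<eta> / C' > 0" using \<eta> C' by simp
  then have "\<forall>\<^sub>F h in at_right 0. cmod (g h) \<le> \<eta> / C' * h" using g unfolding negligible_def by blast
  with le show "\<forall>\<^sub>F h in at_right 0. cmod (f h) \<le> \<eta> * h"
  proof eventually_elim
    case (elim h)
    have "cmod (f h) \<le> C' * cmod (g h)" using elim(1) C'(2) by (meson mult_right_mono norm_ge_zero order_trans)
    also have "\<dots> \<le> C' * (\<eta> / C' * h)" using elim(2) C' by (intro mult_left_mono) auto
    finally show ?case using C' by simp
  qed
qed

lemma negligible_cmult: "negligible f \<Longrightarrow> negligible (\<lambda>h. c * f h)"
  by (rule negligible_bound[of f _ "cmod c"]) (simp_all add: norm_mult)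

lemma negligible_minus: "negligible f \<Longrightarrow> negligible (\<lambda>h. - f h)"
  by (rule negligible_bound[of f _ 1]) simp_all

lemma negligible_diff: "negligible f \<Longrightarrow> negligible g \<Longrightarrow> negligible (\<lambda>h. f h - g h)"
  using negligible_add[of f "\<lambda>h. - g h"] negligible_minus[of g] by simp

lemma negligible_cnj: "negligible f \<Longrightarrow> negligible (\<lambda>h. cnj (f h))"
  by (simp add: negligible_def)

lemma negligible_sum: "(\<And>i. i \<in> I \<Longrightarrow> negligible (f i)) \<Longrightarrow> negligible (\<lambda>h. \<Sum>i\<in>I. f i h)"
  by (induction I rule: infinite_finite_induct) (auto intro: negligible_add)

lemma negligible_cong_pos:
  assumes "negligible f" "\<And>h. h > 0 \<Longrightarrow> f h = g h" shows "negligible g"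
  by (rule negligible_bound[OF assms(1), of _ 1])
    (use assms(2) in \<open>auto intro!: eventually_mono[OF eventually_pos_at_right]\<close>)

context tracial_star_algebra begin

definition op_bounded :: "'h bop \<Rightarrow> bool" where "op_bounded a \<longleftrightarrow> (\<exists>K. op_bound K a)"

lemma op_bounded_mem: "op_bounded a \<Longrightarrow> a \<in> M" by (auto simp: op_bounded_def op_bound_mem)

lemma op_bounded_star_alg:
  assumes "\<And>a. a \<in> S \<Longrightarrow> op_bounded a" shows "a \<in> star_alg S \<Longrightarrow> op_bounded a"
proof (induction rule: star_alg.induct)
  case (adj a b)
  then show ?case using op_bound_adj adj_eqI unfolding op_bounded_def by metis
qed (use assms op_bound_one op_bound_add op_bound_mult op_bound_scaleC in \<open>auto simp: op_bounded_def; blast\<close>)+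

definition bounded_family :: "(real \<Rightarrow> 'h bop) \<Rightarrow> bool" where
  "bounded_family e \<longleftrightarrow> (\<exists>K. \<forall>h>0. op_bound K (e h))"

text \<open>The relation \<open>\<parallel>e\<^sub>h\<parallel>\<^sub>2 = o(\<surd>h)\<close>.\<close>

definition L2_small :: "(real \<Rightarrow> 'h bop) \<Rightarrow> bool" where
  "L2_small e \<longleftrightarrow> (\<forall>h>0. e h \<in> M) \<and> (\<forall>\<eta>>0. \<forall>\<^sub>F h in at_right 0. n2 (e h) \<le> \<eta> * sqrt h)"

text \<open>Families of size \<open>\<surd>h\<close>: up to \<open>o(\<surd>h)\<close> in \<open>L\<^sup>2\<close> they are of size \<open>\<surd>h\<close> in operator norm. Increments of \<open>u\<close>
  are of this kind, although no operator-norm bound of order \<open>\<surd>h\<close> is at hand for them. Uniform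
  boundedness in operator norm allows further factors to be dropped from an estimate.\<close>

definition small_family :: "(real \<Rightarrow> 'h bop) \<Rightarrow> bool" where
  "small_family e \<longleftrightarrow> bounded_family e \<and> (\<exists>C e1 e2. (\<forall>h>0. e h = e1 h + e2 h \<and> op_bound (C * sqrt h) (e1 h)) \<and> L2_small e2)"

lemma bounded_family_mem: "bounded_family e \<Longrightarrow> h > 0 \<Longrightarrow> e h \<in> M" by (auto simp: bounded_family_def op_bound_mem)
lemma small_family_bounded: "small_family e \<Longrightarrow> bounded_family e" by (simp add: small_family_def)
lemma small_family_mem: "small_family e \<Longrightarrow> h > 0 \<Longrightarrow> e h \<in> M" by (simp add: small_family_bounded bounded_family_mem)
lemma L2_small_mem: "L2_small e \<Longrightarrow> h > 0 \<Longrightarrow> e h \<in> M" by (simp add: L2_small_def)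

lemma bounded_family_const: "op_bounded a \<Longrightarrow> bounded_family (\<lambda>_. a)" by (auto simp: bounded_family_def op_bounded_def)
lemma bounded_family_mult: "bounded_family e \<Longrightarrow> bounded_family f \<Longrightarrow> bounded_family (\<lambda>h. e h * f h)"
  unfolding bounded_family_def using op_bound_mult by blast
lemma bounded_family_add: "bounded_family e \<Longrightarrow> bounded_family f \<Longrightarrow> bounded_family (\<lambda>h. e h + f h)"
  unfolding bounded_family_def using op_bound_add by blast
lemma bounded_family_adj: "bounded_family e \<Longrightarrow> bounded_family (\<lambda>h. adj (e h))"
  unfolding bounded_family_def using op_bound_adj by blast
lemma L2_small_bound:
  assumes g: "L2_small g" and mem: "\<And>h. h > 0 \<Longrightarrow> f h \<in> M" and le: "\<And>h. h > 0 \<Longrightarrow> n2 (f h) \<le> C * n2 (g h)"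
  shows "L2_small f"
  unfolding L2_small_def
proof (intro conjI allI impI mem)
  fix \<eta> :: real assume \<eta>: "\<eta> > 0"
  define C' where "C' = max 1 C"
  have C': "C' > 0" "C \<le> C'" by (auto simp: C'_def)
  have "\<eta> / C' > 0" using \<eta> C' by simp
  then have "\<forall>\<^sub>F h in at_right 0. n2 (g h) \<le> \<eta> / C' * sqrt h" using g unfolding L2_small_def by blast
  with eventually_pos_at_right show "\<forall>\<^sub>F h in at_right 0. n2 (f h) \<le> \<eta> * sqrt h"
  proof eventually_elim
    case (elim h)
    have "n2 (f h) \<le> C' * n2 (g h)" using elim(1) C'(2) le[of h] L2_small_mem[OF g]
      by (meson mult_right_mono n2_nonneg order_trans)
    also have "\<dots> \<le> C' * (\<eta> / C' * sqrt h)" using elim(2) C' by (intro mult_left_mono) auto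
    finally show ?case using C' by simp
  qed
qed

lemma L2_small_add:
  assumes "L2_small f" "L2_small g" shows "L2_small (\<lambda>h. f h + g h)"
  unfolding L2_small_def
proof (intro conjI allI impI)
  fix \<eta> :: real assume "\<eta> > 0"
  then have "\<forall>\<^sub>F h in at_right 0. n2 (f h) \<le> \<eta> / 2 * sqrt h" "\<forall>\<^sub>F h in at_right 0. n2 (g h) \<le> \<eta> / 2 * sqrt h"
    using assms unfolding L2_small_def by (metis half_gt_zero)+
  with eventually_pos_at_right show "\<forall>\<^sub>F h in at_right 0. n2 (f h + g h) \<le> \<eta> * sqrt h"
  proof eventually_elim
    case (elim h)
    then show ?case using n2_triangle[of "f h" "g h"] assms[THEN L2_small_mem, of h] by (simp add: field_simps)
  qed
qed (use assms L2_small_mem in auto)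

lemma L2_small_left: "bounded_family e \<Longrightarrow> L2_small f \<Longrightarrow> L2_small (\<lambda>h. e h * f h)"
  unfolding bounded_family_def by (elim exE, rule_tac C = K in L2_small_bound[of f]) (auto simp: L2_small_mem op_bound_mem op_boundD)
lemma L2_small_right: "bounded_family e \<Longrightarrow> L2_small f \<Longrightarrow> L2_small (\<lambda>h. f h * e h)"
  unfolding bounded_family_def by (elim exE, rule_tac C = K in L2_small_bound[of f]) (auto simp: L2_small_mem op_bound_mem op_bound_right)
lemma L2_small_adj: "L2_small f \<Longrightarrow> L2_small (\<lambda>h. adj (f h))"
  by (rule L2_small_bound[of f _ 1]) (auto simp: L2_small_mem)

lemma small_familyI:
  assumes "bounded_family e" "\<And>h. h > 0 \<Longrightarrow> e h = e1 h + e2 h" "\<And>h. h > 0 \<Longrightarrow> op_bound (C * sqrt h) (e1 h)" "L2_small e2"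
  shows "small_family e"
  using assms unfolding small_family_def by blast

lemma small_familyE:
  assumes "small_family e"
  obtains C e1 e2 where "bounded_family e" "\<And>h. h > 0 \<Longrightarrow> e h = e1 h + e2 h"
    "\<And>h. h > 0 \<Longrightarrow> op_bound (C * sqrt h) (e1 h)" "L2_small e2" "\<And>h. h > 0 \<Longrightarrow> e1 h \<in> M"
  using assms op_bound_mem unfolding small_family_def by metis

lemma small_family_left:
  assumes b: "bounded_family b" and e: "small_family e" shows "small_family (\<lambda>h. b h * e h)"
proof -
  obtain C e1 e2 where *: "bounded_family e" "\<And>h. h > 0 \<Longrightarrow> e h = e1 h + e2 h"
    "\<And>h. h > 0 \<Longrightarrow> op_bound (C * sqrt h) (e1 h)" "L2_small e2" "\<And>h. h > 0 \<Longrightarrow> e1 h \<in> M" using small_familyE[OF e] by metis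
  obtain K where K: "\<And>h. h > 0 \<Longrightarrow> op_bound K (b h)" using b by (auto simp: bounded_family_def)
  show ?thesis
    by (rule small_familyI[where C = "K * C" and ?e1.0 = "\<lambda>h. b h * e1 h" and ?e2.0 = "\<lambda>h. b h * e2 h"])
      (use * b K op_bound_mult[of K _ "C * sqrt _"] in \<open>auto intro!: bounded_family_mult L2_small_left simp: distrib_left mult.assoc\<close>)
qed

lemma small_family_right:
  assumes b: "bounded_family b" and e: "small_family e" shows "small_family (\<lambda>h. e h * b h)"
proof -
  obtain C e1 e2 where *: "bounded_family e" "\<And>h. h > 0 \<Longrightarrow> e h = e1 h + e2 h"
    "\<And>h. h > 0 \<Longrightarrow> op_bound (C * sqrt h) (e1 h)" "L2_small e2" "\<And>h. h > 0 \<Longrightarrow> e1 h \<in> M" using small_familyE[OF e] by metis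
  obtain K where K: "\<And>h. h > 0 \<Longrightarrow> op_bound K (b h)" using b by (auto simp: bounded_family_def)
  have "op_bound (C * K * sqrt h) (e1 h * b h)" if "h > 0" for h
    using op_bound_mult[OF *(3)[OF that] K[OF that]] by (simp add: mult_ac)
  then show ?thesis
    by (intro small_familyI[where C = "C * K" and ?e1.0 = "\<lambda>h. e1 h * b h" and ?e2.0 = "\<lambda>h. e2 h * b h"])
      (use * b in \<open>auto intro!: bounded_family_mult L2_small_right simp: distrib_right\<close>)
qed

lemma small_family_add:
  assumes e: "small_family e" and f: "small_family f" shows "small_family (\<lambda>h. e h + f h)"
proof -
  obtain C e1 e2 where *: "bounded_family e" "\<And>h. h > 0 \<Longrightarrow> e h = e1 h + e2 h"
    "\<And>h. h > 0 \<Longrightarrow> op_bound (C * sqrt h) (e1 h)" "L2_small e2" "\<And>h. h > 0 \<Longrightarrow> e1 h \<in> M" using small_familyE[OF e] by metis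
  obtain D f1 f2 where **: "bounded_family f" "\<And>h. h > 0 \<Longrightarrow> f h = f1 h + f2 h"
    "\<And>h. h > 0 \<Longrightarrow> op_bound (D * sqrt h) (f1 h)" "L2_small f2" "\<And>h. h > 0 \<Longrightarrow> f1 h \<in> M" using small_familyE[OF f] by metis
  have "op_bound ((C + D) * sqrt h) (e1 h + f1 h)" if "h > 0" for h
    using op_bound_add[OF *(3)[OF that] **(3)[OF that]] by (simp add: distrib_right)
  then show ?thesis
    by (intro small_familyI[where C = "C + D" and ?e1.0 = "\<lambda>h. e1 h + f1 h" and ?e2.0 = "\<lambda>h. e2 h + f2 h"])
      (use * ** in \<open>auto intro!: bounded_family_add L2_small_add\<close>)
qed

lemma small_family_adj:
  assumes e: "small_family e" shows "small_family (\<lambda>h. adj (e h))"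
proof -
  obtain C e1 e2 where *: "bounded_family e" "\<And>h. h > 0 \<Longrightarrow> e h = e1 h + e2 h"
    "\<And>h. h > 0 \<Longrightarrow> op_bound (C * sqrt h) (e1 h)" "L2_small e2" "\<And>h. h > 0 \<Longrightarrow> e1 h \<in> M" using small_familyE[OF e] by metis
  show ?thesis
    by (rule small_familyI[where C = C and ?e1.0 = "\<lambda>h. adj (e1 h)" and ?e2.0 = "\<lambda>h. adj (e2 h)"])
      (use * in \<open>auto intro!: bounded_family_adj L2_small_adj op_bound_adj simp: L2_small_mem op_bound_mem\<close>)
qed

lemma small_family_n2:
  assumes e: "small_family e" obtains C where "C \<ge> 0" "\<forall>\<^sub>F h in at_right 0. n2 (e h) \<le> C * sqrt h"
proof -
  obtain C e1 e2 where *: "bounded_family e" "\<And>h. h > 0 \<Longrightarrow> e h = e1 h + e2 h"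
    "\<And>h. h > 0 \<Longrightarrow> op_bound (C * sqrt h) (e1 h)" "L2_small e2" "\<And>h. h > 0 \<Longrightarrow> e1 h \<in> M" using small_familyE[OF e] by metis
  have "\<forall>\<^sub>F h in at_right 0. n2 (e2 h) \<le> 1 * sqrt h" using *(4) zero_less_one unfolding L2_small_def by blast
  with eventually_pos_at_right have "\<forall>\<^sub>F h in at_right 0. n2 (e h) \<le> (\<bar>C\<bar> + 1) * sqrt h"
  proof eventually_elim
    case (elim h)
    have "n2 (e h) \<le> n2 (e1 h) + n2 (e2 h)"
      using elim *(2-5) by (auto intro!: n2_triangle simp: L2_small_mem op_bound_mem)
    also have "\<dots> \<le> C * sqrt h + 1 * sqrt h" using elim op_bound_n2[OF *(3)[of h]] by (intro add_mono) auto
    also have "\<dots> \<le> (\<bar>C\<bar> + 1) * sqrt h" using elim by (simp add: distrib_right mult_right_mono)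
    finally show ?case .
  qed
  then show ?thesis using that[of "\<bar>C\<bar> + 1"] by simp
qed

lemma small_family_L2_small_negligible:
  assumes e: "small_family e" and f: "L2_small f" shows "negligible (\<lambda>h. \<tau> (e h * f h))"
  unfolding negligible_def
proof (intro allI impI)
  fix \<eta> :: real assume \<eta>: "\<eta> > 0"
  obtain C where C: "C \<ge> 0" "\<forall>\<^sub>F h in at_right 0. n2 (e h) \<le> C * sqrt h" by (rule small_family_n2[OF e])
  have "\<eta> / (C + 1) > 0" using \<eta> C by simp
  then have "\<forall>\<^sub>F h in at_right 0. n2 (f h) \<le> \<eta> / (C + 1) * sqrt h" using f unfolding L2_small_def by blast
  with C(2) eventually_pos_at_right show "\<forall>\<^sub>F h in at_right 0. cmod (\<tau> (e h * f h)) \<le> \<eta> * h"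
  proof eventually_elim
    case (elim h)
    have m: "e h \<in> M" "f h \<in> M" using e f elim by (auto simp: small_family_mem L2_small_mem)
    have "cmod (\<tau> (e h * f h)) \<le> n2 (e h) * n2 (f h)" using m by (rule cauchy_schwarz)
    also have "\<dots> \<le> (C * sqrt h) * (\<eta> / (C + 1) * sqrt h)" using elim C m by (intro mult_mono) auto
    also have "\<dots> = (C / (C + 1)) * \<eta> * h" using elim by simp
    also have "\<dots> \<le> 1 * \<eta> * h" using C \<eta> elim by (intro mult_right_mono) auto
    finally show ?case by simp
  qed
qed

text \<open>The part of the last factor that is \<open>o(\<surd>h)\<close> in \<open>L\<^sup>2\<close> is paired with a product that is \<open>O(\<surd>h)\<close> in \<open>L\<^sup>2\<close>. The
  other part has operator norm \<open>O(\<surd>h)\<close> and is moved by traciality next to the first factor, leaving two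
  \<open>L\<^sup>2\<close>-norms of order \<open>\<surd>h\<close>: altogether \<open>O(h\<^bsup>3/2\<^esup>)\<close>.\<close>

lemma small_family_triple_negligible:
  assumes a: "small_family a" and b: "small_family b" and c: "small_family c"
  shows "negligible (\<lambda>h. \<tau> (a h * b h * c h))"
proof -
  obtain C c1 c2 where *: "bounded_family c" "\<And>h. h > 0 \<Longrightarrow> c h = c1 h + c2 h"
    "\<And>h. h > 0 \<Longrightarrow> op_bound (C * sqrt h) (c1 h)" "L2_small c2" "\<And>h. h > 0 \<Longrightarrow> c1 h \<in> M" using small_familyE[OF c] by metis
  have 2: "negligible (\<lambda>h. \<tau> (a h * b h * c2 h))"
    by (intro small_family_L2_small_negligible small_family_right small_family_bounded a b *)
  obtain A where A: "A \<ge> 0" "\<forall>\<^sub>F h in at_right 0. n2 (a h) \<le> A * sqrt h" by (rule small_family_n2[OF a])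
  obtain B where B: "B \<ge> 0" "\<forall>\<^sub>F h in at_right 0. n2 (b h) \<le> B * sqrt h" by (rule small_family_n2[OF b])
  have 1: "negligible (\<lambda>h. \<tau> (a h * b h * c1 h))"
    unfolding negligible_def
  proof (intro allI impI)
    fix \<eta> :: real assume \<eta>: "\<eta> > 0"
    define L where "L = \<bar>C\<bar> * A * B + 1"
    have L: "L > 0" "\<bar>C\<bar> * A * B \<le> L" using A B by (auto simp: L_def intro!: add_nonneg_pos)
    have "(sqrt \<longlongrightarrow> sqrt 0) (at_right 0)" by (intro tendsto_intros)
    moreover have "\<eta> / L > 0" using \<eta> L by simp
    ultimately have "\<forall>\<^sub>F h in at_right 0. sqrt h < \<eta> / L" by (auto dest: order_tendstoD(2))
    with A(2) B(2) eventually_pos_at_right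
    show "\<forall>\<^sub>F h in at_right 0. cmod (\<tau> (a h * b h * c1 h)) \<le> \<eta> * h"
    proof eventually_elim
      case (elim h)
      have m: "a h \<in> M" "b h \<in> M" "c1 h \<in> M" using a b *(5) elim by (auto simp: small_family_mem)
      have "\<tau> (a h * b h * c1 h) = \<tau> ((c1 h * a h) * b h)"
        using tr_comm[of "a h * b h" "c1 h"] m by (simp add: mult.assoc)
      also have "cmod \<dots> \<le> n2 (c1 h * a h) * n2 (b h)" using m by (intro cauchy_schwarz) auto
      also have "\<dots> \<le> (C * sqrt h * n2 (a h)) * n2 (b h)" using m *(3) elim by (intro mult_right_mono op_boundD) auto
      also have "\<dots> \<le> (\<bar>C\<bar> * sqrt h * (A * sqrt h)) * (B * sqrt h)"
        using m elim A B by (intro mult_mono) auto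
      also have "\<dots> = (\<bar>C\<bar> * A * B) * sqrt h * h" using elim by simp
      also have "\<dots> \<le> L * (\<eta> / L) * h" using elim L A B \<eta> by (intro mult_mono) auto
      also have "\<dots> = \<eta> * h" using L by simp
      finally show ?case .
    qed
  qed
  show ?thesis
    by (rule negligible_cong_pos[OF negligible_add[OF 1 2]])
      (use * a b in \<open>auto simp: distrib_left tr_add small_family_mem op_bound_mem L2_small_mem\<close>)
qed

end

section \<open>Stochastic increments\<close>

locale free_unitary_bm = tracial_star_algebra M \<tau> for M :: "'h::complex_hilbert bop set" and \<tau> +
  fixes F :: "real \<Rightarrow> 'h bop set" and x u :: "real \<Rightarrow> 'h bop"
  assumes filt: "vn_filtration M F"
    and bm: "free_brownian_motion \<tau> F x"
    and uni: "\<And>t. t \<ge> 0 \<Longrightarrow> unitary (u t) \<and> u t \<in> F t"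
    and u_cont: "\<And>t. t \<ge> 0 \<Longrightarrow> ((\<lambda>s. norm2 \<tau> (u s - u t)) \<longlongrightarrow> 0) (at t within {0..})"
    and sde: "\<And>t. t \<ge> 0 \<Longrightarrow> \<exists>I\<in>M. \<exists>J\<in>M. has_stoch_integral \<tau> u x t I \<and>
           has_stoch_integral \<tau> u (\<lambda>s. complex_of_real s *\<^sub>C 1) t J \<and> u t - u 0 = \<i> *\<^sub>C I - (1/2) *\<^sub>C J"
begin

lemma F_alg: "t \<ge> 0 \<Longrightarrow> unital_star_algebra (F t)"
  using filt unital_star_algebra_vN by (auto simp: vn_filtration_def)
lemma F_M: "t \<ge> 0 \<Longrightarrow> F t \<subseteq> M"
  using filt by (auto simp: vn_filtration_def)
lemma F_mono: "0 \<le> s \<Longrightarrow> s \<le> t \<Longrightarrow> a \<in> F s \<Longrightarrow> a \<in> F t"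
  using filt unfolding vn_filtration_def by blast
lemma F_mem: "t \<ge> 0 \<Longrightarrow> a \<in> F t \<Longrightarrow> a \<in> M" using F_M by auto
lemma u_F: "t \<ge> 0 \<Longrightarrow> u t \<in> F t" using uni by auto
lemma u_M: "t \<ge> 0 \<Longrightarrow> u t \<in> M" using u_F F_mem by auto
lemma x_F: "t \<ge> 0 \<Longrightarrow> x t \<in> F t" using bm by (auto simp: free_brownian_motion_def)
lemma u_adj: "t \<ge> 0 \<Longrightarrow> adj (u t) * u t = 1" "t \<ge> 0 \<Longrightarrow> u t * adj (u t) = 1"
  using uni adj_eqI unfolding unitary_def by blast+
lemma u_op_bound: "t \<ge> 0 \<Longrightarrow> op_bound 1 (u t)" by (intro op_bound_isometry u_M u_adj)
lemma u_n2: "t \<ge> 0 \<Longrightarrow> n2 (u t) = 1" by (simp add: norm2_def u_adj)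

definition dx :: "real \<Rightarrow> real \<Rightarrow> 'h bop" where "dx s t = x t - x s"

lemma dx_self [simp]: "dx s s = 0" by (simp add: dx_def)

lemma dx_F: assumes "0 \<le> s" "s \<le> t" shows "dx s t \<in> F t"
proof -
  interpret F: unital_star_algebra "F t" using assms by (intro F_alg) auto
  show ?thesis using assms x_F[of s] x_F[of t] F_mono[of s t] by (auto simp: dx_def)
qed

lemma dx_M: "0 \<le> s \<Longrightarrow> s \<le> t \<Longrightarrow> dx s t \<in> M"
  using dx_F F_mem[of t] by auto

lemma dx_props:
  assumes "0 \<le> s" "s < t"
  shows dx_free: "free \<tau> [F s, star_alg {dx s t}]" and dx_adj: "adj (dx s t) = dx s t"
    and dx_spec: "spectral_measure \<tau> (dx s t) (semicircle_law (t - s))"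
proof -
  show "free \<tau> [F s, star_alg {dx s t}]" and *: "spectral_measure \<tau> (dx s t) (semicircle_law (t - s))"
    using bm assms unfolding free_brownian_motion_def dx_def by blast+
  show "adj (dx s t) = dx s t" using * unfolding spectral_measure_def by (intro adj_eqI) blast
qed

lemma dx_mean: assumes "0 \<le> s" "s < t" shows "\<tau> (dx s t) = 0"
proof -
  have "\<tau> (dx s t ^ 1) = complex_of_real (\<integral>y. y ^ 1 \<partial>semicircle_law (t - s))"
    using dx_spec[OF assms] unfolding spectral_measure_def by blast
  then show ?thesis using semicircle_mean[of "t - s"] assms by simp
qed

lemma dx_var: assumes "0 \<le> s" "s < t" shows "\<tau> (dx s t * dx s t) = complex_of_real (t - s)"
proof -
  have "\<tau> (dx s t ^ 2) = complex_of_real (\<integral>y. y ^ 2 \<partial>semicircle_law (t - s))"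
    using dx_spec[OF assms] unfolding spectral_measure_def by blast
  then show ?thesis using semicircle_variance[of "t - s"] assms by (simp add: power2_eq_square)
qed

lemma dx_op_bound: assumes "0 \<le> s" "s < t" shows "op_bound (2 * sqrt (t - s)) (dx s t)"
proof (rule op_bound_of_moments)
  show "dx s t \<in> M" "adj (dx s t) = dx s t" "0 \<le> 2 * sqrt (t - s)"
    using assms by (auto simp: dx_M dx_adj)
  fix k
  have "\<tau> (dx s t ^ (2 * k)) = complex_of_real (\<integral>y. y ^ (2 * k) \<partial>semicircle_law (t - s))"
    and rd: "real_distribution (semicircle_law (t - s))"
    using dx_spec[OF assms] unfolding spectral_measure_def by blast+
  then show "cmod (\<tau> (dx s t ^ (2 * k))) \<le> (2 * sqrt (t - s)) ^ (2 * k)"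
    using semicircle_even_moment[of "t - s" k] assms by simp
qed

lemma dx_alg:
  assumes "0 \<le> s" "s < t" 
  shows "unital_star_algebra (star_alg {dx s t})" "star_alg {dx s t} \<subseteq> M" "dx s t \<in> star_alg {dx s t}"
proof -
  have "{dx s t} \<subseteq> M" using assms dx_M[of s t] by simp
  then show "unital_star_algebra (star_alg {dx s t})" "star_alg {dx s t} \<subseteq> M"
    by (rule unital_star_algebra_star_alg, rule star_alg_subset)
  show "dx s t \<in> star_alg {dx s t}" by (simp add: star_alg.gen)
qed

lemma dx_mult_zero:
  assumes "0 \<le> s" "s \<le> t" "a \<in> F s" shows "\<tau> (a * dx s t) = 0"
proof (cases "s = t")
  case False
  then have st: "0 \<le> s" "s < t" using assms by auto
  have "\<tau> (a * dx s t) = \<tau> a * \<tau> (dx s t)"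
    by (rule free_mult[OF dx_free[OF st]]) (use st assms F_alg F_M dx_alg[OF st] in auto)
  then show ?thesis using dx_mean[OF st] by simp
qed simp

lemma dx_isometry:
  assumes "0 \<le> s" "s \<le> t" "a \<in> F s" shows "(n2 (a * dx s t))\<^sup>2 = (n2 a)\<^sup>2 * (t - s)"
proof (cases "s = t")
  case False
  then have st: "0 \<le> s" "s < t" using assms by auto
  have m: "a \<in> M" "dx s t \<in> M" using F_mem[OF assms(1,3)] dx_M[OF assms(1,2)] by auto
  have "of_real ((n2 (a * dx s t))\<^sup>2) = \<tau> (dx s t * (adj a * a * dx s t))"
    using n2_sq[of "a * dx s t"] m by (simp add: dx_adj[OF st] mult.assoc)
  also have "\<dots> = \<tau> ((adj a * a) * (dx s t * dx s t))"
    using tr_comm[of "dx s t" "adj a * a * dx s t"] m by (simp add: mult.assoc)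
  also have "\<dots> = \<tau> (adj a * a) * \<tau> (dx s t * dx s t)"
  proof (rule free_mult[OF dx_free[OF st] F_alg F_M])
    interpret F: unital_star_algebra "F s" using st by (intro F_alg) auto
    show "adj a * a \<in> F s" using assms by auto
  qed (use st dx_alg[OF st] in \<open>auto intro: star_alg.mult\<close>)
  also have "\<dots> = of_real ((n2 a)\<^sup>2 * (t - s))" using m by (simp add: n2_sq dx_var[OF st])
  finally show ?thesis unfolding of_real_eq_iff .
qed simp

text \<open>The Ito isometry for Riemann sums: each new term \<open>a\<^sub>j dx\<^sub>j\<close> is orthogonal to everything in the past,
  by freeness of \<open>dx\<^sub>j\<close> from \<open>F(r\<^sub>j)\<close>, and \<open>\<parallel>a dx\<parallel>\<^sup>2 = \<tau>(a\<^sup>* a) \<tau>(dx\<^sup>2)\<close> for the same reason.\<close>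

lemma martingale_sum:
  fixes r :: "nat \<Rightarrow> real"
  assumes r0: "0 \<le> r 0" and mono: "\<And>j. j < N \<Longrightarrow> r j \<le> r (Suc j)" and a: "\<And>j. j < N \<Longrightarrow> a j \<in> F (r j)"
  shows "r 0 \<le> r N \<and> (\<Sum>j<N. a j * dx (r j) (r (Suc j))) \<in> F (r N)
    \<and> (\<forall>c\<in>F (r 0). \<tau> (c * (\<Sum>j<N. a j * dx (r j) (r (Suc j)))) = 0)
    \<and> (n2 (\<Sum>j<N. a j * dx (r j) (r (Suc j))))\<^sup>2 = (\<Sum>j<N. (n2 (a j))\<^sup>2 * (r (Suc j) - r j))"
  using mono a
proof (induction N)
  case 0
  interpret F: unital_star_algebra "F (r 0)" using r0 by (intro F_alg) auto
  show ?case by simp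
next
  case (Suc N)
  have pre: "\<And>j. j < N \<Longrightarrow> r j \<le> r (Suc j)" "\<And>j. j < N \<Longrightarrow> a j \<in> F (r j)"
    using Suc.prems less_SucI by blast+
  note IHs = Suc.IH[OF pre, simplified]
  let ?S = "\<Sum>j<N. a j * dx (r j) (r (Suc j))" and ?d = "dx (r N) (r (Suc N))"
  have IH: "r 0 \<le> r N" "?S \<in> F (r N)" "\<And>c. c \<in> F (r 0) \<Longrightarrow> \<tau> (c * ?S) = 0"
    "(n2 ?S)\<^sup>2 = (\<Sum>j<N. (n2 (a j))\<^sup>2 * (r (Suc j) - r j))" using IHs by blast+
  have rN: "0 \<le> r N" "r N \<le> r (Suc N)" 
    using order_trans[OF r0 IH(1)] Suc.prems(1)[of N] by simp_all
  have aN: "a N \<in> F (r N)" using Suc.prems(2)[of N] by simp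
  interpret FN: unital_star_algebra "F (r N)" using rN by (intro F_alg) auto
  interpret FS: unital_star_algebra "F (r (Suc N))" using rN by (intro F_alg) auto
  have d: "?d \<in> F (r (Suc N))" using rN by (intro dx_F) auto
  have m: "?S \<in> M" "a N \<in> M" "?d \<in> M" 
    using F_mem[OF rN(1) IH(2)] F_mem[OF rN(1) aN] dx_M[OF rN] by auto
  have "?S \<in> F (r (Suc N))" "a N \<in> F (r (Suc N))" using F_mono rN IH aN by blast+
  then have 1: "(\<Sum>j<Suc N. a j * dx (r j) (r (Suc j))) \<in> F (r (Suc N))" using d by auto
  have 2: "\<tau> (c * (\<Sum>j<Suc N. a j * dx (r j) (r (Suc j)))) = 0" if c: "c \<in> F (r 0)" for c
  proof -
    have cN: "c \<in> F (r N)" using c IH(1) r0 F_mono by blast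
    then have "\<tau> (c * a N * ?d) = 0" using aN rN by (intro dx_mult_zero) auto
    then show ?thesis using IH(3)[OF c] m F_mem[OF rN(1) cN] by (simp add: distrib_left tr_add mult.assoc)
  qed
  have cross: "\<tau> (adj ?S * (a N * ?d)) = 0"
    using dx_mult_zero[of "r N" "r (Suc N)" "adj ?S * a N"] IH(2) aN rN by (simp add: mult.assoc)
  have "of_real ((n2 (?S + a N * ?d))\<^sup>2) = \<tau> (adj (?S + 1 *\<^sub>C (a N * ?d)) * (?S + 1 *\<^sub>C (a N * ?d)))"
    using n2_sq[of "?S + a N * ?d"] m by simp
  also have "\<dots> = of_real ((n2 ?S)\<^sup>2 + (n2 (a N * ?d))\<^sup>2)"
    using m by (subst tr_sesqui) (simp_all del: adj_mult add: tr_adj_mult[of ?S "a N * ?d"] cross n2_sq)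
  finally have "(n2 (?S + a N * ?d))\<^sup>2 = (n2 ?S)\<^sup>2 + (n2 (a N * ?d))\<^sup>2" unfolding of_real_eq_iff .
  then have 3: "(n2 (\<Sum>j<Suc N. a j * dx (r j) (r (Suc j))))\<^sup>2 = (\<Sum>j<Suc N. (n2 (a j))\<^sup>2 * (r (Suc j) - r j))"
    using IH(4) dx_isometry[OF rN aN] by simp
  show ?case using 1 2 3 order_trans[OF IH(1) rN(2)] by blast
qed

definition ito_sum :: "(nat \<Rightarrow> real) \<Rightarrow> nat \<Rightarrow> 'h bop" where
  "ito_sum r N = (\<Sum>j<N. u (r j) * dx (r j) (r (Suc j)))"
definition riemann_sum :: "(nat \<Rightarrow> real) \<Rightarrow> nat \<Rightarrow> 'h bop" where
  "riemann_sum r N = (\<Sum>j<N. complex_of_real (r (Suc j) - r j) *\<^sub>C u (r j))"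

text \<open>Stochastic integrals are limits of sums over partitions of intervals that start at \<open>0\<close>. A partition
  of \<open>[0, s + h]\<close> through the point \<open>s\<close> serves both \<open>s\<close> and \<open>s + h\<close>, and the difference of the two sums is a
  sum over \<open>[s, s + h]\<close>.\<close>

lemma two_scale_partition:
  fixes s h \<delta> :: real
  assumes "0 \<le> s" "0 < h" "0 < \<delta>"
  obtains N :: nat and r :: "nat \<Rightarrow> real" where "r 0 = 0" "r N = s" "r (N + N) = s + h"
    "\<And>j. r j \<le> r (Suc j) \<and> r (Suc j) - r j < \<delta>"
proof -
  obtain N :: nat where N: "max s h / \<delta> < real N" using reals_Archimedean2 by blast
  have "0 < max s h / \<delta>" using assms by simp
  then have Npos: "real N > 0" using N by linarith
  have "max s h < real N * \<delta>" using N assms by (simp add: pos_divide_less_eq)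
  then have "s < \<delta> * real N" "h < \<delta> * real N" by (simp_all add: mult.commute)
  then have small: "s / N < \<delta>" "h / N < \<delta>" using Npos by (simp_all add: pos_divide_less_eq)
  define r where "r j = (if j \<le> N then s * j / N else s + h * (real j - N) / N)" for j :: nat
  have step: "r (Suc j) - r j = (if j < N then s / N else h / N)" for j
  proof -
    consider "j < N" | "j = N" | "j > N" by linarith
    then show ?thesis
    proof cases
      case 1 then show ?thesis using Npos by (simp add: r_def add_divide_distrib diff_divide_distrib distrib_left right_diff_distrib)
    next
      case 2 then show ?thesis using Npos by (simp add: r_def)
    next
      case 3 then show ?thesis using Npos by (simp add: r_def add_divide_distrib diff_divide_distrib distrib_left right_diff_distrib)
    qed
  qed
  show ?thesis
  proof (rule that)
    show "r 0 = 0" "r N = s" "r (N + N) = s + h" using Npos by (auto simp: r_def)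
    have "0 \<le> s / N" "0 \<le> h / N" using assms by auto
    then show "r j \<le> r (Suc j) \<and> r (Suc j) - r j < \<delta>" for j
      using step[of j] small by (auto split: if_splits)
  qed
qed

lemma increment_approx:
  assumes s: "0 \<le> s" and h: "0 < h" and \<epsilon>: "0 < \<epsilon>"
  obtains N r where "r 0 = s" "r N = s + h" "\<And>j. r j \<le> r (Suc j)" "\<And>j. 0 \<le> r j"
    "n2 ((u (s + h) - u s) - (\<i> *\<^sub>C ito_sum r N - (1/2) *\<^sub>C riemann_sum r N)) < \<epsilon>"
proof -
  obtain I1 J1 where 1: "I1 \<in> M" "J1 \<in> M" "has_stoch_integral \<tau> u x s I1"
    "has_stoch_integral \<tau> u (\<lambda>s. complex_of_real s *\<^sub>C 1) s J1" "u s - u 0 = \<i> *\<^sub>C I1 - (1/2) *\<^sub>C J1"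
    using sde[of s] s by blast
  obtain I2 J2 where 2: "I2 \<in> M" "J2 \<in> M" "has_stoch_integral \<tau> u x (s + h) I2"
    "has_stoch_integral \<tau> u (\<lambda>s. complex_of_real s *\<^sub>C 1) (s + h) J2" "u (s + h) - u 0 = \<i> *\<^sub>C I2 - (1/2) *\<^sub>C J2"
    using sde[OF add_nonneg_nonneg[OF s less_imp_le[OF h]]] by blast
  define e where "e = \<epsilon> / 4"
  have e: "e > 0" using \<epsilon> by (simp add: e_def)
  define close where "close X t I d \<longleftrightarrow> (\<forall>(n::nat) r. r 0 = 0 \<and> r n = t \<and> (\<forall>j<n. r j \<le> r (Suc j) \<and> r (Suc j) - r j < d) \<longrightarrow>
        n2 ((\<Sum>j<n. u (r j) * (X (r (Suc j)) - X (r j))) - I) < e)" for X t I d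
  have get: "\<exists>d>0. close X t I d" if "has_stoch_integral \<tau> u X t I" for X t I
    using that e unfolding has_stoch_integral_def close_def by blast
  obtain d1 where d1: "d1 > 0" "close x s I1 d1" using get[OF 1(3)] by blast
  obtain d2 where d2: "d2 > 0" "close (\<lambda>s. complex_of_real s *\<^sub>C 1) s J1 d2" using get[OF 1(4)] by blast
  obtain d3 where d3: "d3 > 0" "close x (s + h) I2 d3" using get[OF 2(3)] by blast
  obtain d4 where d4: "d4 > 0" "close (\<lambda>s. complex_of_real s *\<^sub>C 1) (s + h) J2 d4" using get[OF 2(4)] by blast
  define d where "d = min (min d1 d2) (min d3 d4)"
  have "d > 0" using d1 d2 d3 d4 by (simp add: d_def)
  then obtain N r where r: "r 0 = 0" "r N = s" "r (N + N) = s + h" "\<And>j. r j \<le> r (Suc j) \<and> r (Suc j) - r j < d"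
    using two_scale_partition[OF s h] by metis
  have rpos: "0 \<le> r j" for j
    by (induction j) (use r(1,4) in \<open>auto intro: order_trans\<close>)
  have rmono: "r j \<le> r (Suc j)" for j using r by blast
  have ju: "u (r j) * (complex_of_real (r (Suc j)) *\<^sub>C 1 - complex_of_real (r j) *\<^sub>C 1) = complex_of_real (r (Suc j) - r j) *\<^sub>C u (r j)" for j
    by (simp add: bop_scaleC_right right_diff_distrib complex_vector.scale_left_diff_distrib)
  have closeD: "n2 ((\<Sum>j<n. u (r j) * (X (r (Suc j)) - X (r j))) - I) < e"
    if "close X t I d'" "r n = t" "d \<le> d'" for X t I d' and n :: nat
  proof -
    have "\<forall>j<n. r j \<le> r (Suc j) \<and> r (Suc j) - r j < d'" using r(4) that(3) less_le_trans by blast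
    then show ?thesis using that(1)[unfolded close_def, rule_format, of r n] r(1) that(2) by blast
  qed
  have b1: "n2 (ito_sum r N - I1) < e" using closeD[OF d1(2) r(2)] unfolding ito_sum_def dx_def by (simp add: d_def)
  have b2: "n2 (riemann_sum r N - J1) < e" using closeD[OF d2(2) r(2)] unfolding riemann_sum_def ju by (simp add: d_def)
  have b3: "n2 (ito_sum r (N + N) - I2) < e" using closeD[OF d3(2) r(3)] unfolding ito_sum_def dx_def by (simp add: d_def)
  have b4: "n2 (riemann_sum r (N + N) - J2) < e" using closeD[OF d4(2) r(3)] unfolding riemann_sum_def ju by (simp add: d_def)
  define r' where "r' j = r (N + j)" for j
  have split: "(\<Sum>j<N + N. f j) = (\<Sum>j<N. f j) + (\<Sum>j<N. f (N + j))" for f :: "nat \<Rightarrow> 'h bop"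
    using sum.atLeastLessThan_concat[of 0 N "N + N" f] sum.shift_bounds_nat_ivl[of f 0 N N]
    by (simp add: lessThan_atLeast0 add.commute)
  have i: "ito_sum r (N + N) = ito_sum r N + ito_sum r' N" unfolding ito_sum_def split by (simp add: r'_def)
  have j: "riemann_sum r (N + N) = riemann_sum r N + riemann_sum r' N" unfolding riemann_sum_def split by (simp add: r'_def)
  have im: "ito_sum r K \<in> M" "riemann_sum r K \<in> M" for K
    unfolding ito_sum_def riemann_sum_def using u_M rpos dx_M rmono by (auto intro!: sum_mem)
  have "u (s + h) - u s = \<i> *\<^sub>C (I2 - I1) - (1/2) *\<^sub>C (J2 - J1)"
    using 1(5) 2(5) by (simp add: complex_vector.scale_right_diff_distrib algebra_simps)
  then have eq: "(u (s + h) - u s) - (\<i> *\<^sub>C ito_sum r' N - (1/2) *\<^sub>C riemann_sum r' N) =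
    \<i> *\<^sub>C ((ito_sum r N - I1) - (ito_sum r (N + N) - I2)) - (1/2) *\<^sub>C ((riemann_sum r N - J1) - (riemann_sum r (N + N) - J2))"
    unfolding i j by (simp add: complex_vector.scale_right_diff_distrib complex_vector.scale_right_distrib algebra_simps)
  have "n2 (\<i> *\<^sub>C ((ito_sum r N - I1) - (ito_sum r (N + N) - I2)) - (1/2) *\<^sub>C ((riemann_sum r N - J1) - (riemann_sum r (N + N) - J2)))
     \<le> n2 (\<i> *\<^sub>C ((ito_sum r N - I1) - (ito_sum r (N + N) - I2))) + n2 ((1/2) *\<^sub>C ((riemann_sum r N - J1) - (riemann_sum r (N + N) - J2)))"
    using im 1 2 by (intro n2_diff) auto
  also have "\<dots> = n2 ((ito_sum r N - I1) - (ito_sum r (N + N) - I2)) + n2 ((riemann_sum r N - J1) - (riemann_sum r (N + N) - J2)) / 2"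
    using im 1 2 by (simp add: n2_scaleC)
  also have "\<dots> \<le> (n2 (ito_sum r N - I1) + n2 (ito_sum r (N + N) - I2)) + (n2 (riemann_sum r N - J1) + n2 (riemann_sum r (N + N) - J2)) / 2"
    using im 1 2 by (intro add_mono divide_right_mono n2_diff) auto
  also have "\<dots> < \<epsilon>"
  proof -
    have "a + c + (b + d) / 2 < \<epsilon>" if "a < e" "b < e" "c < e" "d < e" for a b c d :: real
      using that \<epsilon> unfolding e_def add_divide_distrib by linarith
    then show ?thesis using b1 b2 b3 b4 by blast
  qed
  finally show ?thesis
    using that[of r' N] r rmono rpos unfolding eq by (auto simp: r'_def)
qed

end

context free_unitary_bm begin

section \<open>First-order behaviour of the free unitary Brownian motion\<close>

lemma partition_ge: 
  fixes r :: "nat \<Rightarrow> real"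
  assumes "\<And>j. r j \<le> r (Suc j)" shows "i \<le> j \<Longrightarrow> r i \<le> r j"
  using lift_Suc_mono_le[of r i j] assms by blast

lemma sum_increments: "(\<Sum>j<N. r (Suc j) - r j) = r N - (r 0 :: real)"
  by (rule sum_lessThan_telescope)

text \<open>Against elements of the past the stochastic integral vanishes, and in the time integral \<open>u\<^sub>r\<close> may be
  replaced by \<open>u\<^sub>s\<close> at the cost of the oscillation \<open>\<eta>\<close> of \<open>u\<close>.\<close>

lemma increment_drift:
  assumes s: "0 \<le> s" and h: "0 < h" and c: "c \<in> F s"
    and osc: "\<And>r. s \<le> r \<Longrightarrow> r \<le> s + h \<Longrightarrow> n2 (u r - u s) \<le> \<eta>"
  shows "cmod (\<tau> (c * (u (s + h) - u s)) + of_real (h / 2) * \<tau> (c * u s)) \<le> n2 c * \<eta> * h"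
proof (rule field_le_epsilon)
  fix e :: real assume e: "e > 0"
  have cM: "c \<in> M" using F_mem[OF s c] .
  define \<epsilon> where "\<epsilon> = e / (n2 c + 1)"
  have n2c: "n2 c \<ge> 0" using cM by simp
  have \<epsilon>: "\<epsilon> > 0" "n2 c * \<epsilon> \<le> e" using e n2c by (auto simp: \<epsilon>_def field_simps)
  obtain N r where r: "r 0 = s" "r N = s + h" "\<And>j. r j \<le> r (Suc j)" "\<And>j. 0 \<le> r j"
    and ap: "n2 ((u (s + h) - u s) - (\<i> *\<^sub>C ito_sum r N - (1/2) *\<^sub>C riemann_sum r N)) < \<epsilon>"
    using increment_approx[OF s h \<epsilon>(1)] by blast
  let ?D = "u (s + h) - u s"
  have D: "?D \<in> M" using u_M s h by auto
  have uM: "u (r j) \<in> M" for j using u_M r(4) .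
  have im: "ito_sum r N \<in> M" "riemann_sum r N \<in> M"
    unfolding ito_sum_def riemann_sum_def using uM dx_M r by (auto intro!: sum_mem)
  have "0 \<le> r 0" using r(4) .
  have "c \<in> F (r 0)" using c r by simp
  then have ito0: "\<tau> (c * ito_sum r N) = 0"
    using martingale_sum[of r N "\<lambda>j. u (r j)"] r u_F unfolding ito_sum_def by blast
  have sum: "\<tau> (c * riemann_sum r N) = (\<Sum>j<N. of_real (r (Suc j) - r j) * \<tau> (c * u (r j)))"
    unfolding riemann_sum_def sum_distrib_left using uM cM
    by (subst tr_sum) (auto simp: bop_scaleC_right tr_scaleC)
  have "\<tau> (c * riemann_sum r N) - of_real h * \<tau> (c * u s)
     = (\<Sum>j<N. of_real (r (Suc j) - r j) * \<tau> (c * (u (r j) - u s)))"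
  proof -
    have "of_real h * \<tau> (c * u s) = (\<Sum>j<N. of_real (r (Suc j) - r j) * \<tau> (c * u s))"
      unfolding sum_distrib_right[symmetric] of_real_sum[symmetric] sum_increments using r by simp
    then show ?thesis unfolding sum using uM cM u_M[OF s]
      by (simp add: sum_subtractf[symmetric] right_diff_distrib tr_diff)
  qed
  also have "cmod \<dots> \<le> (\<Sum>j<N. (r (Suc j) - r j) * (n2 c * \<eta>))"
  proof (rule sum_norm_le)
    fix j assume j: "j \<in> {..<N}"
    have rj: "s \<le> r j" "r j \<le> s + h" using partition_ge[of r, OF r(3)] r(1,2) j by (metis zero_le, metis lessThan_iff less_imp_le)
    have "cmod (\<tau> (c * (u (r j) - u s))) \<le> n2 c * n2 (u (r j) - u s)"
      using cM uM u_M[OF s] by (intro cauchy_schwarz) auto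
    also have "\<dots> \<le> n2 c * \<eta>" using osc[OF rj] n2c by (intro mult_left_mono)
    finally show "cmod (of_real (r (Suc j) - r j) * \<tau> (c * (u (r j) - u s))) \<le> (r (Suc j) - r j) * (n2 c * \<eta>)"
      unfolding norm_mult norm_of_real using r(3)[of j] by (intro mult_mono) auto
  qed
  also have "\<dots> = n2 c * \<eta> * h" unfolding sum_distrib_right[symmetric] sum_increments using r by simp
  finally have A: "cmod (\<tau> (c * riemann_sum r N) - of_real h * \<tau> (c * u s)) \<le> n2 c * \<eta> * h" .
  let ?E = "?D - (\<i> *\<^sub>C ito_sum r N - (1/2) *\<^sub>C riemann_sum r N)"
  have "\<tau> (c * ?E) = \<tau> (c * ?D) + (1/2) * \<tau> (c * riemann_sum r N)"
  proof -
    have "\<tau> (c * (D - (\<i> *\<^sub>C I - (1/2) *\<^sub>C J))) = \<tau> (c * D) - (\<i> * \<tau> (c * I) - (1/2) * \<tau> (c * J))"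
      if "D \<in> M" "I \<in> M" "J \<in> M" for D I J
      using cM that by (simp add: right_diff_distrib tr_diff bop_scaleC_right tr_scaleC)
    from this[OF D im] show ?thesis using ito0 by simp
  qed
  then have "\<tau> (c * ?D) + of_real (h / 2) * \<tau> (c * u s) = \<tau> (c * ?E) - (1/2) * (\<tau> (c * riemann_sum r N) - of_real h * \<tau> (c * u s))"
    by (simp add: algebra_simps)
  also have "cmod \<dots> \<le> cmod (\<tau> (c * ?E)) + cmod ((1/2) * (\<tau> (c * riemann_sum r N) - of_real h * \<tau> (c * u s)))"
    by (rule norm_triangle_ineq4)
  also have "\<dots> \<le> n2 c * n2 ?E + (1/2) * (n2 c * \<eta> * h)"
    unfolding norm_mult using A cM D im by (intro add_mono cauchy_schwarz mult_mono) auto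
  also have "\<dots> \<le> e + n2 c * \<eta> * h"
  proof -
    have "n2 c * n2 ?E \<le> n2 c * \<epsilon>" using ap n2c by (intro mult_left_mono) auto
    moreover have "0 \<le> n2 c * \<eta> * h" using A norm_ge_zero order_trans by blast
    ultimately show ?thesis using \<epsilon>(2) by linarith
  qed
  finally show "cmod (\<tau> (c * ?D) + of_real (h / 2) * \<tau> (c * u s)) \<le> n2 c * \<eta> * h + e" by linarith
qed

text \<open>By the isometry, replacing \<open>u\<^sub>r\<close> by \<open>u\<^sub>s\<close> in the stochastic integral costs \<open>\<eta> \<surd>h\<close>; the whole time
  integral is of order \<open>h\<close>.\<close>

lemma increment_martingale:
  assumes s: "0 \<le> s" and h: "0 < h" and \<eta>0: "0 \<le> \<eta>"
    and osc: "\<And>r. s \<le> r \<Longrightarrow> r \<le> s + h \<Longrightarrow> n2 (u r - u s) \<le> \<eta>"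
  shows "n2 ((u (s + h) - u s) - \<i> *\<^sub>C (u s * dx s (s + h))) \<le> \<eta> * sqrt h + h"
proof (rule field_le_epsilon)
  fix \<epsilon> :: real assume \<epsilon>: "\<epsilon> > 0"
  obtain N r where r: "r 0 = s" "r N = s + h" "\<And>j. r j \<le> r (Suc j)" "\<And>j. 0 \<le> r j"
    and ap: "n2 ((u (s + h) - u s) - (\<i> *\<^sub>C ito_sum r N - (1/2) *\<^sub>C riemann_sum r N)) < \<epsilon>"
    using increment_approx[OF s h \<epsilon>] by blast
  let ?D = "u (s + h) - u s" and ?x = "u s * dx s (s + h)"
  have D: "?D \<in> M" using u_M s h by auto
  have uM: "u (r j) \<in> M" for j using u_M r(4) .
  have im: "ito_sum r N \<in> M" "riemann_sum r N \<in> M"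
    unfolding ito_sum_def riemann_sum_def using uM dx_M r by (auto intro!: sum_mem)
  have xM: "?x \<in> M" using u_M[OF s] dx_M[of s "s + h"] s h by auto
  have rs: "s \<le> r j" for j using partition_ge[of r 0 j] r by simp
  have ub: "u (r j) - u s \<in> F (r j)" for j
  proof -
    interpret R: unital_star_algebra "F (r j)" using r(4) by (rule F_alg)
    show ?thesis using u_F[OF r(4)] F_mono[OF s rs u_F[OF s]] by auto
  qed
  define S where "S = (\<Sum>j<N. (u (r j) - u s) * dx (r j) (r (Suc j)))"
  have "(\<Sum>j<N. dx (r j) (r (Suc j))) = dx s (s + h)"
    unfolding dx_def using sum_lessThan_telescope[of "\<lambda>j. x (r j)" N] r by simp
  then have S: "S = ito_sum r N - ?x"
    by (simp add: S_def ito_sum_def left_diff_distrib sum_subtractf sum_distrib_left[symmetric])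
  have "(n2 S)\<^sup>2 = (\<Sum>j<N. (n2 (u (r j) - u s))\<^sup>2 * (r (Suc j) - r j))"
    using martingale_sum[of r N "\<lambda>j. u (r j) - u s"] r ub unfolding S_def by blast
  also have "\<dots> \<le> (\<Sum>j<N. \<eta>\<^sup>2 * (r (Suc j) - r j))"
  proof (rule sum_mono)
    fix j assume j: "j \<in> {..<N}"
    have "r j \<le> s + h" using partition_ge[of r j N] r j by simp
    then show "(n2 (u (r j) - u s))\<^sup>2 * (r (Suc j) - r j) \<le> \<eta>\<^sup>2 * (r (Suc j) - r j)"
      using osc[of "r j"] rs r(3)[of j] uM u_M[OF s] by (intro mult_right_mono power_mono) auto
  qed
  also have "\<dots> = (\<eta> * sqrt h)\<^sup>2"
    unfolding sum_distrib_left[symmetric] sum_increments using r h by (simp add: power_mult_distrib)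
  finally have Sn: "n2 S \<le> \<eta> * sqrt h" by (rule power2_le_imp_le) (use \<eta>0 h in auto)
  have "n2 (riemann_sum r N) \<le> (\<Sum>j<N. n2 (complex_of_real (r (Suc j) - r j) *\<^sub>C u (r j)))"
    unfolding riemann_sum_def using uM by (intro n2_sum) auto
  also have "\<dots> = (\<Sum>j<N. r (Suc j) - r j)"
    using uM u_n2 r by (intro sum.cong refl) (simp add: n2_scaleC del: of_real_diff)
  also have "\<dots> = h" unfolding sum_increments using r by simp
  finally have Rn: "n2 (riemann_sum r N) \<le> h" .
  let ?E = "?D - (\<i> *\<^sub>C ito_sum r N - (1/2) *\<^sub>C riemann_sum r N)"
  have SM: "S \<in> M" using im xM by (simp add: S)
  have "?D - \<i> *\<^sub>C ?x = ?E + (\<i> *\<^sub>C S - (1/2) *\<^sub>C riemann_sum r N)"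
    by (simp add: S complex_vector.scale_right_diff_distrib)
  also have "n2 \<dots> \<le> n2 ?E + n2 (\<i> *\<^sub>C S - (1/2) *\<^sub>C riemann_sum r N)" using D im SM by (intro n2_triangle) auto
  also have "\<dots> \<le> n2 ?E + (n2 (\<i> *\<^sub>C S) + n2 ((1/2) *\<^sub>C riemann_sum r N))"
    using im SM by (intro add_mono n2_diff) auto
  also have "\<dots> = n2 ?E + (n2 S + n2 (riemann_sum r N) / 2)" using im SM by (simp add: n2_scaleC)
  also have "\<dots> \<le> \<eta> * sqrt h + h + \<epsilon>" using ap Sn Rn h by linarith
  finally show "n2 (?D - \<i> *\<^sub>C ?x) \<le> \<eta> * sqrt h + h + \<epsilon>" .
qed

lemma eventually_osc:
  assumes s: "0 \<le> s" and \<eta>: "\<eta> > 0"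
  shows "\<forall>\<^sub>F h in at_right 0. \<forall>r. s \<le> r \<and> r \<le> s + h \<longrightarrow> n2 (u r - u s) \<le> \<eta>"
proof -
  have "\<forall>\<^sub>F r in at s within {0..}. n2 (u r - u s) < \<eta>"
    using order_tendstoD(2)[OF u_cont[OF s] \<eta>] .
  then obtain d where d: "d > 0" "\<And>r. r \<ge> 0 \<Longrightarrow> r \<noteq> s \<Longrightarrow> dist r s < d \<Longrightarrow> n2 (u r - u s) < \<eta>"
    by (auto simp: eventually_at)
  have "n2 (u r - u s) \<le> \<eta>" if "s \<le> r" "r \<le> s + h" "0 < h" "h < d" for r h
    using d(2)[of r] that s \<eta> by (cases "r = s") (auto simp: dist_real_def)
  then show ?thesis unfolding eventually_at_right_field using d(1) by auto
qed

definition w :: "real \<Rightarrow> real \<Rightarrow> 'h bop" where "w s h = adj (u s) * u (s + h) - 1"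

lemma w_alt: "0 \<le> s \<Longrightarrow> w s h = adj (u s) * (u (s + h) - u s)"
  by (simp add: w_def right_diff_distrib u_adj)

lemma u_w: "0 \<le> s \<Longrightarrow> u (s + h) = u s * (1 + w s h)"
  by (simp add: w_def mult.assoc[symmetric] u_adj)

lemma w_M: "0 \<le> s \<Longrightarrow> 0 < h \<Longrightarrow> w s h \<in> M"
  unfolding w_def using u_M[of s] u_M[of "s + h"] by auto

lemma w_drift:
  assumes s: "0 \<le> s" and c: "c \<in> F s"
  shows "negligible (\<lambda>h. \<tau> (c * w s h) + of_real (h / 2) * \<tau> c)"
  unfolding negligible_def
proof (intro allI impI)
  fix \<eta> :: real assume \<eta>: "\<eta> > 0"
  interpret Fs: unital_star_algebra "F s" using s by (rule F_alg)
  define c' where "c' = c * adj (u s)"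
  have c': "c' \<in> F s" using c u_F[OF s] by (auto simp: c'_def)
  have c'M: "c' \<in> M" using F_mem[OF s c'] .
  define \<delta> where "\<delta> = \<eta> / (n2 c' + 1)"
  have n2c: "n2 c' \<ge> 0" using c'M by simp
  have \<delta>: "\<delta> > 0" "n2 c' * \<delta> \<le> \<eta>" using \<eta> n2c by (auto simp: \<delta>_def field_simps)
  from eventually_osc[OF s \<delta>(1)] eventually_pos_at_right
  show "\<forall>\<^sub>F h in at_right 0. cmod (\<tau> (c * w s h) + of_real (h / 2) * \<tau> c) \<le> \<eta> * h"
  proof eventually_elim
    case (elim h)
    have "c' * (u (s + h) - u s) = c * w s h" using s by (simp add: c'_def w_alt mult.assoc)
    moreover have "c' * u s = c" using s by (simp add: c'_def mult.assoc u_adj)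
    ultimately have "cmod (\<tau> (c * w s h) + of_real (h / 2) * \<tau> c) \<le> n2 c' * \<delta> * h"
      using increment_drift[OF s elim(2) c', of \<delta>] elim(1) by simp
    also have "\<dots> \<le> \<eta> * h" using \<delta> elim by (intro mult_right_mono) auto
    finally show ?case .
  qed
qed

lemma w_minus_dx_small: assumes s: "0 \<le> s" shows "L2_small (\<lambda>h. w s h - \<i> *\<^sub>C dx s (s + h))"
proof -
  define R where "R h = (u (s + h) - u s) - \<i> *\<^sub>C (u s * dx s (s + h))" for h
  have RM: "R h \<in> M" if "h > 0" for h
    using u_M[of s] u_M[of "s + h"] dx_M[of s "s + h"] s that by (auto simp: R_def)
  have "L2_small R"
    unfolding L2_small_def
  proof (intro conjI allI impI)
    fix \<eta> :: real assume \<eta>: "\<eta> > 0"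
    have "(sqrt \<longlongrightarrow> sqrt 0) (at_right 0)" by (intro tendsto_intros)
    then have "\<forall>\<^sub>F h in at_right 0. sqrt h < \<eta> / 2" by (rule order_tendstoD(2)) (use \<eta> in simp)
    moreover have "\<eta> / 2 > 0" using \<eta> by simp
    note eventually_osc[OF s this]
    ultimately show "\<forall>\<^sub>F h in at_right 0. n2 (R h) \<le> \<eta> * sqrt h" using eventually_pos_at_right
    proof eventually_elim
      case (elim h)
      have "n2 (R h) \<le> \<eta> / 2 * sqrt h + h"
        unfolding R_def by (rule increment_martingale) (use s elim \<eta> in auto)
      also have "\<eta> / 2 * sqrt h + h = \<eta> / 2 * sqrt h + sqrt h * sqrt h" using elim by simp
      also have "\<eta> / 2 * sqrt h + sqrt h * sqrt h \<le> \<eta> / 2 * sqrt h + \<eta> / 2 * sqrt h"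
        using elim by (intro add_left_mono mult_right_mono) auto
      finally show ?case by simp
    qed
  qed (rule RM)
  moreover have "op_bounded (adj (u s))" using op_bound_adj[OF u_op_bound[OF s]] by (auto simp: op_bounded_def)
  ultimately have "L2_small (\<lambda>h. adj (u s) * R h)" by (intro L2_small_left bounded_family_const)
  moreover have "adj (u s) * R h = w s h - \<i> *\<^sub>C dx s (s + h)" for h
  proof -
    have "adj (u s) * (u s * dx s (s + h)) = dx s (s + h)" using s by (simp add: mult.assoc[symmetric] u_adj)
    then show ?thesis using s by (simp add: R_def w_alt right_diff_distrib bop_scaleC_right)
  qed
  ultimately show ?thesis by simp
qed

lemma op_bounded_u: "t \<ge> 0 \<Longrightarrow> op_bounded (u t)" using u_op_bound by (auto simp: op_bounded_def)

lemma bounded_family_u: "0 \<le> s \<Longrightarrow> bounded_family (\<lambda>h. u (s + h))"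
  unfolding bounded_family_def using u_op_bound by (intro exI[of _ 1]) auto

lemma op_bounded_one: "op_bounded 1" using op_bound_one by (auto simp: op_bounded_def)
lemma op_bounded_scaleC: "op_bounded a \<Longrightarrow> op_bounded (c *\<^sub>C a)" using op_bound_scaleC unfolding op_bounded_def by blast
lemma op_bounded_mult: "op_bounded a \<Longrightarrow> op_bounded b \<Longrightarrow> op_bounded (a * b)" using op_bound_mult unfolding op_bounded_def by blast
lemma op_bounded_adj: "op_bounded a \<Longrightarrow> op_bounded (adj a)" using op_bound_adj unfolding op_bounded_def by blast

lemma bounded_family_w: assumes s: "0 \<le> s" shows "bounded_family (w s)"
proof -
  have "bounded_family (\<lambda>h. adj (u s) * u (s + h) + (-1) *\<^sub>C 1)"
    using s by (intro bounded_family_add bounded_family_mult bounded_family_const bounded_family_u op_bounded_adj op_bounded_u op_bounded_scaleC op_bounded_one)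
  then show ?thesis by (simp add: w_def[abs_def])
qed

lemma small_family_w: assumes s: "0 \<le> s" shows "small_family (w s)"
proof (rule small_familyI[where C = 2 and ?e1.0 = "\<lambda>h. \<i> *\<^sub>C dx s (s + h)"])
  show "op_bound (2 * sqrt h) (\<i> *\<^sub>C dx s (s + h))" if "h > 0" for h
    using op_bound_scaleC[OF dx_op_bound[of s "s + h"], of \<i>] that s by simp
qed (use s in \<open>auto intro: bounded_family_w w_minus_dx_small\<close>)

text \<open>\<open>\<kappa>\<close> is the leading coefficient of \<open>y\<close> with respect to \<open>dx\<close>: it is \<open>i\<close> for \<open>w\<close> and \<open>- i\<close> for \<open>w\<^sup>*\<close>, so a
  product of two of them contributes \<open>- h\<close> or \<open>h\<close>.\<close>

definition leading_dx :: "real \<Rightarrow> complex \<Rightarrow> (real \<Rightarrow> 'h bop) \<Rightarrow> bool" where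
  "leading_dx s \<kappa> y \<longleftrightarrow> small_family y \<and> L2_small (\<lambda>h. y h - \<kappa> *\<^sub>C dx s (s + h))"

lemma leading_dx_w: "0 \<le> s \<Longrightarrow> leading_dx s \<i> (w s)"
  by (simp add: leading_dx_def small_family_w w_minus_dx_small)

lemma leading_dx_adj_w: assumes s: "0 \<le> s" shows "leading_dx s (-\<i>) (\<lambda>h. adj (w s h))"
proof -
  have "L2_small (\<lambda>h. adj (w s h - \<i> *\<^sub>C dx s (s + h)))" using w_minus_dx_small[OF s] by (rule L2_small_adj)
  then have "L2_small (\<lambda>h. adj (w s h) - (-\<i>) *\<^sub>C dx s (s + h))"
    by (rule L2_small_bound[where C = 1])
      (use s w_M[OF s] dx_M[of s] dx_adj[of s] in \<open>auto\<close>)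
  then show ?thesis using s by (simp add: leading_dx_def small_family_adj small_family_w)
qed

text \<open>Replace the two factors by \<open>\<kappa> dx\<close> and \<open>\<kappa>' dx\<close> one after the other; each error is \<open>O(\<surd>h)\<close> times \<open>o(\<surd>h)\<close>.
  The remaining product is computed exactly by freeness.\<close>

lemma leading_dx_quadratic:
  assumes s: "0 \<le> s" and c: "c \<in> F s" "c' \<in> F s" "op_bounded c" "op_bounded c'"
    and y: "leading_dx s \<kappa> y" and y': "leading_dx s \<kappa>' y'"
  shows "negligible (\<lambda>h. \<tau> (c * y h * c' * y' h) - \<kappa> * \<kappa>' * of_real h * (\<tau> c * \<tau> c'))"
proof -
  let ?d = "\<lambda>h. dx s (s + h)"
  define R where "R h = y h - \<kappa> *\<^sub>C ?d h" for h
  define R' where "R' h = y' h - \<kappa>' *\<^sub>C ?d h" for h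
  have sf: "small_family y" "small_family y'" and Lo: "L2_small R" "L2_small R'"
    using y y' by (auto simp: leading_dx_def R_def[abs_def] R'_def[abs_def])
  have cb: "bounded_family (\<lambda>_. c)" "bounded_family (\<lambda>_. c')" using c by (auto intro: bounded_family_const)
  have cM: "c \<in> M" "c' \<in> M" using c op_bounded_mem by auto
  have 1: "negligible (\<lambda>h. \<tau> (c * y h * c' * R' h))"
    by (intro small_family_L2_small_negligible small_family_right small_family_left cb sf Lo)
  have 2: "negligible (\<lambda>h. \<tau> ((\<kappa>' *\<^sub>C (c' * ?d h * c)) * R h))"
  proof -
    define K where "K h = \<kappa>' *\<^sub>C (c' * ?d h * c)" for h
    obtain C C' where C: "op_bound C c" "op_bound C' c'" using c by (auto simp: op_bounded_def)
    have o: "op_bound (cmod \<kappa>' * (C' * (2 * sqrt h) * C)) (K h)" if "h > 0" for h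
      unfolding K_def using dx_op_bound[of s "s + h"] s that
      by (intro op_bound_scaleC op_bound_mult C) auto
    define B where "B = cmod \<kappa>' * C' * 2 * C"
    have B0: "B \<ge> 0" using C by (auto simp: B_def op_bound_nonneg)
    have o: "op_bound (B * sqrt h) (K h)" if "h > 0" for h
      using o[OF that] by (simp add: B_def mult_ac)
    show ?thesis unfolding negligible_def K_def[symmetric]
    proof (intro allI impI)
      fix \<eta> :: real assume \<eta>: "\<eta> > 0"
      have "\<eta> / (B + 1) > 0" using \<eta> B0 by simp
      then have "\<forall>\<^sub>F h in at_right 0. n2 (R h) \<le> \<eta> / (B + 1) * sqrt h" using Lo(1) unfolding L2_small_def by blast
      with eventually_pos_at_right show "\<forall>\<^sub>F h in at_right 0. cmod (\<tau> (K h * R h)) \<le> \<eta> * h"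
      proof eventually_elim
        case (elim h)
        have RM: "R h \<in> M" using Lo(1) elim(1) by (rule L2_small_mem)
        have "cmod (\<tau> (K h * R h)) \<le> n2 (K h * R h)"
          using op_bound_mem[OF o[OF elim(1)]] RM by (intro tr_le_n2) auto
        also have "\<dots> \<le> B * sqrt h * n2 (R h)" by (rule op_boundD[OF o[OF elim(1)] RM])
        also have "\<dots> \<le> B * sqrt h * (\<eta> / (B + 1) * sqrt h)" using elim B0 by (intro mult_left_mono) auto
        also have "\<dots> = (B / (B + 1)) * \<eta> * h" using elim by simp
        also have "\<dots> \<le> 1 * \<eta> * h" using B0 \<eta> elim by (intro mult_right_mono) auto
        finally show ?case by simp
      qed
    qed
  qed
  show ?thesis
  proof (rule negligible_cong_pos[OF negligible_add[OF 1 2]])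
    fix h :: real assume h: "h > 0"
    then have st: "0 \<le> s" "s < s + h" using s by auto
    have m: "y h \<in> M" "y' h \<in> M" "?d h \<in> M" "R h \<in> M" "R' h \<in> M"
      using h sf Lo dx_M[of s "s + h"] st by (auto simp: small_family_mem L2_small_mem)
    have a1: "\<tau> (c * y h * c' * y' h) = \<tau> (c * y h * c' * R' h) + \<kappa>' * \<tau> (c * y h * c' * ?d h)"
      using m cM by (simp add: R'_def right_diff_distrib tr_diff bop_scaleC_right tr_scaleC)
    have a2: "\<tau> (c * y h * c' * ?d h) = \<tau> (c * R h * c' * ?d h) + \<kappa> * \<tau> (c * ?d h * c' * ?d h)"
      using m cM by (simp add: R_def right_diff_distrib left_diff_distrib tr_diff bop_scaleC_right bop_scaleC_left tr_scaleC)
    have a3: "\<tau> (c * ?d h * c' * ?d h) = \<tau> c * \<tau> c' * of_real h"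
      using free_sandwich[OF dx_free[OF st] F_alg[OF s] F_M[OF s] dx_alg(1,2)[OF st] c(1,2) dx_alg(3)[OF st] dx_mean[OF st]]
        dx_var[OF st] by simp
    have a4: "\<tau> ((\<kappa>' *\<^sub>C (c' * ?d h * c)) * R h) = \<kappa>' * \<tau> (c * R h * c' * ?d h)"
      using m cM tr_comm[of "c' * ?d h" "c * R h"] by (simp add: bop_scaleC_left tr_scaleC mult.assoc)
    show "\<tau> (c * y h * c' * R' h) + \<tau> ((\<kappa>' *\<^sub>C (c' * ?d h * c)) * R h) =
      \<tau> (c * y h * c' * y' h) - \<kappa> * \<kappa>' * of_real h * (\<tau> c * \<tau> c')"
      unfolding a1 a2 a3 a4 by (simp add: algebra_simps)
  qed
qed

end

section \<open>Coefficients involving the projections\<close>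

lemma negligible_mult_linear:
  assumes f: "negligible (\<lambda>h. f h + of_real (h / 2) * a)" and g: "negligible (\<lambda>h. g h + of_real (h / 2) * b)"
  shows "negligible (\<lambda>h. f h * g h)"
proof -
  have lin: "\<forall>\<^sub>F h in at_right 0. cmod (f h) \<le> (cmod a + 1) * h" if "negligible (\<lambda>h. f h + of_real (h / 2) * a)" for f a
  proof -
    have "\<forall>\<^sub>F h in at_right 0. cmod (f h + of_real (h / 2) * a) \<le> 1 * h"
      using that zero_less_one unfolding negligible_def by blast
    with eventually_pos_at_right show ?thesis
    proof eventually_elim
      case (elim h)
      have "cmod (f h) = cmod ((f h + of_real (h / 2) * a) - of_real (h / 2) * a)" by simp
      also have "\<dots> \<le> cmod (f h + of_real (h / 2) * a) + cmod (of_real (h / 2) * a)" by (rule norm_triangle_ineq4)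
      also have "\<dots> \<le> 1 * h + h * cmod a" using elim by (intro add_mono) (auto simp: norm_mult norm_divide)
      finally show ?case by (simp add: algebra_simps)
    qed
  qed
  define K where "K = (cmod a + 1) * (cmod b + 1)"
  have K: "K > 0" by (simp add: K_def add_nonneg_pos)
  show ?thesis unfolding negligible_def
  proof (intro allI impI)
    fix \<eta> :: real assume "\<eta> > 0"
    then have "\<eta> / K > 0" using K by simp
    then have "\<forall>\<^sub>F h in at_right 0. h < \<eta> / K" unfolding eventually_at_right_field by blast
    with eventually_pos_at_right lin[OF f] lin[OF g]
    show "\<forall>\<^sub>F h in at_right 0. cmod (f h * g h) \<le> \<eta> * h"
    proof eventually_elim
      case (elim h)
      have "cmod (f h * g h) \<le> ((cmod a + 1) * h) * ((cmod b + 1) * h)"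
        unfolding norm_mult using elim by (intro mult_mono) auto
      also have "\<dots> = K * h * h" by (simp add: K_def mult_ac)
      also have "\<dots> \<le> K * (\<eta> / K) * h" using elim K by (intro mult_right_mono mult_left_mono) auto
      finally show ?case using K by simp
    qed
  qed
qed

locale free_liberation = free_unitary_bm M \<tau> F x u
  for M :: "'h::complex_hilbert bop set" and \<tau> F x u +
  fixes p q :: "'h bop"
  assumes p: "p \<in> M" "adj p = p" "p * p = p" and q: "q \<in> M" "adj q = q" "q * q = q"
    and freeness: "free \<tau> [star_alg (u ` {0..}), star_alg {p, q}]"
begin

abbreviation (input) "U \<equiv> star_alg (u ` {0..})"
abbreviation (input) "P \<equiv> star_alg {p, q}"
abbreviation (input) "Us s \<equiv> star_alg {u s}"

lemma U_M: "U \<subseteq> M" by (rule star_alg_subset) (auto intro: u_M)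
lemma P_M: "P \<subseteq> M" by (rule star_alg_subset) (use p q in auto)
sublocale U: unital_star_algebra U by (rule unital_star_algebra_star_alg) (auto intro: u_M)
sublocale P: unital_star_algebra P by (rule unital_star_algebra_star_alg) (use p q in auto)
lemma U_mem: "a \<in> U \<Longrightarrow> a \<in> M" using U_M by auto
lemma P_mem: "a \<in> P \<Longrightarrow> a \<in> M" using P_M by auto

lemma Us_alg: "0 \<le> s \<Longrightarrow> unital_star_algebra (Us s)"
  by (rule unital_star_algebra_star_alg) (auto intro: u_M)

lemma Us_F: assumes s: "0 \<le> s" shows "Us s \<subseteq> F s"
proof -
  interpret Fs: unital_star_algebra "F s" using s by (rule F_alg)
  show ?thesis by (rule Fs.star_alg_subset) (use s u_F in auto)
qed

lemma Us_U: assumes s: "0 \<le> s" shows "Us s \<subseteq> U"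
  by (rule U.star_alg_subset) (use s in \<open>auto intro: star_alg.gen\<close>)

lemma Us_op_bounded: "0 \<le> s \<Longrightarrow> a \<in> Us s \<Longrightarrow> op_bounded a"
  by (rule op_bounded_star_alg[of "{u s}"]) (auto intro: op_bounded_u)

lemma u_U: "0 \<le> t \<Longrightarrow> u t \<in> U" by (rule star_alg.gen) auto

lemma w_U: "0 \<le> s \<Longrightarrow> 0 < h \<Longrightarrow> w s h \<in> U"
  unfolding w_def using u_U[of s] u_U[of "s + h"] by auto

definition alternating :: "(nat \<times> 'h bop) list \<Rightarrow> bool" where
  "alternating W \<longleftrightarrow> (\<forall>(i, a)\<in>set W. i < 2 \<and> a \<in> [U, P] ! i \<and> \<tau> a = 0) \<and> distinct_adj (map fst W)"

lemma alternating_trace: "alternating W \<Longrightarrow> W \<noteq> [] \<Longrightarrow> \<tau> (prod_list (map snd W)) = 0"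
  using freeness unfolding free_def alternating_def by (auto simp: numeral_2_eq_2)

lemma alternating_append:
  "alternating V \<Longrightarrow> alternating W \<Longrightarrow> V \<noteq> [] \<Longrightarrow> W \<noteq> [] \<Longrightarrow> fst (last V) \<noteq> fst (hd W) \<Longrightarrow> alternating (V @ W)"
  by (auto simp: alternating_def distinct_adj_append_iff last_map hd_map)

text \<open>Alternating products of centred elements of \<open>P\<close> and \<open>Us s\<close> that begin and end in \<open>P\<close>.\<close>

inductive_set core :: "real \<Rightarrow> 'h bop set" for s where
  base: "b \<in> P \<Longrightarrow> \<tau> b = 0 \<Longrightarrow> b \<in> core s"
| step: "b \<in> P \<Longrightarrow> \<tau> b = 0 \<Longrightarrow> e \<in> Us s \<Longrightarrow> \<tau> e = 0 \<Longrightarrow> k \<in> core s \<Longrightarrow> b * e * k \<in> core s"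

lemma core_word:
  assumes s: "0 \<le> s" and k: "k \<in> core s"
  obtains W where "alternating W" "W \<noteq> []" "prod_list (map snd W) = k" "fst (hd W) = 1" "fst (last W) = 1"
proof -
  from k have "\<exists>W. alternating W \<and> W \<noteq> [] \<and> prod_list (map snd W) = k \<and> fst (hd W) = 1 \<and> fst (last W) = 1"
  proof induction
    case (base b)
    then show ?case by (intro exI[of _ "[(1, b)]"]) (auto simp: alternating_def)
  next
    case (step b e k)
    then obtain W where W: "alternating W" "W \<noteq> []" "prod_list (map snd W) = k" "fst (hd W) = 1" "fst (last W) = 1"
      by blast
    have "alternating ([(1, b), (0, e)] @ W)"
      by (rule alternating_append) (use step W Us_U[OF s] in \<open>auto simp: alternating_def\<close>)
    then show ?case using W
      by (intro exI[of _ "[(1, b), (0, e)] @ W"]) (auto simp: mult.assoc)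
  qed
  then show ?thesis using that by blast
qed

lemma core_M: assumes s: "0 \<le> s" and k: "k \<in> core s" shows "k \<in> M"
  using k
proof induction
  case (step b e k)
  then show ?case using P_mem[of b] U_mem[of e] Us_U[OF s] by auto
qed (simp add: P_mem)

text \<open>The centred part \<open>a - \<tau>(a) 1\<close> of an operator.\<close>

definition centred :: "'h bop \<Rightarrow> 'h bop" where "centred a = a - \<tau> a *\<^sub>C 1"

lemma centred_trace: "a \<in> M \<Longrightarrow> \<tau> (centred a) = 0" by (simp add: centred_def tr_diff tr_scaleC)
lemma centred_U: "a \<in> U \<Longrightarrow> centred a \<in> U" by (auto simp: centred_def)
lemma centred_P: "a \<in> P \<Longrightarrow> centred a \<in> P" by (auto simp: centred_def)
lemma centred_Us: "0 \<le> s \<Longrightarrow> a \<in> Us s \<Longrightarrow> centred a \<in> Us s"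
  using Us_alg unital_star_algebra.diff_mem unital_star_algebra.scaleC_mem unital_star_algebra.one_mem
  unfolding centred_def by blast
lemma alternating_single: "z \<in> U \<Longrightarrow> alternating [(0, centred z)]"
  by (simp add: alternating_def centred_U centred_trace U_mem)

lemma core_trace: assumes "0 \<le> s" "k \<in> core s" shows "\<tau> k = 0"
  by (rule core_word[OF assms]) (use alternating_trace in auto)

lemma core_trace_U:
  assumes s: "0 \<le> s" and k: "k \<in> core s" and z: "z \<in> U" shows "\<tau> (k * z) = 0"
proof -
  obtain W where W: "alternating W" "W \<noteq> []" "prod_list (map snd W) = k" "fst (hd W) = 1" "fst (last W) = 1"
    using core_word[OF s k] by metis
  have "alternating (W @ [(0, centred z)])"
    by (rule alternating_append) (use W alternating_single[OF z] in auto)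
  from alternating_trace[OF this] have "\<tau> (k * centred z) = 0" using W by simp
  then show ?thesis using core_M[OF s k] U_mem[OF z] core_trace[OF s k]
    by (simp add: centred_def right_diff_distrib tr_diff bop_scaleC_right tr_scaleC)
qed

lemma core_sandwich_trace:
  assumes s: "0 \<le> s" and k: "k \<in> core s" and e: "e \<in> U" "e' \<in> U" and a: "a \<in> U"
  shows "\<tau> (e * k * e' * a) = 0"
  using tr_comm[of e "k * (e' * a)"] core_trace_U[OF s k, of "e' * a * e"] U_mem core_M[OF s k] e a
  by (simp add: mult.assoc)

text \<open>Write \<open>z\<close> and \<open>z'\<close> as centred parts plus constants. A word in which a centred part survives is
  alternating, possibly after a cyclic rotation, so only the product of the constants remains.\<close>

lemma core_quad:
  assumes s: "0 \<le> s" and k: "k1 \<in> core s" "k2 \<in> core s" and z: "z \<in> U" "z' \<in> U"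
  shows "\<tau> (k1 * z * k2 * z') = \<tau> z * \<tau> z' * \<tau> (k1 * k2)"
proof -
  obtain V where V: "alternating V" "V \<noteq> []" "prod_list (map snd V) = k1" "fst (hd V) = 1" "fst (last V) = 1"
    using core_word[OF s k(1)] by metis
  obtain W where W: "alternating W" "W \<noteq> []" "prod_list (map snd W) = k2" "fst (hd W) = 1" "fst (last W) = 1"
    using core_word[OF s k(2)] by metis
  have VW: "alternating (V @ [(0, centred z)] @ W)" 
    by (intro alternating_append) (use V W alternating_single z in auto)
  have WV: "alternating (W @ [(0, centred z')] @ V)" 
    by (intro alternating_append) (use V W alternating_single z in auto)
  have VWz: "alternating ((V @ [(0, centred z)] @ W) @ [(0, centred z')])"
    by (rule alternating_append) (use VW V W alternating_single z in auto)
  have m: "k1 \<in> M" "k2 \<in> M" "z \<in> M" "z' \<in> M" "centred z \<in> M" "centred z' \<in> M"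
    using core_M[OF s] k z U_mem centred_U by auto
  have 1: "\<tau> (k1 * centred z * k2 * centred z') = 0" using alternating_trace[OF VWz] V W by (simp add: mult.assoc)
  have 2: "\<tau> (k1 * centred z * k2) = 0" using alternating_trace[OF VW] V W by (simp add: mult.assoc)
  have "\<tau> (k2 * centred z' * k1) = 0" using alternating_trace[OF WV] V W by (simp add: mult.assoc)
  then have 3: "\<tau> (k1 * k2 * centred z') = 0" using tr_comm[of k1 "k2 * centred z'"] m by (simp add: mult.assoc)
  have "k1 * z * k2 * z' = k1 * (centred z + \<tau> z *\<^sub>C 1) * k2 * (centred z' + \<tau> z' *\<^sub>C 1)" by (simp add: centred_def)
  also have "\<dots> = k1 * centred z * k2 * centred z' + \<tau> z' *\<^sub>C (k1 * centred z * k2) + \<tau> z *\<^sub>C (k1 * k2 * centred z') + (\<tau> z * \<tau> z') *\<^sub>C (k1 * k2)"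
    by (simp add: distrib_left distrib_right bop_scaleC_left bop_scaleC_right scaleC_add_right scaleC_scaleC mult.assoc add_ac mult.commute)
  also have "\<tau> \<dots> = \<tau> z * \<tau> z' * \<tau> (k1 * k2)" using m by (simp add: tr_add tr_scaleC 1 2 3)
  finally show ?thesis .
qed

text \<open>A spanning set of the algebra generated by \<open>u\<^sub>s\<close>, \<open>p\<close> and \<open>q\<close>: the elements \<open>e k e'\<close> have conditional
  expectation zero onto \<open>U\<close>, so \<open>Us s\<close> carries all of the conditional expectation.\<close>

definition joint_gens :: "real \<Rightarrow> 'h bop set" where
  "joint_gens s = Us s \<union> {e * k * e' | e k e'. e \<in> Us s \<and> k \<in> core s \<and> e' \<in> Us s}"

definition joint_alg :: "real \<Rightarrow> 'h bop set" where "joint_alg s = complex_vector.span (joint_gens s)"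

lemma joint_gens_M: assumes s: "0 \<le> s" shows "a \<in> joint_gens s \<Longrightarrow> a \<in> M"
  unfolding joint_gens_def using Us_U[OF s] U_mem core_M[OF s] by blast

lemma joint_alg_induct [consumes 1, case_names gen add scale]:
  assumes a: "a \<in> joint_alg s" and gen: "\<And>a. a \<in> joint_gens s \<Longrightarrow> Q a"
    and add: "\<And>a b. a \<in> joint_alg s \<Longrightarrow> b \<in> joint_alg s \<Longrightarrow> Q a \<Longrightarrow> Q b \<Longrightarrow> Q (a + b)"
    and scale: "\<And>c a. a \<in> joint_alg s \<Longrightarrow> Q a \<Longrightarrow> Q (c *\<^sub>C a)"
  shows "Q a"
proof -
  have one: "1 \<in> joint_gens s" by (auto simp: joint_gens_def star_alg.one)
  have "1 \<in> joint_alg s" using one by (simp add: joint_alg_def complex_vector.span_base)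
  from scale[OF this gen[OF one], of 0] have Q0: "Q 0" by simp
  have "a \<in> joint_alg s \<and> Q a"
    using a unfolding joint_alg_def
  proof (induction rule: complex_vector.span_induct_alt)
    case base show ?case using Q0 complex_vector.span_zero by blast
  next
    case (step c x y)
    have x: "x \<in> joint_alg s" using step by (simp add: joint_alg_def complex_vector.span_base)
    have cx: "c *\<^sub>C x \<in> joint_alg s" using x unfolding joint_alg_def by (rule complex_vector.span_scale)
    have "Q (c *\<^sub>C x + y)" using add[OF cx _ scale[OF x gen[OF step(1)]]] step by (simp add: joint_alg_def)
    then show ?case using cx step by (simp add: joint_alg_def complex_vector.span_add)
  qed
  then show ?thesis by blast
qed

lemma joint_alg_gen: "a \<in> joint_gens s \<Longrightarrow> a \<in> joint_alg s" by (simp add: joint_alg_def complex_vector.span_base)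
lemma joint_alg_add: "a \<in> joint_alg s \<Longrightarrow> b \<in> joint_alg s \<Longrightarrow> a + b \<in> joint_alg s" by (simp add: joint_alg_def complex_vector.span_add)
lemma joint_alg_scale: "a \<in> joint_alg s \<Longrightarrow> c *\<^sub>C a \<in> joint_alg s" by (simp add: joint_alg_def complex_vector.span_scale)

lemma joint_alg_M: assumes s: "0 \<le> s" and a: "a \<in> joint_alg s" shows "a \<in> M"
  using a
proof (induction rule: joint_alg_induct)
  case (gen a) then show ?case using joint_gens_M[OF s] by blast
qed auto

lemma joint_alg_left_U:
  assumes s: "0 \<le> s" and e: "e \<in> Us s" shows "a \<in> joint_alg s \<Longrightarrow> e * a \<in> joint_alg s"
proof (induction rule: joint_alg_induct)
  case (gen a)
  interpret Us: unital_star_algebra "Us s" using s by (rule Us_alg)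
  have "e * a \<in> joint_gens s"
  proof (cases "a \<in> Us s")
    case True then show ?thesis using e by (auto simp: joint_gens_def)
  next
    case False
    then obtain e1 k e' where "a = e1 * k * e'" "e1 \<in> Us s" "k \<in> core s" "e' \<in> Us s"
      using gen by (auto simp: joint_gens_def)
    then have "e * a = (e * e1) * k * e'" "e * e1 \<in> Us s" "k \<in> core s" "e' \<in> Us s"
      using e by (auto simp: mult.assoc)
    then show ?thesis unfolding joint_gens_def by blast
  qed
  then show ?case by (rule joint_alg_gen)
qed (simp_all add: distrib_left bop_scaleC_right joint_alg_add joint_alg_scale)

lemma joint_alg_core: "0 \<le> s \<Longrightarrow> k \<in> core s \<Longrightarrow> e' \<in> Us s \<Longrightarrow> k * e' \<in> joint_alg s"
  by (rule joint_alg_gen) (use star_alg.one[of "{u s}"] in \<open>force simp: joint_gens_def\<close>)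

text \<open>Centring the factors one at a time keeps words alternating; when two letters of \<open>P\<close> meet, their
  product is a single letter up to a constant, and the constant belongs to a shorter word. Hence the
  span is closed under multiplication by generators from the left.\<close>

lemma joint_alg_left_P:
  assumes s: "0 \<le> s" and b: "b \<in> P" shows "a \<in> joint_alg s \<Longrightarrow> b * a \<in> joint_alg s"
proof (induction rule: joint_alg_induct)
  case (gen a)
  interpret Us: unital_star_algebra "Us s" using s by (rule Us_alg)
  have cP: "centred c \<in> P" "\<tau> (centred c) = 0" if "c \<in> P" for c using that centred_P centred_trace P_mem by auto
  have split: "c * y = centred c * y + \<tau> c *\<^sub>C y" for c y by (simp add: centred_def left_diff_distrib bop_scaleC_left)
  have on_U: "c * e \<in> joint_alg s" if "c \<in> P" "e \<in> Us s" for c e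
    unfolding split[of c e]
    by (intro joint_alg_add joint_alg_scale joint_alg_core[OF s] core.base cP that joint_alg_gen) (use that in \<open>auto simp: joint_gens_def\<close>)
  \<comment> \<open>left multiplication of a core word: merge the two adjacent letters of \<open>P\<close>\<close>
  have on_core: "c * (k * e') \<in> joint_alg s" if c: "c \<in> P" and k: "k \<in> core s" and e': "e' \<in> Us s" for c k e'
    using k
  proof cases
    case base
    then have "c * k \<in> P" using c by auto
    then show ?thesis using on_U[of "c * k" e'] e' by (simp add: mult.assoc)
  next
    case (step b' e k')
    have cb: "c * b' \<in> P" using c step by auto
    have eq: "c * (k * e') = (c * b') * (e * (k' * e'))" by (simp add: step mult.assoc)
    have "centred (c * b') * e * k' \<in> core s" by (intro core.step cP cb step)
    from joint_alg_core[OF s this e'] have 1: "centred (c * b') * (e * (k' * e')) \<in> joint_alg s" by (simp add: mult.assoc)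
    have 2: "e * (k' * e') \<in> joint_alg s" by (intro joint_alg_left_U joint_alg_core s step e')
    show ?thesis unfolding eq split[of "c * b'"] by (intro joint_alg_add joint_alg_scale 1 2)
  qed
  show ?case
  proof (cases "a \<in> Us s")
    case True then show ?thesis by (intro on_U b)
  next
    case False
    then obtain e k e' where a: "a = e * k * e'" "e \<in> Us s" "k \<in> core s" "e' \<in> Us s"
      using gen by (auto simp: joint_gens_def)
    have ce: "centred e \<in> Us s" "\<tau> (centred e) = 0" using a centred_Us[OF s] centred_trace Us_U[OF s] U_mem by auto
    have ek: "centred b * centred e * k \<in> core s" by (intro core.step cP b ce a)
    have 1: "centred b * (centred e * (k * e')) \<in> joint_alg s" using joint_alg_core[OF s ek a(4)] by (simp add: mult.assoc)
    have 2: "centred e * (k * e') \<in> joint_alg s" by (intro joint_alg_left_U joint_alg_core s a ce)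
    have 3: "b * (k * e') \<in> joint_alg s" by (intro on_core b a)
    have "b * a = (centred b * (centred e * (k * e')) + \<tau> b *\<^sub>C (centred e * (k * e'))) + \<tau> e *\<^sub>C (b * (k * e'))"
      unfolding split[of b "centred e * (k * e')", symmetric]
      by (simp add: a(1) centred_def[of e] left_diff_distrib right_diff_distrib bop_scaleC_left bop_scaleC_right mult.assoc)
    then show ?thesis using 1 2 3 by (simp add: joint_alg_add joint_alg_scale)
  qed
qed (simp_all add: distrib_left bop_scaleC_right joint_alg_add joint_alg_scale)

text \<open>The part of \<open>w_drift\<close> that survives the passage to \<open>w\<^sup>*\<close> and depends only on the algebra of the
  process: to first order the family behaves like the scalar \<open>- h/2\<close>.\<close>

definition drift :: "real \<Rightarrow> (real \<Rightarrow> 'h bop) \<Rightarrow> bool" where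
  "drift s y \<longleftrightarrow> (\<forall>h>0. y h \<in> U) \<and> (\<forall>c\<in>Us s. negligible (\<lambda>h. \<tau> (c * y h) + of_real (h / 2) * \<tau> c))"

lemma drift_w: "0 \<le> s \<Longrightarrow> drift s (w s)"
  using w_drift Us_F unfolding drift_def by (auto intro: w_U)

lemma drift_adj_w: assumes s: "0 \<le> s" shows "drift s (\<lambda>h. adj (w s h))"
  unfolding drift_def
proof (intro conjI ballI allI impI)
  show "adj (w s h) \<in> U" if "h > 0" for h using w_U[OF s that] by auto
  fix c assume c: "c \<in> Us s"
  interpret Us: unital_star_algebra "Us s" using s by (rule Us_alg)
  have cM: "c \<in> M" using c Us_U[OF s] U_mem by auto
  have "negligible (\<lambda>h. \<tau> (adj c * w s h) + of_real (h / 2) * \<tau> (adj c))"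
    using drift_w[OF s] Us.adj_mem[OF c] unfolding drift_def by blast
  from negligible_cnj[OF this] show "negligible (\<lambda>h. \<tau> (c * adj (w s h)) + of_real (h / 2) * \<tau> c)"
  proof (rule negligible_cong_pos)
    fix h :: real assume "h > 0"
    then have wM: "w s h \<in> M" using s w_M by auto
    have "cnj (\<tau> (adj c * w s h)) = \<tau> (adj (w s h) * c)" using tr_adj_mult[OF cM wM] by simp
    also have "\<dots> = \<tau> (c * adj (w s h))" using cM wM by (intro tr_comm) auto
    finally show "cnj (\<tau> (adj c * w s h) + of_real (h / 2) * \<tau> (adj c)) = \<tau> (c * adj (w s h)) + of_real (h / 2) * \<tau> c"
      using cM by (simp add: tr_adj)
  qed
qed

text \<open>An element \<open>e k e'\<close> is orthogonal to \<open>U\<close>, so the trace is zero exactly on such words.\<close>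

lemma drift_joint_alg:
  assumes s: "0 \<le> s" and y: "drift s y"
  shows "c \<in> joint_alg s \<Longrightarrow> negligible (\<lambda>h. \<tau> (c * y h) + of_real (h / 2) * \<tau> c)"
proof (induction rule: joint_alg_induct)
  case (gen c)
  show ?case
  proof (cases "c \<in> Us s")
    case True then show ?thesis using y by (auto simp: drift_def)
  next
    case False
    then obtain e k e' where c: "c = e * k * e'" "e \<in> Us s" "k \<in> core s" "e' \<in> Us s"
      using gen by (auto simp: joint_gens_def)
    have eU: "e \<in> U" "e' \<in> U" using c Us_U[OF s] by auto
    have z: "\<tau> (c * a) = 0" if "a \<in> U" for a
      unfolding c(1) by (rule core_sandwich_trace[OF s c(3) eU that])
    show ?thesis by (rule negligible_cong_pos[OF negligible_0]) (use z[of 1] z y in \<open>auto simp: drift_def\<close>)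
  qed
next
  case (add a b)
  have m: "a \<in> M" "b \<in> M" using add joint_alg_M[OF s] by auto
  show ?case
    by (rule negligible_cong_pos[OF negligible_add[OF add(3,4)]])
      (use m y U_mem in \<open>auto simp: drift_def distrib_right distrib_left tr_add\<close>)
next
  case (scale k a)
  have m: "a \<in> M" using scale joint_alg_M[OF s] by auto
  show ?case
    by (rule negligible_cong_pos[OF negligible_cmult[OF scale(2), of k]])
      (use m y U_mem in \<open>auto simp: drift_def bop_scaleC_left distrib_left tr_scaleC\<close>)
qed

text \<open>Split both coefficients. If one of them is a word \<open>e k e'\<close> and the other lies in \<open>Us s\<close>, the trace is
  zero. If both are words, \<open>core_quad\<close> turns it into a product of two first-order quantities, which is
  \<open>O(h\<^sup>2)\<close>, while the trace of each word is zero.\<close>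

lemma quadratic_joint_alg:
  assumes s: "0 \<le> s" and y: "drift s y" "leading_dx s \<kappa> y" and y': "drift s y'" "leading_dx s \<kappa>' y'"
    and c: "c \<in> joint_alg s" and c': "c' \<in> joint_alg s"
  shows "negligible (\<lambda>h. \<tau> (c * y h * c' * y' h) - \<kappa> * \<kappa>' * of_real h * (\<tau> c * \<tau> c'))"
  using c
proof (induction rule: joint_alg_induct)
  have yU: "y h \<in> U" "y' h \<in> U" "y h \<in> M" "y' h \<in> M" if "h > 0" for h using y y' that U_mem by (auto simp: drift_def)
  have c'M: "c' \<in> M" using joint_alg_M[OF s c'] .
  {
    case (gen c)
    have cM: "c \<in> M" using gen joint_gens_M[OF s] by auto
    show ?case using c'
    proof (induction rule: joint_alg_induct)
      case (gen c')
      interpret Us: unital_star_algebra "Us s" using s by (rule Us_alg)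
      consider (UU) "c \<in> Us s" "c' \<in> Us s"
        | (KU) e k e' where "c = e * k * e'" "e \<in> Us s" "k \<in> core s" "e' \<in> Us s" "c' \<in> Us s"
        | (UK) e k e' where "c' = e * k * e'" "e \<in> Us s" "k \<in> core s" "e' \<in> Us s" "c \<in> Us s"
        | (KK) e1 k1 e1' e2 k2 e2' where "c = e1 * k1 * e1'" "e1 \<in> Us s" "k1 \<in> core s" "e1' \<in> Us s"
            "c' = e2 * k2 * e2'" "e2 \<in> Us s" "k2 \<in> core s" "e2' \<in> Us s"
        using \<open>c \<in> joint_gens s\<close> \<open>c' \<in> joint_gens s\<close> unfolding joint_gens_def by blast
      then show ?case
      proof cases
        case UU
        show ?thesis
          by (rule leading_dx_quadratic) (use UU s y y' Us_op_bounded Us_F in auto)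
      next
        case KU
        have eU: "e \<in> U" "e' \<in> U" "c' \<in> U" using KU Us_U[OF s] by auto
        have z: "\<tau> (c * a) = 0" if "a \<in> U" for a
          unfolding KU(1) by (rule core_sandwich_trace[OF s KU(3) eU(1,2) that])
        show ?thesis
        proof (rule negligible_cong_pos[OF negligible_0])
          fix h :: real assume "h > 0"
          then show "0 = \<tau> (c * y h * c' * y' h) - \<kappa> * \<kappa>' * of_real h * (\<tau> c * \<tau> c')"
            using z[of 1] z[of "y h * c' * y' h"] yU eU by (simp add: mult.assoc)
        qed
      next
        case UK
        have eU: "e \<in> U" "e' \<in> U" "c \<in> U" using UK Us_U[OF s] by auto
        have z: "\<tau> (c' * a) = 0" if "a \<in> U" for a
          unfolding UK(1) by (rule core_sandwich_trace[OF s UK(3) eU(1,2) that])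
        show ?thesis
        proof (rule negligible_cong_pos[OF negligible_0])
          fix h :: real assume h: "h > 0"
          have "\<tau> (c * y h * c' * y' h) = \<tau> (c' * (y' h * c * y h))"
            using tr_comm[of "c * y h" "c' * y' h"] joint_gens_M[OF s \<open>c' \<in> joint_gens s\<close>] cM yU[OF h] by (simp add: mult.assoc)
          then show "0 = \<tau> (c * y h * c' * y' h) - \<kappa> * \<kappa>' * of_real h * (\<tau> c * \<tau> c')"
            using z[of 1] z[of "y' h * c * y h"] yU[OF h] eU by simp
        qed
      next
        case KK
        have eU: "e1 \<in> U" "e1' \<in> U" "e2 \<in> U" "e2' \<in> U" using KK Us_U[OF s] by auto
        have m: "e1 \<in> M" "e1' \<in> M" "e2 \<in> M" "e2' \<in> M" "k1 \<in> M" "k2 \<in> M" using eU U_mem core_M[OF s] KK by auto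
        have z: "\<tau> c = 0"
          using tr_comm[of e1 "k1 * e1'"] core_trace_U[OF s KK(3), of "e1' * e1"] m eU by (simp add: KK mult.assoc)
        have n1: "negligible (\<lambda>h. \<tau> (e2 * e1' * y h) + of_real (h / 2) * \<tau> (e2 * e1'))"
          using y KK by (auto simp: drift_def)
        have n2: "negligible (\<lambda>h. \<tau> (e1 * e2' * y' h) + of_real (h / 2) * \<tau> (e1 * e2'))"
          using y' KK by (auto simp: drift_def)
        have "negligible (\<lambda>h. \<tau> (k1 * k2) * (\<tau> (e2 * e1' * y h) * \<tau> (e1 * e2' * y' h)))"
          by (intro negligible_cmult negligible_mult_linear[OF n1 n2])
        then show ?thesis
        proof (rule negligible_cong_pos)
          fix h :: real assume h: "h > 0"
          have "\<tau> (c * y h * c' * y' h) = \<tau> (k1 * (e1' * y h * e2) * k2 * (e2' * y' h * e1))"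
            using tr_comm[of e1 "k1 * (e1' * y h * e2) * k2 * (e2' * y' h)"] m yU[OF h] by (simp add: KK mult.assoc)
          also have "\<dots> = \<tau> (e1' * y h * e2) * \<tau> (e2' * y' h * e1) * \<tau> (k1 * k2)"
            by (rule core_quad) (use s KK eU yU[OF h] in auto)
          also have "\<tau> (e1' * y h * e2) = \<tau> (e2 * e1' * y h)"
            using tr_comm[of "e1' * y h" e2] m yU[OF h] by (simp add: mult.assoc)
          also have "\<tau> (e2' * y' h * e1) = \<tau> (e1 * e2' * y' h)"
            using tr_comm[of "e2' * y' h" e1] m yU[OF h] by (simp add: mult.assoc)
          finally show "\<tau> (k1 * k2) * (\<tau> (e2 * e1' * y h) * \<tau> (e1 * e2' * y' h)) =
            \<tau> (c * y h * c' * y' h) - \<kappa> * \<kappa>' * of_real h * (\<tau> c * \<tau> c')" using z by simp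
        qed
      qed
    next
      case (add a b)
      have m: "a \<in> M" "b \<in> M" using add joint_alg_M[OF s] by auto
      show ?case
        by (rule negligible_cong_pos[OF negligible_add[OF add(3,4)]])
          (use m cM yU in \<open>auto simp: distrib_right distrib_left tr_add algebra_simps\<close>)
    next
      case (scale k a)
      have m: "a \<in> M" using scale joint_alg_M[OF s] by auto
      show ?case
        by (rule negligible_cong_pos[OF negligible_cmult[OF scale(2), of k]])
          (use m cM yU in \<open>auto simp: bop_scaleC_left bop_scaleC_right tr_scaleC algebra_simps\<close>)
    qed
  next
    case (add a b)
    have m: "a \<in> M" "b \<in> M" using add joint_alg_M[OF s] by auto
    show ?case
      by (rule negligible_cong_pos[OF negligible_add[OF add(3,4)]])
        (use m c'M yU in \<open>auto simp: distrib_right distrib_left tr_add algebra_simps\<close>)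
  next
    case (scale k a)
    have m: "a \<in> M" using scale joint_alg_M[OF s] by auto
    show ?case
      by (rule negligible_cong_pos[OF negligible_cmult[OF scale(2), of k]])
        (use m c'M yU in \<open>auto simp: bop_scaleC_left bop_scaleC_right tr_scaleC algebra_simps\<close>)
  }
qed

end

section \<open>The moment equations\<close>

lemma power_expand:
  fixes X Y :: "'h::complex_hilbert bop"
  shows "Y ^ n = X ^ n + (\<Sum>j<n. X ^ j * (Y - X) * Y ^ (n - 1 - j))"
proof (induction n)
  case (Suc n)
  have "Y ^ Suc n = X * Y ^ n + (Y - X) * Y ^ n" by (simp add: left_diff_distrib)
  also have "X * Y ^ n = X ^ Suc n + (\<Sum>j<n. X ^ Suc j * (Y - X) * Y ^ (n - 1 - j))"
    by (subst Suc) (simp add: distrib_left sum_distrib_left mult.assoc)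
  also have "\<dots> + (Y - X) * Y ^ n = X ^ Suc n + (\<Sum>j<Suc n. X ^ j * (Y - X) * Y ^ (Suc n - 1 - j))"
    by (subst sum.lessThan_Suc_shift) (simp add: add_ac)
  finally show ?case .
qed simp

text \<open>Telescoping three times isolates the terms with one and with two increments \<open>E\<close>; each remaining term
  contains three.\<close>

lemma power_expand3:
  fixes X Y :: "'h::complex_hilbert bop"
  defines "E \<equiv> Y - X"
  shows "Y ^ n = X ^ n + (\<Sum>j<n. X ^ j * E * X ^ (n - 1 - j))
     + (\<Sum>j<n. \<Sum>i<n - 1 - j. X ^ j * E * X ^ i * E * X ^ (n - 1 - j - 1 - i))
     + (\<Sum>j<n. \<Sum>i<n - 1 - j. \<Sum>l<n - 1 - j - 1 - i. X ^ j * E * X ^ i * E * X ^ l * E * Y ^ (n - 1 - j - 1 - i - 1 - l))"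
proof -
  have 1: "Y ^ k = X ^ k + (\<Sum>l<k. X ^ l * E * Y ^ (k - 1 - l))" for k
    unfolding E_def by (rule power_expand)
  have 2: "Y ^ k = X ^ k + (\<Sum>i<k. X ^ i * E * X ^ (k - 1 - i))
     + (\<Sum>i<k. \<Sum>l<k - 1 - i. X ^ i * E * X ^ l * E * Y ^ (k - 1 - i - 1 - l))" for k
    by (subst 1, subst 1) (simp add: distrib_left sum_distrib_left sum.distrib mult.assoc add.assoc)
  show ?thesis
    by (subst 1, subst 2) (simp add: distrib_left sum_distrib_left sum.distrib mult.assoc add.assoc)
qed

context free_liberation begin

definition pt :: "real \<Rightarrow> 'h bop" where "pt t = u t * p * adj (u t)"
definition X :: "real \<Rightarrow> 'h bop" where "X t = q * pt t"

lemma pt_M: "0 \<le> t \<Longrightarrow> pt t \<in> M" unfolding pt_def using u_M[of t] p by auto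
lemma X_M: "0 \<le> t \<Longrightarrow> X t \<in> M" unfolding X_def using pt_M[of t] q by auto

lemma op_bound_p: "op_bound 1 p" and op_bound_q: "op_bound 1 q" using p q by (auto intro: op_bound_projection)
lemma op_bounded_p: "op_bounded p" and op_bounded_q: "op_bounded q" using op_bound_p op_bound_q by (auto simp: op_bounded_def)

lemma op_bound_pt: assumes "0 \<le> t" shows "op_bound 1 (pt t)"
  using op_bound_mult[OF op_bound_mult[OF u_op_bound[OF assms] op_bound_p] op_bound_adj[OF u_op_bound[OF assms]]] by (simp add: pt_def)

lemma op_bound_X: assumes "0 \<le> t" shows "op_bound 1 (X t)"
  using op_bound_mult[OF op_bound_q op_bound_pt[OF assms]] by (simp add: X_def)

text \<open>The increment of \<open>p\<close> in the moving frame: \<open>p\<^bsub>s+h\<^esub> - p\<^sub>s = u\<^sub>s Z u\<^sub>s\<^sup>*\<close>.\<close>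

definition Z :: "real \<Rightarrow> real \<Rightarrow> 'h bop" where
  "Z s h = w s h * p + p * adj (w s h) + w s h * p * adj (w s h)"

definition E :: "real \<Rightarrow> real \<Rightarrow> 'h bop" where "E s h = X (s + h) - X s"

lemma E_eq: assumes s: "0 \<le> s" "0 < h" shows "E s h = q * u s * Z s h * adj (u s)"
proof -
  have m: "w s h \<in> M" "u s \<in> M" using w_M[OF s] u_M s by auto
  have "adj (u (s + h)) = (1 + adj (w s h)) * adj (u s)"
    unfolding u_w[OF s(1)] using m by simp
  then have "pt (s + h) = u s * ((1 + w s h) * p * (1 + adj (w s h))) * adj (u s)"
    unfolding pt_def u_w[OF s(1)] by (simp add: mult.assoc)
  also have "(1 + w s h) * p * (1 + adj (w s h)) = p + Z s h"
    by (simp add: Z_def distrib_left distrib_right mult.assoc add_ac)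
  finally show ?thesis by (simp add: E_def X_def pt_def distrib_left distrib_right mult.assoc)
qed

lemma small_family_Z: assumes s: "0 \<le> s" shows "small_family (Z s)"
  unfolding Z_def[abs_def]
  by (intro small_family_add small_family_left small_family_right small_family_adj small_family_w bounded_family_mult bounded_family_const bounded_family_adj bounded_family_w op_bounded_p s)

lemma small_family_cong: 
  assumes "small_family e" "\<And>h. h > 0 \<Longrightarrow> e h = f h" shows "small_family f"
  using assms unfolding small_family_def bounded_family_def by metis

lemma small_family_E: assumes s: "0 \<le> s" shows "small_family (E s)"
proof (rule small_family_cong)
  show "small_family (\<lambda>h. (q * u s) * Z s h * adj (u s))"
    by (intro small_family_right small_family_left small_family_Z bounded_family_const op_bounded_mult op_bounded_adj op_bounded_q op_bounded_u s)
qed (use E_eq s in auto)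

text \<open>A cyclic word that is cut at one increment becomes \<open>A s m\<close> in the moving frame. For \<open>m = 0\<close> it is
  \<open>u\<^sub>s\<^sup>* q u\<^sub>s\<close>, of trace \<open>\<tau>(q)\<close>; this boundary value is why \<open>G s 0\<close> differs from the pattern of \<open>G_Suc\<close>.\<close>

definition A :: "real \<Rightarrow> nat \<Rightarrow> 'h bop" where "A s m = adj (u s) * X s ^ m * q * u s"

lemma A_M: "0 \<le> s \<Longrightarrow> A s m \<in> M" unfolding A_def using u_M[of s] X_M[of s] q by auto

lemma X_alg: assumes s: "0 \<le> s" shows "a \<in> joint_alg s \<Longrightarrow> X s ^ m * a \<in> joint_alg s"
proof (induction m)
  case (Suc m)
  interpret Us: unital_star_algebra "Us s" using s by (rule Us_alg)
  have us: "u s \<in> Us s" by (simp add: star_alg.gen)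
  have "p \<in> P" "q \<in> P" by (simp_all add: star_alg.gen)
  have "q * (u s * (p * (adj (u s) * (X s ^ m * a)))) \<in> joint_alg s"
    by (intro joint_alg_left_P joint_alg_left_U s us Us.adj_mem Suc \<open>p \<in> P\<close> \<open>q \<in> P\<close>)
  then show ?case by (simp add: X_def pt_def mult.assoc)
qed simp

lemma A_alg: assumes s: "0 \<le> s" and r: "r \<in> P" shows "A s m * r \<in> joint_alg s"
proof -
  interpret Us: unital_star_algebra "Us s" using s by (rule Us_alg)
  have us: "u s \<in> Us s" by (simp add: star_alg.gen)
  have pq: "q \<in> P" by (simp add: star_alg.gen)
  have "1 \<in> joint_alg s" by (rule joint_alg_gen) (simp add: joint_gens_def star_alg.one)
  then have "r * 1 \<in> joint_alg s" by (rule joint_alg_left_P[OF s r])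
  then have "adj (u s) * (X s ^ m * (q * (u s * (r * 1)))) \<in> joint_alg s"
    by (rule joint_alg_left_U[OF s Us.adj_mem[OF us] X_alg[OF s joint_alg_left_P[OF s pq joint_alg_left_U[OF s us]]]])
  then show ?thesis by (simp add: A_def mult.assoc)
qed

lemma p_P: "p \<in> P" by (simp add: star_alg.gen)

lemma A_algs: 
  assumes s: "0 \<le> s" 
  shows "A s m \<in> joint_alg s" "A s m * p \<in> joint_alg s" "p * A s m \<in> joint_alg s" "p * A s m * p \<in> joint_alg s"
  using A_alg[OF s P.one_mem, of m] A_alg[OF s p_P, of m]
    joint_alg_left_P[OF s p_P A_alg[OF s P.one_mem, of m]] joint_alg_left_P[OF s p_P A_alg[OF s p_P, of m]]
  by (simp_all add: mult.assoc)

definition G :: "real \<Rightarrow> nat \<Rightarrow> complex" where "G s m = \<tau> (A s m)"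
definition \<gamma> :: "real \<Rightarrow> nat \<Rightarrow> complex" where "\<gamma> s m = \<tau> (A s m * p)"

lemma tr_pA: assumes s: "0 \<le> s" shows "\<tau> (p * A s m) = \<gamma> s m" "\<tau> (p * A s m * p) = \<gamma> s m"
  using tr_comm[of p "A s m"] tr_comm[of p "A s m * p"] A_M[OF s, of m] p
  by (simp_all add: \<gamma>_def mult.assoc)

definition linear_rate :: "real \<Rightarrow> nat \<Rightarrow> complex" where
  "linear_rate s m = \<tau> p * G s m - \<gamma> s m"
definition pair_rate :: "real \<Rightarrow> nat \<Rightarrow> nat \<Rightarrow> complex" where
  "pair_rate s m i = G s m * \<gamma> s i + \<gamma> s m * G s i - 2 * (\<gamma> s m * \<gamma> s i)"

text \<open>The two linear terms of \<open>Z\<close> contribute the drift \<open>- h \<tau>(A p)\<close>, the term \<open>w p w\<^sup>*\<close> the Ito correction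
  \<open>h \<tau>(A) \<tau>(p)\<close>.\<close>

lemma first_order:
  assumes s: "0 \<le> s"
  shows "negligible (\<lambda>h. \<tau> (A s m * Z s h) - of_real h * linear_rate s m)"
proof -
  note al = A_algs[OF s, of m]
  have 1: "negligible (\<lambda>h. \<tau> (p * A s m * w s h) + of_real (h / 2) * \<tau> (p * A s m))"
    by (rule drift_joint_alg[OF s drift_w[OF s] al(3)])
  have 2: "negligible (\<lambda>h. \<tau> (A s m * p * adj (w s h)) + of_real (h / 2) * \<tau> (A s m * p))"
    by (rule drift_joint_alg[OF s drift_adj_w[OF s] al(2)])
  have palg: "p \<in> joint_alg s" using joint_alg_left_P[OF s p_P joint_alg_gen[of 1]] by (simp add: joint_gens_def star_alg.one)
  have 3: "negligible (\<lambda>h. \<tau> (A s m * w s h * p * adj (w s h)) - \<i> * (-\<i>) * of_real h * (\<tau> (A s m) * \<tau> p))"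
    by (rule quadratic_joint_alg[OF s drift_w[OF s] leading_dx_w[OF s] drift_adj_w[OF s] leading_dx_adj_w[OF s] al(1) palg])
  show ?thesis
  proof (rule negligible_cong_pos[OF negligible_add[OF negligible_add[OF 1 2] 3]])
    fix h :: real assume h: "h > 0"
    have m: "A s m \<in> M" "w s h \<in> M" using A_M[OF s] w_M[OF s h] by auto
    have "\<tau> (A s m * Z s h) = \<tau> (A s m * (w s h * p)) + \<tau> (A s m * p * adj (w s h)) + \<tau> (A s m * w s h * p * adj (w s h))"
      using m p by (simp add: Z_def distrib_left tr_add mult.assoc)
    also have "\<tau> (A s m * (w s h * p)) = \<tau> (p * A s m * w s h)"
      using tr_comm[of "A s m * w s h" p] m p by (simp add: mult.assoc)
    finally show "\<tau> (p * A s m * w s h) + of_real (h / 2) * \<tau> (p * A s m)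
        + (\<tau> (A s m * p * adj (w s h)) + of_real (h / 2) * \<tau> (A s m * p))
        + (\<tau> (A s m * w s h * p * adj (w s h)) - \<i> * (-\<i>) * of_real h * (\<tau> (A s m) * \<tau> p))
      = \<tau> (A s m * Z s h) - of_real h * linear_rate s m"
      unfolding tr_pA[OF s] linear_rate_def by (simp add: G_def \<gamma>_def algebra_simps)
  qed
qed

text \<open>Only the linear part \<open>w p + p w\<^sup>*\<close> of each \<open>Z\<close> matters, as the others produce three factors; the four
  remaining products are evaluated by \<open>quadratic_joint_alg\<close>, with sign \<open>- 1\<close> for \<open>w w\<close> and \<open>w\<^sup>* w\<^sup>*\<close> and sign
  \<open>+ 1\<close> for the mixed ones.\<close>

lemma second_order:
  assumes s: "0 \<le> s"
  shows "negligible (\<lambda>h. \<tau> (A s m * Z s h * A s i * Z s h)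
     - of_real h * pair_rate s m i)"
proof -
  let ?w = "w s" and ?v = "\<lambda>h. adj (w s h)" and ?A = "A s m" and ?B = "A s i"
  note alA = A_algs[OF s, of m] and alB = A_algs[OF s, of i]
  note w = drift_w[OF s] leading_dx_w[OF s] and v = drift_adj_w[OF s] leading_dx_adj_w[OF s]
  have 1: "negligible (\<lambda>h. \<tau> (p * ?A * ?w h * (p * ?B) * ?w h) - \<i> * \<i> * of_real h * (\<tau> (p * ?A) * \<tau> (p * ?B)))"
    by (rule quadratic_joint_alg[OF s w w alA(3) alB(3)])
  have 2: "negligible (\<lambda>h. \<tau> (?A * ?w h * (p * ?B * p) * ?v h) - \<i> * (-\<i>) * of_real h * (\<tau> ?A * \<tau> (p * ?B * p)))"
    by (rule quadratic_joint_alg[OF s w v alA(1) alB(4)])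
  have 3: "negligible (\<lambda>h. \<tau> (p * ?A * p * ?v h * ?B * ?w h) - (-\<i>) * \<i> * of_real h * (\<tau> (p * ?A * p) * \<tau> ?B))"
    by (rule quadratic_joint_alg[OF s v w alA(4) alB(1)])
  have 4: "negligible (\<lambda>h. \<tau> (?A * p * ?v h * (?B * p) * ?v h) - (-\<i>) * (-\<i>) * of_real h * (\<tau> (?A * p) * \<tau> (?B * p)))"
    by (rule quadratic_joint_alg[OF s v v alA(2) alB(2)])
  have "op_bounded (X s ^ k)" for k using op_bound_power[OF op_bound_X[OF s]] by (auto simp: op_bounded_def)
  then have "op_bounded (A s k)" for k unfolding A_def by (intro op_bounded_mult op_bounded_adj op_bounded_u op_bounded_q s)
  then have bA: "op_bounded ?A" "op_bounded ?B" by blast+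
  have bf: "bounded_family (\<lambda>_. ?A)" "bounded_family (\<lambda>_. ?B)" "bounded_family (\<lambda>_. p)" using bA op_bounded_p by (auto intro: bounded_family_const)
  note si = small_family_left small_family_right small_family_adj small_family_w small_family_Z bf s small_family_add
  define V where "V h = ?w h * p + p * ?v h" for h
  define T where "T h = ?w h * p * ?v h" for h
  have ZVT: "Z s h = V h + T h" for h by (simp add: Z_def V_def T_def)
  have sV: "small_family V" unfolding V_def[abs_def] by (intro si)
  have 5: "negligible (\<lambda>h. \<tau> ((?A * ?w h) * (p * ?v h) * (?B * Z s h)))" by (intro small_family_triple_negligible si)
  have 6: "negligible (\<lambda>h. \<tau> ((?A * V h) * (?B * (?w h)) * (p * ?v h)))" by (intro small_family_triple_negligible si sV)
  note all = negligible_add[OF negligible_add[OF negligible_add[OF 1 2] negligible_add[OF 3 4]] negligible_add[OF 5 6]]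
  show ?thesis
  proof (rule negligible_cong_pos[OF all])
    fix h :: real assume h: "h > 0"
    have m: "?A \<in> M" "?B \<in> M" "?w h \<in> M" "?v h \<in> M" "V h \<in> M" "T h \<in> M" "p \<in> M"
      using A_M[OF s] w_M[OF s h] p by (auto simp: V_def T_def)
    have a: "\<tau> (?A * Z s h * ?B * Z s h) = \<tau> (?A * V h * ?B * V h) + \<tau> (?A * T h * ?B * Z s h) + \<tau> (?A * V h * ?B * T h)"
      using m unfolding ZVT by (simp add: distrib_left distrib_right tr_add mult.assoc)
    have b: "\<tau> (?A * V h * ?B * V h) = \<tau> (?A * ?w h * p * ?B * ?w h * p) + \<tau> (?A * ?w h * (p * ?B * p) * ?v h)
      + (\<tau> (?A * p * ?v h * ?B * ?w h * p) + \<tau> (?A * p * ?v h * (?B * p) * ?v h))"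
      unfolding V_def using m by (simp add: distrib_left distrib_right tr_add mult.assoc)
    have c: "\<tau> (?A * ?w h * p * ?B * ?w h * p) = \<tau> (p * ?A * ?w h * (p * ?B) * ?w h)"
      using m tr_comm[of "?A * ?w h * p * ?B * ?w h" p] by (simp add: mult.assoc)
    have d: "\<tau> (?A * p * ?v h * ?B * ?w h * p) = \<tau> (p * ?A * p * ?v h * ?B * ?w h)"
      using m tr_comm[of "?A * p * ?v h * ?B * ?w h" p] by (simp add: mult.assoc)
    have e: "\<tau> (?A * T h * ?B * Z s h) = \<tau> ((?A * ?w h) * (p * ?v h) * (?B * Z s h))"
      "\<tau> (?A * V h * ?B * T h) = \<tau> ((?A * V h) * (?B * (?w h)) * (p * ?v h))"
      by (simp_all add: T_def mult.assoc)
    show "\<tau> (p * ?A * ?w h * (p * ?B) * ?w h) - \<i> * \<i> * of_real h * (\<tau> (p * ?A) * \<tau> (p * ?B))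
      + (\<tau> (?A * ?w h * (p * ?B * p) * ?v h) - \<i> * (-\<i>) * of_real h * (\<tau> ?A * \<tau> (p * ?B * p)))
      + (\<tau> (p * ?A * p * ?v h * ?B * ?w h) - (-\<i>) * \<i> * of_real h * (\<tau> (p * ?A * p) * \<tau> ?B)
      + (\<tau> (?A * p * ?v h * (?B * p) * ?v h) - (-\<i>) * (-\<i>) * of_real h * (\<tau> (?A * p) * \<tau> (?B * p))))
      + (\<tau> ((?A * ?w h) * (p * ?v h) * (?B * Z s h)) + \<tau> ((?A * V h) * (?B * (?w h)) * (p * ?v h)))
      = \<tau> (?A * Z s h * ?B * Z s h) - of_real h * pair_rate s m i"
      unfolding a b c d e tr_pA[OF s] pair_rate_def by (simp add: G_def \<gamma>_def algebra_simps)
  qed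
qed

lemma moment_increment:
  assumes s: "0 \<le> s"
  shows "negligible (\<lambda>h. \<tau> (X (s + h) ^ n) - \<tau> (X s ^ n) - of_real h *
    ((\<Sum>j<n. linear_rate s (n - 1)) +
     (\<Sum>j<n. \<Sum>i<n - 1 - j. pair_rate s (n - 2 - i) i)))"
proof -
  let ?X = "X s" and ?Y = "\<lambda>h. X (s + h)"
  have XM: "?X \<in> M" using s by (rule X_M)
  have bX: "bounded_family (\<lambda>_. ?X ^ k)" for k
    using op_bound_power[OF op_bound_X[OF s]] by (auto simp: bounded_family_def)
  have bY: "bounded_family (\<lambda>h. ?Y h ^ k)" for k
    unfolding bounded_family_def using op_bound_power[OF op_bound_X] s by (intro exI[of _ 1]) auto
  have EM: "E s h \<in> M" if "h > 0" for h using small_family_mem[OF small_family_E[OF s] that] .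
  have YM: "?Y h \<in> M" if "h > 0" for h using X_M[of "s + h"] s that by auto
  have 1: "negligible (\<lambda>h. \<Sum>j<n. \<tau> (A s (n - 1) * Z s h) - of_real h * linear_rate s (n - 1))"
    by (intro negligible_sum first_order s)
  have 2: "negligible (\<lambda>h. \<Sum>j<n. \<Sum>i<n - 1 - j. \<tau> (A s (n - 2 - i) * Z s h * A s i * Z s h)
     - of_real h * pair_rate s (n - 2 - i) i)"
    by (intro negligible_sum second_order s)
  have 3: "negligible (\<lambda>h. \<Sum>j<n. \<Sum>i<n - 1 - j. \<Sum>l<n - 1 - j - 1 - i.
      \<tau> ((?X ^ j * E s h) * (?X ^ i * E s h) * ((?X ^ l * E s h) * ?Y h ^ (n - 1 - j - 1 - i - 1 - l))))"
    by (intro negligible_sum small_family_triple_negligible small_family_left small_family_right small_family_E s bX bY)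
  show ?thesis
  proof (rule negligible_cong_pos[OF negligible_add[OF negligible_add[OF 1 2] 3]])
    fix h :: real assume h: "h > 0"
    note m = XM EM[OF h] YM[OF h]
    have usM: "u s \<in> M" and ZM: "Z s h \<in> M" using u_M[OF s] small_family_mem[OF small_family_Z[OF s] h] .
    have t1: "\<tau> (?X ^ j * E s h * ?X ^ (n - 1 - j)) = \<tau> (A s (n - 1) * Z s h)" if "j < n" for j
    proof -
      have "\<tau> (?X ^ j * E s h * ?X ^ (n - 1 - j)) = \<tau> (?X ^ (n - 1 - j + j) * E s h)"
        using m tr_comm[of "?X ^ j * E s h" "?X ^ (n - 1 - j)"] by (simp add: mult.assoc power_add)
      also have "n - 1 - j + j = n - 1" using that by simp
      also have "\<tau> (?X ^ (n - 1) * E s h) = \<tau> (A s (n - 1) * Z s h)"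
        using m usM ZM q tr_comm[of "?X ^ (n - 1) * (q * u s * Z s h)" "adj (u s)"]
        by (simp add: E_eq[OF s h] A_def mult.assoc)
      finally show ?thesis .
    qed
    have t2: "\<tau> (?X ^ j * E s h * ?X ^ i * E s h * ?X ^ (n - 1 - j - 1 - i)) = \<tau> (A s (n - 2 - i) * Z s h * A s i * Z s h)"
      if "i < n - 1 - j" for i j
    proof -
      have "\<tau> (?X ^ j * E s h * ?X ^ i * E s h * ?X ^ (n - 1 - j - 1 - i)) = \<tau> (?X ^ (n - 1 - j - 1 - i + j) * E s h * ?X ^ i * E s h)"
        using m tr_comm[of "?X ^ j * E s h * ?X ^ i * E s h" "?X ^ (n - 1 - j - 1 - i)"] by (simp add: mult.assoc power_add)
      also have "n - 1 - j - 1 - i + j = n - 2 - i" using that by simp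
      also have "\<tau> (?X ^ (n - 2 - i) * E s h * ?X ^ i * E s h) = \<tau> (A s (n - 2 - i) * Z s h * A s i * Z s h)"
        using m usM ZM q tr_comm[of "?X ^ (n - 2 - i) * (q * u s * Z s h) * adj (u s) * ?X ^ i * (q * u s * Z s h)" "adj (u s)"]
        by (simp add: E_eq[OF s h] A_def mult.assoc)
      finally show ?thesis .
    qed
    have YX: "?Y h - ?X = E s h" by (simp add: E_def)
    have "\<tau> (?Y h ^ n) = \<tau> (?X ^ n) + (\<Sum>j<n. \<tau> (?X ^ j * E s h * ?X ^ (n - 1 - j)))
     + (\<Sum>j<n. \<Sum>i<n - 1 - j. \<tau> (?X ^ j * E s h * ?X ^ i * E s h * ?X ^ (n - 1 - j - 1 - i)))
     + (\<Sum>j<n. \<Sum>i<n - 1 - j. \<Sum>l<n - 1 - j - 1 - i. \<tau> (?X ^ j * E s h * ?X ^ i * E s h * ?X ^ l * E s h * ?Y h ^ (n - 1 - j - 1 - i - 1 - l)))"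
      using m by (subst power_expand3[of _ n ?X]) (simp add: YX tr_add tr_sum sum_mem)
    also have "\<dots> = \<tau> (?X ^ n) + (\<Sum>j<n. \<tau> (A s (n - 1) * Z s h))
     + (\<Sum>j<n. \<Sum>i<n - 1 - j. \<tau> (A s (n - 2 - i) * Z s h * A s i * Z s h))
     + (\<Sum>j<n. \<Sum>i<n - 1 - j. \<Sum>l<n - 1 - j - 1 - i. \<tau> ((?X ^ j * E s h) * (?X ^ i * E s h) * ((?X ^ l * E s h) * ?Y h ^ (n - 1 - j - 1 - i - 1 - l))))"
      by (intro arg_cong2[where f = "(+)"] sum.cong refl t1 t2) (auto simp: mult.assoc)
    finally show "(\<Sum>j<n. \<tau> (A s (n - 1) * Z s h) - of_real h * linear_rate s (n - 1))
     + (\<Sum>j<n. \<Sum>i<n - 1 - j. \<tau> (A s (n - 2 - i) * Z s h * A s i * Z s h)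
     - of_real h * pair_rate s (n - 2 - i) i)
     + (\<Sum>j<n. \<Sum>i<n - 1 - j. \<Sum>l<n - 1 - j - 1 - i.
      \<tau> ((?X ^ j * E s h) * (?X ^ i * E s h) * ((?X ^ l * E s h) * ?Y h ^ (n - 1 - j - 1 - i - 1 - l))))
     = \<tau> (?Y h ^ n) - \<tau> (?X ^ n) - of_real h *
    ((\<Sum>j<n. linear_rate s (n - 1)) +
     (\<Sum>j<n. \<Sum>i<n - 1 - j. pair_rate s (n - 2 - i) i))"
      unfolding distrib_left sum_distrib_left sum_subtractf by (simp only: algebra_simps)
  qed
qed

lemma \<gamma>_eq: assumes s: "0 \<le> s" shows "\<gamma> s m = \<tau> (X s ^ Suc m)"
proof -
  have m: "u s \<in> M" "X s \<in> M" using u_M[OF s] X_M[OF s] .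
  have "\<gamma> s m = \<tau> (adj (u s) * (X s ^ m * q * u s * p))" by (simp add: \<gamma>_def A_def mult.assoc)
  also have "\<dots> = \<tau> (X s ^ m * q * u s * p * adj (u s))" using m p q by (intro tr_comm) auto
  also have "X s ^ m * q * u s * p * adj (u s) = X s ^ Suc m"
    by (subst power_Suc2) (simp add: X_def pt_def mult.assoc)
  finally show ?thesis .
qed

lemma G_0: assumes s: "0 \<le> s" shows "G s 0 = \<tau> q"
proof -
  have "G s 0 = \<tau> (adj (u s) * (q * u s))" by (simp add: G_def A_def mult.assoc)
  also have "\<dots> = \<tau> (q * u s * adj (u s))" using u_M[OF s] q by (intro tr_comm) auto
  finally show ?thesis by (simp add: mult.assoc u_adj[OF s])
qed

lemma G_Suc: assumes s: "0 \<le> s" shows "G s (Suc m) = \<tau> (X s ^ Suc m)"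
proof -
  have m: "u s \<in> M" "X s \<in> M" using u_M[OF s] X_M[OF s] .
  have "G s (Suc m) = \<tau> (adj (u s) * (X s ^ Suc m * q * u s))" by (simp add: G_def A_def mult.assoc)
  also have "\<dots> = \<tau> (X s ^ Suc m * q * u s * adj (u s))" using m q by (intro tr_comm) auto
  also have "\<dots> = \<tau> (X s ^ Suc m * q)" by (simp add: mult.assoc u_adj[OF s])
  also have "\<dots> = \<tau> (q * X s ^ Suc m)" using m q by (intro tr_comm) auto
  also have "q * X s ^ Suc m = X s ^ Suc m" by (simp add: X_def mult.assoc[symmetric] q)
  finally show ?thesis .
qed

lemma X_L2_lipschitz:
  assumes "0 \<le> s" "0 \<le> t" shows "n2 (X t - X s) \<le> 2 * n2 (u t - u s)"
proof -
  have m: "u s \<in> M" "u t \<in> M" using u_M assms by auto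
  have eq: "X t - X s = q * ((u t - u s) * (p * adj (u t))) + q * (u s * p * adj (u t - u s))"
    using m by (simp add: X_def pt_def left_diff_distrib right_diff_distrib mult.assoc)
  have o1: "op_bound 1 (p * adj (u t))" using op_bound_mult[OF op_bound_p op_bound_adj[OF u_op_bound[OF assms(2)]]] by simp
  have o2: "op_bound 1 (u s * p)" using op_bound_mult[OF u_op_bound[OF assms(1)] op_bound_p] by simp
  have "n2 (q * ((u t - u s) * (p * adj (u t)))) \<le> n2 ((u t - u s) * (p * adj (u t)))"
    using op_boundD[OF op_bound_q, of "(u t - u s) * (p * adj (u t))"] m p by auto
  also have "\<dots> \<le> n2 (u t - u s)" using op_bound_right[OF o1, of "u t - u s"] m by auto
  finally have 1: "n2 (q * ((u t - u s) * (p * adj (u t)))) \<le> n2 (u t - u s)" .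
  have "n2 (q * (u s * p * adj (u t - u s))) \<le> n2 (u s * p * adj (u t - u s))"
    using op_boundD[OF op_bound_q, of "u s * p * adj (u t - u s)"] m p by auto
  also have "\<dots> \<le> n2 (adj (u t - u s))" using op_boundD[OF o2, of "adj (u t - u s)"] m by auto
  also have "\<dots> = n2 (u t - u s)" using m by (intro n2_adj) auto
  finally have 2: "n2 (q * (u s * p * adj (u t - u s))) \<le> n2 (u t - u s)" .
  have "n2 (X t - X s) \<le> n2 (q * ((u t - u s) * (p * adj (u t)))) + n2 (q * (u s * p * adj (u t - u s)))"
    unfolding eq using m p q by (intro n2_triangle) auto
  then show ?thesis using 1 2 by linarith
qed

text \<open>Operators bounded by one may be stripped from a telescoping sum, so the \<open>L\<^sup>2\<close>-continuity of \<open>u\<close> passes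
  to every moment.\<close>

lemma moment_lipschitz:
  assumes "0 \<le> s" "0 \<le> t" shows "cmod (\<tau> (X t ^ n) - \<tau> (X s ^ n)) \<le> real n * (2 * n2 (u t - u s))"
proof -
  have m: "X s \<in> M" "X t \<in> M" using X_M assms by auto
  have "n2 (X s ^ j * (X t - X s) * X t ^ (n - 1 - j)) \<le> 2 * n2 (u t - u s)" for j
  proof -
    have "n2 (X s ^ j * (X t - X s) * X t ^ (n - 1 - j)) \<le> n2 (X s ^ j * (X t - X s))"
      using op_bound_right[OF op_bound_power[OF op_bound_X[OF assms(2)]], of "X s ^ j * (X t - X s)" "n - 1 - j"] m by auto
    also have "\<dots> \<le> n2 (X t - X s)"
      using op_boundD[OF op_bound_power[OF op_bound_X[OF assms(1)]], of "X t - X s" j] m by auto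
    finally show ?thesis using X_L2_lipschitz[OF assms] by linarith
  qed
  note le = this
  have eq: "\<tau> (X t ^ n) - \<tau> (X s ^ n) = \<tau> (\<Sum>j<n. X s ^ j * (X t - X s) * X t ^ (n - 1 - j))"
  proof -
    have "\<tau> (X t ^ n) = \<tau> (X s ^ n + (\<Sum>j<n. X s ^ j * (X t - X s) * X t ^ (n - 1 - j)))"
      by (rule arg_cong[OF power_expand])
    also have "\<dots> = \<tau> (X s ^ n) + \<tau> (\<Sum>j<n. X s ^ j * (X t - X s) * X t ^ (n - 1 - j))"
      using m by (intro tr_add sum_mem) auto
    finally show ?thesis by simp
  qed
  have "cmod (\<tau> (X t ^ n) - \<tau> (X s ^ n)) \<le> n2 (\<Sum>j<n. X s ^ j * (X t - X s) * X t ^ (n - 1 - j))"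
    unfolding eq using m by (intro tr_le_n2 sum_mem) auto
  also have "\<dots> \<le> (\<Sum>j<n. 2 * n2 (u t - u s))"
  proof (rule order_trans[OF n2_sum])
    show "(\<Sum>j<n. n2 (X s ^ j * (X t - X s) * X t ^ (n - 1 - j))) \<le> (\<Sum>j<n. 2 * n2 (u t - u s))"
      by (rule sum_mono) (rule le)
  qed (simp add: m)
  finally show ?thesis by simp
qed

lemma moment_continuous: "continuous_on {0..} (\<lambda>t. \<tau> (X t ^ n))"
  unfolding continuous_on_def
proof
  fix s :: real assume s: "s \<in> {0..}"
  have "((\<lambda>t. \<tau> (X t ^ n) - \<tau> (X s ^ n)) \<longlongrightarrow> 0) (at s within {0..})"
  proof (rule tendsto_0_le)
    show "((\<lambda>t. real n * (2 * n2 (u t - u s))) \<longlongrightarrow> 0) (at s within {0..})"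
      using u_cont[of s] s by (auto intro!: tendsto_eq_intros)
    show "\<forall>\<^sub>F t in at s within {0..}. norm (\<tau> (X t ^ n) - \<tau> (X s ^ n)) \<le> norm (real n * (2 * n2 (u t - u s))) * 1"
      unfolding eventually_at_filter
      using moment_lipschitz[of s _ n] s u_M by (auto intro!: always_eventually)
  qed
  then show "((\<lambda>t. \<tau> (X t ^ n)) \<longlongrightarrow> \<tau> (X s ^ n)) (at s within {0..})" by (simp add: Lim_null[symmetric])
qed

end

section \<open>From right derivatives to derivatives\<close>

text \<open>For each \<open>\<epsilon>\<close> the largest point up to which \<open>|\<Phi>(r)| \<le> \<epsilon> r\<close> can hold is the right end point, since the
  vanishing right derivative extends the inequality past any smaller one.\<close>

lemma right_derivative_zero:
  fixes \<Phi> :: "real \<Rightarrow> complex"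
  assumes cont: "continuous_on {0..T} \<Phi>" and z: "\<Phi> 0 = 0"
    and der: "\<And>s. 0 \<le> s \<Longrightarrow> s < T \<Longrightarrow> negligible (\<lambda>h. \<Phi> (s + h) - \<Phi> s)"
    and s: "0 \<le> s" "s \<le> T"
  shows "\<Phi> s = 0"
proof -
  have le: "cmod (\<Phi> s) \<le> \<epsilon> * s" if \<epsilon>: "\<epsilon> > 0" for \<epsilon> :: real
  proof (rule ccontr)
    assume bad: "\<not> cmod (\<Phi> s) \<le> \<epsilon> * s"
    define B where "B = {r \<in> {0..s}. cmod (\<Phi> r) \<le> \<epsilon> * r}"
    have "continuous_on {0..s} \<Phi>" by (rule continuous_on_subset[OF cont]) (use s in auto)
    then have "closed B" unfolding B_def
      by (intro continuous_on_closed_Collect_le continuous_intros) auto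
    have ne: "0 \<in> B" using s z by (simp add: B_def)
    have bdd: "bdd_above B" unfolding B_def by (intro bdd_aboveI[of _ s]) auto
    define \<sigma> where "\<sigma> = Sup B"
    have \<sigma>B: "\<sigma> \<in> B" unfolding \<sigma>_def using closed_contains_Sup[OF _ bdd \<open>closed B\<close>] ne by blast
    then have \<sigma>: "0 \<le> \<sigma>" "\<sigma> \<le> s" "cmod (\<Phi> \<sigma>) \<le> \<epsilon> * \<sigma>" by (auto simp: B_def)
    have "\<sigma> < s" using \<sigma> bad by (cases "\<sigma> = s") auto
    then have "negligible (\<lambda>h. \<Phi> (\<sigma> + h) - \<Phi> \<sigma>)" using der[of \<sigma>] \<sigma> s by auto
    then have "\<forall>\<^sub>F h in at_right 0. cmod (\<Phi> (\<sigma> + h) - \<Phi> \<sigma>) \<le> \<epsilon> * h" using \<epsilon> by (auto simp: negligible_def)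
    then obtain b where b: "b > 0" "\<And>h. 0 < h \<Longrightarrow> h < b \<Longrightarrow> cmod (\<Phi> (\<sigma> + h) - \<Phi> \<sigma>) \<le> \<epsilon> * h"
      unfolding eventually_at_right_field by blast
    define h where "h = min (b / 2) (s - \<sigma>)"
    have h: "0 < h" "h < b" "\<sigma> + h \<le> s" using b \<open>\<sigma> < s\<close> by (auto simp: h_def)
    have "cmod (\<Phi> (\<sigma> + h)) \<le> cmod (\<Phi> \<sigma>) + cmod (\<Phi> (\<sigma> + h) - \<Phi> \<sigma>)"
      using norm_triangle_ineq[of "\<Phi> \<sigma>" "\<Phi> (\<sigma> + h) - \<Phi> \<sigma>"] by simp
    also have "\<dots> \<le> \<epsilon> * \<sigma> + \<epsilon> * h" using \<sigma>(3) b(2)[OF h(1,2)] by (rule add_mono)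
    finally have "\<sigma> + h \<in> B" using h \<sigma> by (simp add: B_def distrib_left)
    then have "\<sigma> + h \<le> \<sigma>" unfolding \<sigma>_def using bdd by (rule cSup_upper)
    then show False using h by simp
  qed
  have "cmod (\<Phi> s) \<le> 0"
  proof (rule field_le_epsilon)
    fix e :: real assume e: "e > 0"
    have "cmod (\<Phi> s) \<le> e / (s + 1) * s" using le[of "e / (s + 1)"] e s by simp
    also have "\<dots> \<le> e" using e s by (simp add: field_simps)
    finally show "cmod (\<Phi> s) \<le> 0 + e" by simp
  qed
  then show ?thesis by simp
qed

lemma has_vector_derivative_imp_negligible:
  fixes f :: "real \<Rightarrow> complex"
  assumes d: "(f has_vector_derivative D) (at s within {0..T})" and s: "0 \<le> s" "s < T"
  shows "negligible (\<lambda>h. f (s + h) - f s - of_real h * D)"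
  unfolding negligible_def
proof (intro allI impI)
  fix \<eta> :: real assume \<eta>: "\<eta> > 0"
  from d \<eta> obtain d where d: "d > 0" "\<And>y. y \<in> {0..T} \<Longrightarrow> norm (y - s) < d \<Longrightarrow>
      norm (f y - f s - (y - s) *\<^sub>R D) \<le> \<eta> * norm (y - s)"
    unfolding has_vector_derivative_def has_derivative_within_alt by blast
  show "\<forall>\<^sub>F h in at_right 0. cmod (f (s + h) - f s - of_real h * D) \<le> \<eta> * h"
    unfolding eventually_at_right_field
  proof (intro exI[of _ "min d (T - s)"] conjI allI impI)
    show "min d (T - s) > 0" using d s by simp
    fix h :: real assume "0 < h" "h < min d (T - s)"
    then show "cmod (f (s + h) - f s - of_real h * D) \<le> \<eta> * h"
      using d(2)[of "s + h"] s by (simp add: scaleR_conv_of_real)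
  qed
qed

text \<open>The difference between \<open>f\<close> and the integral of its continuous right derivative has vanishing right
  derivative.\<close>

lemma derivative_from_right:
  fixes f g :: "real \<Rightarrow> complex"
  assumes f: "continuous_on {0..} f" and g: "continuous_on {0..} g"
    and der: "\<And>s. 0 \<le> s \<Longrightarrow> negligible (\<lambda>h. f (s + h) - f s - of_real h * g s)" and t: "0 < t"
  shows "(f has_vector_derivative g t) (at t)"
proof -
  define T where "T = t + 1"
  have gT: "continuous_on {0..T} g" by (rule continuous_on_subset[OF g]) auto
  have fT: "continuous_on {0..T} f" by (rule continuous_on_subset[OF f]) auto
  define J where "J s = integral {0..s} g" for s
  have J: "(J has_vector_derivative g s) (at s within {0..T})" if "s \<in> {0..T}" for s
    unfolding J_def using integral_has_vector_derivative[OF gT that] .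
  define \<Phi> where "\<Phi> s = f s - f 0 - J s" for s
  have zero: "\<Phi> s = 0" if "0 \<le> s" "s \<le> T" for s
  proof (rule right_derivative_zero[where T = T])
    show "continuous_on {0..T} \<Phi>"
    proof -
      have "continuous_on {0..T} J"
        unfolding continuous_on_eq_continuous_within by (intro ballI has_vector_derivative_continuous[OF J])
      then show ?thesis unfolding \<Phi>_def using fT by (intro continuous_intros)
    qed
    show "\<Phi> 0 = 0" by (simp add: \<Phi>_def J_def)
    show "negligible (\<lambda>h. \<Phi> (r + h) - \<Phi> r)" if r: "0 \<le> r" "r < T" for r
    proof -
      have "negligible (\<lambda>h. J (r + h) - J r - of_real h * g r)"
        by (rule has_vector_derivative_imp_negligible[OF J r]) (use r in auto)
      from negligible_diff[OF der[OF r(1)] this] show ?thesis by (simp add: \<Phi>_def algebra_simps)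
    qed
  qed (use that in auto)
  have "(J has_vector_derivative g t) (at t within {0..T})" using J[of t] t by (simp add: T_def)
  then have "(J has_vector_derivative g t) (at t)" 
    using t at_within_interior[of t "{0..T}"] by (simp add: T_def)
  then have "((\<lambda>s. f 0 + J s) has_vector_derivative g t) (at t)" by (auto intro!: derivative_eq_intros)
  then show ?thesis
  proof (rule has_vector_derivative_transform_within_open)
    show "open {0<..<T}" "t \<in> {0<..<T}" using t by (auto simp: T_def)
    show "f 0 + J s = f s" if "s \<in> {0<..<T}" for s using zero[of s] that by (simp add: \<Phi>_def algebra_simps)
  qed
qed

context free_liberation begin

lemma rate_continuous:
  "continuous_on {0..} (\<lambda>t. G t m)" "continuous_on {0..} (\<lambda>t. \<gamma> t m)"
proof -
  show "continuous_on {0..} (\<lambda>t. G t m)"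
  proof (cases m)
    case 0
    then show ?thesis using continuous_on_cong[of "{0..}" "{0..}" "\<lambda>t. G t m" "\<lambda>_. \<tau> q"] by (simp add: G_0)
  next
    case (Suc k)
    then show ?thesis
      using moment_continuous[of "Suc k"] continuous_on_cong[of "{0..}" "{0..}" "\<lambda>t. G t m" "\<lambda>t. \<tau> (X t ^ Suc k)"]
      by (simp add: G_Suc)
  qed
  show "continuous_on {0..} (\<lambda>t. \<gamma> t m)"
    using moment_continuous[of "Suc m"] continuous_on_cong[of "{0..}" "{0..}" "\<lambda>t. \<gamma> t m" "\<lambda>t. \<tau> (X t ^ Suc m)"]
    by (simp add: \<gamma>_eq)
qed

lemma moment_ode:
  assumes t: "0 < t"
  shows "((\<lambda>t. \<tau> (X t ^ n)) has_vector_derivative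
    (\<Sum>j<n. linear_rate t (n - 1)) + (\<Sum>j<n. \<Sum>i<n - 1 - j. pair_rate t (n - 2 - i) i)) (at t)"
proof (rule derivative_from_right[OF moment_continuous _ moment_increment t])
  show "continuous_on {0..} (\<lambda>t. (\<Sum>j<n. linear_rate t (n - 1)) + (\<Sum>j<n. \<Sum>i<n - 1 - j. pair_rate t (n - 2 - i) i))"
    unfolding linear_rate_def pair_rate_def by (intro continuous_intros rate_continuous)
qed

section \<open>Support of the spectral measure\<close>

definition Q :: "real \<Rightarrow> 'h bop" where "Q t = q * pt t * q"

lemma Q_M: "0 \<le> t \<Longrightarrow> Q t \<in> M" unfolding Q_def using pt_M[of t] q by auto

lemma pt_proj: assumes "0 \<le> t" shows "pt t * pt t = pt t" "adj (pt t) = pt t"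
proof -
  have m: "u t \<in> M" using u_M[OF assms] .
  have "pt t * pt t = u t * p * (adj (u t) * u t) * p * adj (u t)" by (simp add: pt_def mult.assoc)
  also have "\<dots> = u t * (p * p) * adj (u t)" by (simp add: u_adj[OF assms] mult.assoc)
  finally show "pt t * pt t = pt t" by (simp add: p pt_def)
  show "adj (pt t) = pt t" using m p by (simp add: pt_def mult.assoc)
qed

lemma moment_Q: assumes t: "0 \<le> t" shows "\<tau> (Q t ^ Suc n) = \<tau> (X t ^ Suc n)"
proof -
  have "Q t ^ Suc n = X t ^ Suc n * q"
  proof (induction n)
    case 0 show ?case by (simp add: Q_def X_def)
  next
    case (Suc n)
    have "Q t ^ Suc (Suc n) = Q t * (X t ^ Suc n * q)" by (subst power_Suc) (simp only: Suc)
    also have "\<dots> = q * pt t * (q * X t ^ Suc n) * q" by (simp add: Q_def mult.assoc)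
    also have "q * X t ^ Suc n = X t ^ Suc n" by (simp add: X_def mult.assoc[symmetric] q)
    finally show ?case by (simp add: X_def mult.assoc)
  qed
  then have "\<tau> (Q t ^ Suc n) = \<tau> (X t ^ Suc n * q)" by simp
  also have "\<dots> = \<tau> (q * X t ^ Suc n)" using X_M[OF t] q by (intro tr_comm) auto
  also have "q * X t ^ Suc n = X t ^ Suc n" by (simp add: X_def mult.assoc[symmetric] q)
  finally show ?thesis .
qed

lemma op_bound_Q: "0 \<le> t \<Longrightarrow> op_bound 1 (Q t)"
  using op_bound_mult[OF op_bound_mult[OF op_bound_q op_bound_pt[of t]] op_bound_q] by (simp add: Q_def)

text \<open>Algebraic reason: \<open>(1 - Q)\<^sup>2 = 1 - v\<^sup>* v - z\<^sup>* z\<close> with \<open>v = p\<^sub>t q\<close> and \<open>z = (1 - q) p\<^sub>t q\<close>.\<close>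

lemma op_bound_one_minus_Q: assumes t: "0 \<le> t" shows "op_bound 1 (1 - Q t)"
proof -
  define v where "v = pt t * q"
  define z where "z = (1 - q) * pt t * q"
  note pp = pt_proj[OF t]
  have m: "pt t \<in> M" "v \<in> M" "z \<in> M" "Q t \<in> M" using pt_M[OF t] q Q_M[OF t] by (auto simp: v_def z_def)
  have Qadj: "adj (Q t) = Q t" using m q pp by (simp add: Q_def mult.assoc)
  have pp2: "pt t * (pt t * a) = pt t * a" for a by (simp add: mult.assoc[symmetric] pp)
  have q2: "q * (q * a) = q * a" for a by (simp add: mult.assoc[symmetric] q)
  have v: "adj v * v = Q t" using m q pp by (simp add: v_def Q_def mult.assoc pp2)
  have z: "adj z * z = Q t - Q t * Q t" using m q pp
    by (simp add: z_def Q_def mult.assoc left_diff_distrib right_diff_distrib pp2 q2)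
  have "n2 ((1 - Q t) * y) \<le> 1 * n2 y" if y: "y \<in> M" for y
  proof -
    have "adj ((1 - Q t) * y) * ((1 - Q t) * y) = adj y * y - adj (v * y) * (v * y) - adj (z * y) * (z * y)"
    proof -
      have "adj ((1 - Q t) * y) * ((1 - Q t) * y) = adj y * (1 - Q t - (Q t - Q t * Q t)) * y"
        using m y Qadj by (simp add: mult.assoc left_diff_distrib right_diff_distrib)
      also have "\<dots> = adj y * (1 - adj v * v - adj z * z) * y" by (simp add: v z)
      also have "\<dots> = adj y * y - adj (v * y) * (v * y) - adj (z * y) * (z * y)"
        using m y by (simp add: mult.assoc left_diff_distrib right_diff_distrib)
      finally show ?thesis .
    qed
    then have "\<tau> (adj ((1 - Q t) * y) * ((1 - Q t) * y)) = \<tau> (adj y * y) - \<tau> (adj (v * y) * (v * y)) - \<tau> (adj (z * y) * (z * y))"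
      using m y by (simp only: tr_diff mult_mem adj_mem diff_mem)
    then have "of_real ((n2 ((1 - Q t) * y))\<^sup>2) = (of_real ((n2 y)\<^sup>2 - (n2 (v * y))\<^sup>2 - (n2 (z * y))\<^sup>2) :: complex)"
      using m y by (simp only: n2_sq mult_mem diff_mem one_mem of_real_diff)
    then have "(n2 ((1 - Q t) * y))\<^sup>2 = (n2 y)\<^sup>2 - (n2 (v * y))\<^sup>2 - (n2 (z * y))\<^sup>2" unfolding of_real_eq_iff .
    then have "(n2 ((1 - Q t) * y))\<^sup>2 \<le> (n2 y)\<^sup>2"
      using zero_le_power2[of "n2 (v * y)"] zero_le_power2[of "n2 (z * y)"] by linarith
    from power2_le_imp_le[OF this n2_nonneg[OF y]] show ?thesis by simp
  qed
  then show ?thesis using m by (simp add: op_bound_def)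
qed

text \<open>All even moments of \<open>x\<close> and of \<open>1 - x\<close> are at most one, because \<open>Q\<close> and \<open>1 - Q\<close> are contractions. By
  Markov's inequality \<open>|x| \<le> 1\<close> and \<open>|1 - x| \<le> 1\<close> almost everywhere, and together these say
  \<open>x \<in> [0, 1]\<close>.\<close>

lemma spectral_support:
  assumes t: "0 \<le> t" and sp: "spectral_measure \<tau> (Q t) \<nu>"
  shows "AE x in \<nu>. x \<in> {0..1}"
proof -
  interpret real_distribution \<nu> using sp by (simp add: spectral_measure_def)
  have mom: "integrable \<nu> (\<lambda>x. x ^ n)" "\<tau> (Q t ^ n) = of_real (\<integral>x. x ^ n \<partial>\<nu>)" for n
    using sp unfolding spectral_measure_def by blast+
  have QM: "Q t \<in> M" by (rule Q_M[OF t])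
  have mixed: "integrable \<nu> (\<lambda>x. x ^ n * (1 - x) ^ m) \<and> \<tau> (Q t ^ n * (1 - Q t) ^ m) = of_real (\<integral>x. x ^ n * (1 - x) ^ m \<partial>\<nu>)" for n m
  proof (induction m arbitrary: n)
    case 0 show ?case using mom by simp
  next
    case (Suc m)
    have e: "x ^ n * (1 - x) ^ Suc m = x ^ n * (1 - x) ^ m - x ^ Suc n * (1 - x) ^ m" for x :: real
      by (simp add: algebra_simps)
    have "Q t ^ n * (1 - Q t) ^ Suc m = Q t ^ n * (1 - Q t) ^ m - Q t ^ Suc n * (1 - Q t) ^ m"
      by (simp add: left_diff_distrib right_diff_distrib mult.assoc[symmetric] power_commutes)
    then have "\<tau> (Q t ^ n * (1 - Q t) ^ Suc m) = \<tau> (Q t ^ n * (1 - Q t) ^ m) - \<tau> (Q t ^ Suc n * (1 - Q t) ^ m)"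
      using QM by (simp only: tr_diff mult_mem power_mem diff_mem one_mem)
    then show ?case unfolding e using Suc[of n] Suc[of "Suc n"]
      by (simp only: Bochner_Integration.integral_diff Bochner_Integration.integrable_diff of_real_diff simp_thms)
  qed
  have bd: "AE x in \<nu>. \<bar>f x\<bar> \<le> 1"
    if f: "f \<in> borel_measurable borel" and i: "\<And>k. integrable \<nu> (\<lambda>x. f x ^ (2 * k))"
      and le: "\<And>k. (\<integral>x. f x ^ (2 * k) \<partial>\<nu>) \<le> 1" for f :: "real \<Rightarrow> real"
  proof -
    have "AE x in \<nu>. \<bar>f x\<bar> < 1 + 1 / real (Suc n)" for n
    proof -
      define c where "c = 1 + 1 / real (Suc n)"
      have c: "c > 1" by (simp add: c_def)
      define S where "S = {x. \<bar>f x\<bar> \<ge> c}"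
      have S: "S \<in> sets \<nu>" unfolding S_def using f by measurable
      have "prob S * c ^ (2 * k) \<le> 1" for k
      proof -
        have "prob S * c ^ (2 * k) = (\<integral>x. indicator S x * c ^ (2 * k) \<partial>\<nu>)" using S by simp
        also have "\<dots> \<le> (\<integral>x. f x ^ (2 * k) \<partial>\<nu>)"
        proof (rule integral_mono)
          show "integrable \<nu> (\<lambda>x. indicator S x * c ^ (2 * k))" using S by (auto intro!: integrable_real_mult_indicator integrable_mult_left simp: less_top[symmetric])
          show "indicator S x * c ^ (2 * k) \<le> f x ^ (2 * k)" for x
          proof (cases "x \<in> S")
            case True
            then have "c ^ (2 * k) \<le> \<bar>f x\<bar> ^ (2 * k)" using c by (intro power_mono) (auto simp: S_def)
            then show ?thesis using True by (simp add: power_even_abs)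
          qed simp
        qed (rule i)
        also have "\<dots> \<le> 1" by (rule le)
        finally show ?thesis .
      qed
      note key = this
      have "prob S = 0"
      proof (rule ccontr)
        assume "prob S \<noteq> 0"
        then have pos: "prob S > 0" by (simp add: zero_less_measure_iff)
        have "c\<^sup>2 > 1" using c by (simp add: one_less_power)
        then obtain k where "1 / prob S < (c\<^sup>2) ^ k" using real_arch_pow by blast
        then have "1 < prob S * (c\<^sup>2) ^ k" using pos by (simp add: pos_divide_less_eq mult.commute)
        moreover have "c ^ (2 * k) = (c\<^sup>2) ^ k" by (rule power_mult)
        ultimately show False using key[of k] by simp
      qed
      then have "AE x in \<nu>. x \<notin> S" using S by (simp add: prob_eq_0)
      then show ?thesis by eventually_elim (auto simp: S_def c_def)
    qed
    then have "AE x in \<nu>. \<forall>n. \<bar>f x\<bar> < 1 + 1 / real (Suc n)" by (simp add: AE_all_countable)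
    then show ?thesis
    proof eventually_elim
      case (elim x)
      show ?case
      proof (rule field_le_epsilon)
        fix e :: real assume "e > 0"
        then obtain n where "1 / real (Suc n) < e" using nat_approx_posE by blast
        then show "\<bar>f x\<bar> \<le> 1 + e" using elim[rule_format, of n] by linarith
      qed
    qed
  qed
  have norm1: "\<bar>\<integral>x. x ^ n * (1 - x) ^ m \<partial>\<nu>\<bar> \<le> 1" for n m
  proof -
    have "\<bar>\<integral>x. x ^ n * (1 - x) ^ m \<partial>\<nu>\<bar> = cmod (\<tau> (Q t ^ n * (1 - Q t) ^ m))"
      using mixed[of n m] by simp
    also have "\<dots> \<le> n2 (Q t ^ n * (1 - Q t) ^ m)" using QM by (intro tr_le_n2) auto
    also have "\<dots> \<le> 1" using op_bound_n2[OF op_bound_mult[OF op_bound_power[OF op_bound_Q[OF t]] op_bound_power[OF op_bound_one_minus_Q[OF t]]]] by simp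
    finally show ?thesis .
  qed
  have 1: "AE x in \<nu>. \<bar>x\<bar> \<le> 1"
    by (rule bd) (use mom norm1[of _ 0] in \<open>auto simp: abs_le_iff\<close>)
  have 2: "AE x in \<nu>. \<bar>1 - x\<bar> \<le> 1"
    by (rule bd) (use mixed[of 0] norm1[of 0] in \<open>auto simp: abs_le_iff\<close>)
  from 1 2 show ?thesis by eventually_elim auto
qed

end

section \<open>Majorants of power series\<close>

definition majorized :: "'a::real_normed_field fps \<Rightarrow> real fps \<Rightarrow> bool" where
  "majorized f F \<longleftrightarrow> (\<forall>k. norm (f $ k) \<le> F $ k)"

lemma majorizedD: "majorized f F \<Longrightarrow> norm (f $ k) \<le> F $ k" by (simp add: majorized_def)
lemma majorized_nonneg: "majorized f F \<Longrightarrow> 0 \<le> F $ k" using majorizedD norm_ge_zero order_trans by blast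

lemma majorized_add: "majorized f F \<Longrightarrow> majorized g G \<Longrightarrow> majorized (f + g) (F + G)"
  unfolding majorized_def by (auto intro: order_trans[OF norm_triangle_ineq] add_mono)

lemma majorized_mult:
  assumes "majorized f F" "majorized g G" shows "majorized (f * g) (F * G)"
  unfolding majorized_def fps_mult_nth
proof
  fix k
  show "norm (\<Sum>i=0..k. f $ i * g $ (k - i)) \<le> (\<Sum>i=0..k. F $ i * G $ (k - i))"
    by (rule sum_norm_le) (use assms in \<open>auto simp: norm_mult intro!: mult_mono majorizedD majorized_nonneg\<close>)
qed

lemma majorized_sum: "finite I \<Longrightarrow> (\<And>i. i \<in> I \<Longrightarrow> majorized (f i) (F i)) \<Longrightarrow> majorized (\<Sum>i\<in>I. f i) (\<Sum>i\<in>I. F i)"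
proof (induction I rule: finite_induct)
  case empty show ?case by (simp add: majorized_def)
next
  case (insert x I) then show ?case by (simp add: majorized_add)
qed

lemma majorized_mono: "majorized f F \<Longrightarrow> (\<And>k. F $ k \<le> G $ k) \<Longrightarrow> majorized f G"
  unfolding majorized_def by (meson order_trans)

lemma majorized_const: "norm c \<le> C \<Longrightarrow> majorized f F \<Longrightarrow> majorized (fps_const c * f) (fps_const C * F)"
  unfolding majorized_def by (auto simp: norm_mult intro!: mult_mono) (meson norm_ge_zero order_trans)

text \<open>The series \<open>1/(1 - r X)\<close>; its powers are the majorants, since they are stable under products and under
  \<open>X d/dX\<close>.\<close>

definition geom :: "real \<Rightarrow> real fps" where "geom r = Abs_fps (\<lambda>k. r ^ k)"

lemma geom_nth [simp]: "geom r $ k = r ^ k" by (simp add: geom_def)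

lemma geom_power_nonneg: assumes "r \<ge> 0" shows "geom r ^ m $ k \<ge> 0"
proof (induction m arbitrary: k)
  case (Suc m) then show ?case using assms by (auto simp: fps_mult_nth intro!: sum_nonneg)
qed (simp add: fps_one_nth)

lemma geom_power_mono_Suc: assumes "r \<ge> 0" shows "geom r ^ m $ k \<le> geom r ^ Suc m $ k"
proof -
  have "geom r ^ m $ k = (\<Sum>i\<in>{0}. geom r $ i * geom r ^ m $ (k - i))" by simp
  also have "\<dots> \<le> (\<Sum>i=0..k. geom r $ i * geom r ^ m $ (k - i))"
    by (rule sum_mono2) (use assms geom_power_nonneg in auto)
  finally show ?thesis by (simp add: fps_mult_nth)
qed

lemma majorized_geom_Suc: "r \<ge> 0 \<Longrightarrow> majorized f (fps_const C * geom r ^ m) \<Longrightarrow> C \<ge> 0 \<Longrightarrow> majorized f (fps_const C * geom r ^ Suc m)"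
  by (erule majorized_mono) (auto intro!: mult_left_mono geom_power_mono_Suc[simplified])

lemma fps_XD_mult: "fps_X * fps_deriv (f * g) = fps_X * fps_deriv f * g + f * (fps_X * fps_deriv (g :: 'a::comm_ring_1 fps))"
  by (simp add: algebra_simps)

lemma XD_nth: "(fps_X * fps_deriv f) $ k = of_nat k * f $ k"
  by (cases k) simp_all

lemma majorized_XD_geom: assumes r: "r \<ge> 0" shows "majorized (fps_X * fps_deriv (geom r ^ m)) (fps_const (real m) * geom r ^ Suc m)"
proof (induction m)
  case 0 show ?case by (simp add: majorized_def)
next
  case (Suc m)
  have g: "majorized (geom r) (geom r)" using r by (simp add: majorized_def)
  have gm: "majorized (geom r ^ m) (geom r ^ m)" using geom_power_nonneg[OF r] by (simp add: majorized_def)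
  have "majorized (fps_X * fps_deriv (geom r)) (geom r * geom r)"
    unfolding majorized_def XD_nth
  proof
    fix k
    have "(geom r * geom r) $ k = (\<Sum>i=0..k. r ^ k)"
      unfolding fps_mult_nth by (intro sum.cong refl) (simp add: power_add[symmetric])
    then show "norm (of_nat k * geom r $ k) \<le> (geom r * geom r) $ k"
      using r by (simp add: algebra_simps)
  qed
  from majorized_add[OF majorized_mult[OF this gm] majorized_mult[OF g Suc]]
  show ?case unfolding power_Suc fps_XD_mult
    by (rule majorized_mono) (simp add: algebra_simps fps_const_add[symmetric] del: fps_const_add)
qed

lemma majorized_XD:
  assumes r: "r \<ge> 0" and f: "majorized f (fps_const C * geom r ^ m)"
  shows "majorized (fps_X * fps_deriv f) (fps_const (C * real m) * geom r ^ Suc m)"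
  unfolding majorized_def XD_nth
proof
  fix k
  have C: "0 \<le> C"
    using majorized_nonneg[OF f, of 0] by (simp add: zero_le_mult_iff fps_power_zeroth)
  have "norm (of_nat k * f $ k) \<le> real k * (C * geom r ^ m $ k)"
    using majorizedD[OF f, of k] by (auto simp: norm_mult intro: mult_left_mono)
  also have "\<dots> = C * (real k * geom r ^ m $ k)" by simp
  also have "\<dots> \<le> C * (real m * geom r ^ Suc m $ k)"
    using majorized_XD_geom[OF r, of m] C unfolding majorized_def XD_nth by (intro mult_left_mono) (auto simp: abs_le_iff)
  finally show "norm (of_nat k * f $ k) \<le> (fps_const (C * real m) * geom r ^ Suc m) $ k"
    by (simp only: fps_mult_left_const_nth mult.assoc)
qed

text \<open>The radius of convergence is given up by an arbitrarily small amount only: any \<open>y < 1/r\<close> is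
  admitted, at the price of a constant that is geometric in \<open>m\<close>.\<close>

lemma geom_power_bound:
  assumes r: "r \<ge> 0" and y: "0 < y" "r * y < 1"
  shows "geom r ^ m $ k * y ^ k \<le> (1 / (1 - r * y)) ^ m"
proof (induction m arbitrary: k)
  case 0 show ?case by (simp add: fps_one_nth)
next
  case (Suc m)
  define C where "C = 1 / (1 - r * y)"
  have C: "C > 0" using y by (simp add: C_def)
  have "geom r ^ Suc m $ k * y ^ k = (\<Sum>i=0..k. (r * y) ^ i * (geom r ^ m $ (k - i) * y ^ (k - i)))"
    unfolding power_Suc fps_mult_nth sum_distrib_right
    by (intro sum.cong refl) (simp add: power_mult_distrib power_add[symmetric] mult_ac)
  also have "\<dots> \<le> (\<Sum>i=0..k. (r * y) ^ i * C ^ m)"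
    using r y Suc by (intro sum_mono mult_left_mono) (auto simp: C_def)
  also have "\<dots> = (\<Sum>i\<le>k. (r * y) ^ i) * C ^ m" by (simp add: sum_distrib_right atLeast0AtMost)
  also have "(\<Sum>i\<le>k. (r * y) ^ i) \<le> C"
  proof -
    have "(1 - r * y) * (\<Sum>i\<le>k. (r * y) ^ i) = 1 - (r * y) ^ Suc k" by (rule sum_gp_basic)
    also have "\<dots> \<le> 1" using r y by simp
    finally show ?thesis using y by (simp add: C_def field_simps)
  qed
  finally show ?case using C by (simp add: C_def mult_right_mono)
qed

section \<open>Taylor coefficients in time\<close>

text \<open>The \<open>n\<close>-th Taylor coefficient in time of a solution of \<open>\<partial>\<^sub>t E = X \<partial>\<^sub>X (A E\<^sup>2 + B E)\<close>, as a function of the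
  solution at that time.\<close>

fun taylor_coeff :: "complex fps \<Rightarrow> complex fps \<Rightarrow> complex fps \<Rightarrow> nat \<Rightarrow> complex fps" where
  "taylor_coeff A B E 0 = E"
| "taylor_coeff A B E (Suc n) = fps_const (1 / of_nat (Suc n)) *
     (fps_X * fps_deriv (A * (\<Sum>j\<le>n. taylor_coeff A B E j * taylor_coeff A B E (n - j)) + B * taylor_coeff A B E n))"

fun majorant_coeff :: "real \<Rightarrow> real \<Rightarrow> nat \<Rightarrow> real" where
  "majorant_coeff K M 0 = K"
| "majorant_coeff K M (Suc n) = 3 * M * ((\<Sum>j\<le>n. majorant_coeff K M j * majorant_coeff K M (n - j)) + majorant_coeff K M n)"

lemma majorant_coeff_nonneg: "K \<ge> 0 \<Longrightarrow> M \<ge> 0 \<Longrightarrow> majorant_coeff K M n \<ge> 0"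
proof (induction n rule: less_induct)
  case (less n)
  then show ?case by (cases n) (auto intro!: mult_nonneg_nonneg add_nonneg_nonneg sum_nonneg)
qed

text \<open>The exponents of \<open>1/(1 - r X)\<close> are \<open>1\<close> for the solution and add up under products; the factor \<open>A\<close> and the
  derivation raise them by one each. The recursion \<open>e\<^bsub>n+1\<^esub> = e\<^sub>j + e\<^bsub>n-j\<^esub> + 2\<close> is solved by \<open>3 n + 1\<close>, and the
  factor \<open>3 (n + 1)\<close> produced by the derivation cancels against \<open>1/(n + 1)\<close>.\<close>

lemma taylor_coeff_majorized:
  assumes r: "r \<ge> 0" and K: "K \<ge> 0" and M: "M \<ge> 0"
    and A: "majorized A (fps_const M * geom r)" and B: "majorized B (fps_const M * geom r)" and E: "majorized E (fps_const K * geom r)"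
  shows "majorized (taylor_coeff A B E n) (fps_const (majorant_coeff K M n) * geom r ^ (3 * n + 1))"
proof (induction n rule: less_induct)
  case (less n)
  show ?case
  proof (cases n)
    case 0 then show ?thesis using E by simp
  next
    case (Suc n')
    let ?Q = "taylor_coeff A B E" and ?a = "majorant_coeff K M"
    define S where "S = (\<Sum>j\<le>n'. ?a j * ?a (n' - j))"
    have IH: "majorized (?Q j) (fps_const (?a j) * geom r ^ (3 * j + 1))" if "j \<le> n'" for j
      using less[of j] that Suc by simp
    have "majorized (\<Sum>j\<le>n'. ?Q j * ?Q (n' - j)) (\<Sum>j\<le>n'. fps_const (?a j * ?a (n' - j)) * geom r ^ (3 * n' + 2))"
    proof (rule majorized_sum)
      fix j assume j: "j \<in> {..n'}"
      have e: "(3 * j + 1) + (3 * (n' - j) + 1) = 3 * n' + 2" using j by auto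
      have "majorized (?Q j * ?Q (n' - j)) ((fps_const (?a j) * geom r ^ (3 * j + 1)) * (fps_const (?a (n' - j)) * geom r ^ (3 * (n' - j) + 1)))"
        using j by (intro majorized_mult IH) auto
      also have "(fps_const (?a j) * geom r ^ (3 * j + 1)) * (fps_const (?a (n' - j)) * geom r ^ (3 * (n' - j) + 1))
        = fps_const (?a j * ?a (n' - j)) * geom r ^ (3 * n' + 2)"
        unfolding e[symmetric] power_add by (simp add: fps_const_mult[symmetric] mult_ac del: fps_const_mult)
      finally show "majorized (?Q j * ?Q (n' - j)) (fps_const (?a j * ?a (n' - j)) * geom r ^ (3 * n' + 2))" .
    qed simp
    also have "(\<Sum>j\<le>n'. fps_const (?a j * ?a (n' - j)) * geom r ^ (3 * n' + 2)) = fps_const S * geom r ^ (3 * n' + 2)"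
      unfolding sum_distrib_right[symmetric] S_def by (simp add: fps_eq_iff fps_sum_nth sum_distrib_right)
    finally have mA: "majorized (A * (\<Sum>j\<le>n'. ?Q j * ?Q (n' - j))) ((fps_const M * geom r) * (fps_const S * geom r ^ (3 * n' + 2)))"
      by (intro majorized_mult A)
    have mB: "majorized (B * ?Q n') ((fps_const M * geom r) * (fps_const (?a n') * geom r ^ (3 * n' + 2)))"
      using majorized_geom_Suc[OF r IH[of n']] majorant_coeff_nonneg[OF K M] by (intro majorized_mult B) auto
    have eq: "((fps_const M * geom r) * (fps_const S * geom r ^ (3 * n' + 2)) + (fps_const M * geom r) * (fps_const (?a n') * geom r ^ (3 * n' + 2)))
      = (fps_const (M * (S + ?a n')) * geom r ^ (3 * n' + 3))"
    proof -
      have "geom r ^ (3 * n' + 3) = geom r * geom r ^ (3 * n' + 2)" by (simp add: power_Suc[symmetric] numeral_3_eq_3 del: power_Suc)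
      then show ?thesis by (simp add: fps_const_mult[symmetric] fps_const_add[symmetric] algebra_simps del: fps_const_mult fps_const_add)
    qed
    have "majorized (A * (\<Sum>j\<le>n'. ?Q j * ?Q (n' - j)) + B * ?Q n') (fps_const (M * (S + ?a n')) * geom r ^ (3 * n' + 3))"
      using majorized_add[OF mA mB] unfolding eq .
    then have "majorized (fps_X * fps_deriv (A * (\<Sum>j\<le>n'. ?Q j * ?Q (n' - j)) + B * ?Q n'))
        (fps_const (M * (S + ?a n') * real (3 * n' + 3)) * geom r ^ Suc (3 * n' + 3))"
      by (rule majorized_XD[OF r])
    moreover have "norm (1 / of_nat (Suc n') :: complex) \<le> 1 / real (Suc n')"
      by (simp only: norm_divide norm_one norm_of_nat order_refl)
    ultimately have "majorized (fps_const (1 / of_nat (Suc n')) * (fps_X * fps_deriv (A * (\<Sum>j\<le>n'. ?Q j * ?Q (n' - j)) + B * ?Q n')))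
        (fps_const (1 / real (Suc n')) * (fps_const (M * (S + ?a n') * real (3 * n' + 3)) * geom r ^ Suc (3 * n' + 3)))"
      by (rule majorized_const[rotated])
    also have "fps_const (1 / real (Suc n')) * (fps_const (M * (S + ?a n') * real (3 * n' + 3)) * geom r ^ Suc (3 * n' + 3))
       = fps_const (?a n) * geom r ^ (3 * n + 1)"
    proof -
      have "1 / real (Suc n') * (M * (S + ?a n') * real (3 * n' + 3)) = 3 * M * (S + ?a n')"
        by (simp add: field_simps)
      then show ?thesis unfolding mult.assoc[symmetric] fps_const_mult
        by (simp add: Suc S_def numeral_3_eq_3)
    qed
    finally show ?thesis by (simp add: Suc)
  qed
qed

text \<open>The numbers grow like Catalan numbers. If \<open>s\<close> is a partial sum of the series
  \<open>majorant_coeff K M n * y ^ n\<close>, the next one is at most \<open>K + 3 M y (s\<^sup>2 + s)\<close>, and for the \<open>y\<close> chosen below this map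
  preserves \<open>[0, 2 K]\<close>.\<close>

lemma majorant_coeff_bound:
  assumes K: "K > 0" and M: "M > 0"
  shows "majorant_coeff K M n \<le> 2 * K * (3 * M * (4 * K + 2)) ^ n"
proof -
  define y where "y = 1 / (3 * M * (4 * K + 2))"
  have y: "y > 0" using K M by (simp add: y_def)
  define b where "b n = majorant_coeff K M n * y ^ n" for n
  have b0: "b n \<ge> 0" for n using majorant_coeff_nonneg[of K M n] K M y by (simp add: b_def)
  have "(\<Sum>n\<le>N. b n) \<le> 2 * K" for N
  proof (induction N)
    case 0 show ?case using K by (simp add: b_def)
  next
    case (Suc N)
    define s where "s = (\<Sum>n\<le>N. b n)"
    have s: "0 \<le> s" "s \<le> 2 * K" using b0 Suc by (auto simp: s_def intro: sum_nonneg)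
    have bS: "b (Suc n) = 3 * M * y * ((\<Sum>j\<le>n. b j * b (n - j)) + b n)" for n
    proof -
      have "(\<Sum>j\<le>n. b j * b (n - j)) = (\<Sum>j\<le>n. majorant_coeff K M j * majorant_coeff K M (n - j)) * y ^ n"
        unfolding sum_distrib_right b_def by (intro sum.cong refl) (simp add: power_add[symmetric] mult_ac)
      then show ?thesis by (simp add: b_def algebra_simps)
    qed
    have "(\<Sum>n\<le>N. \<Sum>j\<le>n. b j * b (n - j)) = (\<Sum>(i,j)\<in>{(i,j). i + j \<le> N}. b i * b j)"
      by (rule sum.triangle_reindex_eq[symmetric])
    also have "\<dots> \<le> (\<Sum>(i,j)\<in>{..N} \<times> {..N}. b i * b j)"
      by (rule sum_mono2) (use b0 in auto)
    also have "\<dots> = s * s" by (simp add: s_def sum_product sum.cartesian_product)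
    finally have conv: "(\<Sum>n\<le>N. \<Sum>j\<le>n. b j * b (n - j)) \<le> s * s" .
    have "(\<Sum>n\<le>Suc N. b n) = K + (\<Sum>n\<le>N. b (Suc n))" by (subst sum.atMost_Suc_shift) (simp add: b_def)
    also have "(\<Sum>n\<le>N. b (Suc n)) = 3 * M * y * ((\<Sum>n\<le>N. \<Sum>j\<le>n. b j * b (n - j)) + s)"
      unfolding bS s_def by (simp add: sum_distrib_left sum.distrib[symmetric] distrib_left)
    also have "\<dots> \<le> 3 * M * y * (s * s + s)" using conv M y by (intro mult_left_mono add_right_mono) auto
    also have "\<dots> \<le> 3 * M * y * (2 * K * (2 * K) + 2 * K)"
      using s M y by (intro mult_left_mono add_mono mult_mono) auto
    also have "\<dots> = K * (y * (3 * M * (4 * K + 2)))" by (simp add: algebra_simps)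
    also have "y * (3 * M * (4 * K + 2)) = 1" using K M by (simp add: y_def)
    finally show ?case by simp
  qed
  moreover have "b n \<le> (\<Sum>n\<le>n. b n)" using b0 by (intro member_le_sum) auto
  ultimately have "b n \<le> 2 * K" using order_trans by blast
  moreover define D where "D = 3 * M * (4 * K + 2)"
  have D: "D > 0" using K M by (simp add: D_def)
  ultimately have "majorant_coeff K M n / D ^ n \<le> 2 * K" by (simp add: b_def y_def D_def[symmetric] power_one_over)
  then show ?thesis using D by (simp add: D_def[symmetric] pos_divide_le_eq)
qed

text \<open>Differentiation in time is taken coefficient by coefficient, so that no exchange of limits occurs:
  every coefficient of a product or of \<open>X d/dX\<close> is a finite expression in the coefficients.\<close>

definition fps_time_deriv :: "(real \<Rightarrow> complex fps) \<Rightarrow> complex fps \<Rightarrow> real \<Rightarrow> bool" where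
  "fps_time_deriv F F' t \<longleftrightarrow> (\<forall>k. ((\<lambda>s. F s $ k) has_vector_derivative F' $ k) (at t))"

lemma fps_time_deriv_const: "fps_time_deriv (\<lambda>_. c) 0 t" by (simp add: fps_time_deriv_def)
lemma fps_time_deriv_add: "fps_time_deriv F F' t \<Longrightarrow> fps_time_deriv G G' t \<Longrightarrow> fps_time_deriv (\<lambda>s. F s + G s) (F' + G') t"
  by (auto simp: fps_time_deriv_def intro: has_vector_derivative_add)
lemma fps_time_deriv_sum: "(\<And>i. i \<in> I \<Longrightarrow> fps_time_deriv (F i) (F' i) t) \<Longrightarrow> fps_time_deriv (\<lambda>s. \<Sum>i\<in>I. F i s) (\<Sum>i\<in>I. F' i) t"
  by (induction I rule: infinite_finite_induct) (auto intro: fps_time_deriv_add fps_time_deriv_const)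
lemma fps_time_deriv_mult: "fps_time_deriv F F' t \<Longrightarrow> fps_time_deriv G G' t \<Longrightarrow> fps_time_deriv (\<lambda>s. F s * G s) (F' * G t + F t * G') t"
  unfolding fps_time_deriv_def fps_mult_nth fps_add_nth sum.distrib[symmetric]
  by (auto intro!: has_vector_derivative_sum derivative_eq_intros has_vector_derivative_mult simp: add.commute)
lemma fps_time_deriv_cmult: "fps_time_deriv F F' t \<Longrightarrow> fps_time_deriv (\<lambda>s. c * F s) (c * F') t"
  using fps_time_deriv_mult[OF fps_time_deriv_const] by fastforce
lemma fps_time_deriv_XD: "fps_time_deriv F F' t \<Longrightarrow> fps_time_deriv (\<lambda>s. fps_X * fps_deriv (F s)) (fps_X * fps_deriv F') t"
  unfolding fps_time_deriv_def XD_nth by (auto intro!: has_vector_derivative_mult_right)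

lemma sum_shift_identity:
  fixes Q :: "nat \<Rightarrow> 'a::comm_ring_1"
  shows "(\<Sum>j\<le>n. of_nat (Suc j) * Q (Suc j) * Q (n - j) + Q j * (of_nat (Suc (n - j)) * Q (Suc (n - j))))
    = of_nat (Suc n) * (\<Sum>i\<le>Suc n. Q i * Q (Suc n - i))"
proof -
  have 1: "(\<Sum>j\<le>n. of_nat (Suc j) * Q (Suc j) * Q (n - j)) = (\<Sum>i\<le>Suc n. of_nat i * (Q i * Q (Suc n - i)))"
    unfolding sum.atMost_Suc_shift by (simp add: mult.assoc)
  have 2: "(\<Sum>j\<le>n. Q j * (of_nat (Suc (n - j)) * Q (Suc (n - j)))) = (\<Sum>i\<le>Suc n. of_nat (Suc n - i) * (Q i * Q (Suc n - i)))"
  proof -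
    have "(\<Sum>i\<le>Suc n. of_nat (Suc n - i) * (Q i * Q (Suc n - i))) = (\<Sum>i\<le>n. of_nat (Suc n - i) * (Q i * Q (Suc n - i)))"
      by simp
    also have "\<dots> = (\<Sum>j\<le>n. Q j * (of_nat (Suc (n - j)) * Q (Suc (n - j))))"
      by (intro sum.cong refl) (simp only: atMost_iff Suc_diff_le mult_ac)
    finally show ?thesis ..
  qed
  have "(\<Sum>j\<le>n. of_nat (Suc j) * Q (Suc j) * Q (n - j) + Q j * (of_nat (Suc (n - j)) * Q (Suc (n - j))))
    = (\<Sum>i\<le>Suc n. (of_nat i + of_nat (Suc n - i)) * (Q i * Q (Suc n - i)))"
    unfolding sum.distrib 1 2 by (simp only: distrib_right sum.distrib)
  also have "\<dots> = (\<Sum>i\<le>Suc n. of_nat (Suc n) * (Q i * Q (Suc n - i)))"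
    by (intro sum.cong refl arg_cong2[where f = "(*)"]) (auto simp: of_nat_add[symmetric] simp del: of_nat_add of_nat_Suc)
  finally show ?thesis by (simp only: sum_distrib_left)
qed

lemma taylor_coeff_derivative:
  fixes E :: "real \<Rightarrow> complex fps"
  assumes pde: "fps_time_deriv E (fps_X * fps_deriv (A * (E t * E t) + B * E t)) t"
  shows "fps_time_deriv (\<lambda>s. taylor_coeff A B (E s) n) (of_nat (Suc n) * taylor_coeff A B (E t) (Suc n)) t"
proof (induction n rule: less_induct)
  case (less n)
  show ?case
  proof (cases n)
    case 0 then show ?thesis using pde by simp
  next
    case (Suc n')
    let ?Q = "\<lambda>s. taylor_coeff A B (E s)"
    let ?Q' = "\<lambda>j. of_nat (Suc j) * ?Q t (Suc j)"
    have IH: "fps_time_deriv (\<lambda>s. ?Q s j) (?Q' j) t" if "j \<le> n'" for j using less[of j] that Suc by simp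
    define F where "F s = A * (\<Sum>j\<le>n'. ?Q s j * ?Q s (n' - j)) + B * ?Q s n'" for s
    have "fps_time_deriv F (A * (\<Sum>j\<le>n'. ?Q' j * ?Q t (n' - j) + ?Q t j * ?Q' (n' - j)) + B * ?Q' n') t"
      unfolding F_def[abs_def] by (intro fps_time_deriv_add fps_time_deriv_cmult fps_time_deriv_sum fps_time_deriv_mult IH) auto
    also have "(\<Sum>j\<le>n'. ?Q' j * ?Q t (n' - j) + ?Q t j * ?Q' (n' - j)) = of_nat n * (\<Sum>i\<le>n. ?Q t i * ?Q t (n - i))"
      unfolding Suc by (rule sum_shift_identity)
    also have "A * (of_nat n * (\<Sum>i\<le>n. ?Q t i * ?Q t (n - i))) + B * ?Q' n' 
       = of_nat n * (A * (\<Sum>i\<le>n. ?Q t i * ?Q t (n - i)) + B * ?Q t n)"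
      unfolding Suc by (simp only: distrib_left mult_ac)
    finally have F: "fps_time_deriv F (of_nat n * (A * (\<Sum>i\<le>n. ?Q t i * ?Q t (n - i)) + B * ?Q t n)) t" .
    have "fps_time_deriv (\<lambda>s. fps_const (1 / of_nat n) * (fps_X * fps_deriv (F s)))
      (fps_const (1 / of_nat n) * (fps_X * fps_deriv (of_nat n * (A * (\<Sum>i\<le>n. ?Q t i * ?Q t (n - i)) + B * ?Q t n)))) t"
      by (intro fps_time_deriv_cmult fps_time_deriv_XD F)
    moreover have "fps_const (1 / of_nat n) * (fps_X * fps_deriv (of_nat n * f)) = fps_X * fps_deriv f" for f :: "complex fps"
    proof -
      have n: "(of_nat n :: complex fps) = fps_const (of_nat n)" by (simp add: fps_of_nat)
      have "fps_const (1 / of_nat n) * (fps_X * fps_deriv (fps_const (of_nat n) * f))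
        = (fps_const (1 / of_nat n) * fps_const (of_nat n)) * (fps_X * fps_deriv f)"
        unfolding fps_deriv_mult_const_left by (simp only: mult_ac)
      also have "fps_const (1 / of_nat n) * fps_const (of_nat n) = (1 :: complex fps)"
        unfolding fps_const_mult using Suc by (simp del: of_nat_Suc)
      finally show ?thesis unfolding n by simp
    qed
    moreover have "of_nat (Suc n) * ?Q t (Suc n) = fps_X * fps_deriv (A * (\<Sum>i\<le>n. ?Q t i * ?Q t (n - i)) + B * ?Q t n)"
    proof -
      have n: "(of_nat (Suc n) :: complex fps) = fps_const (of_nat (Suc n))" by (simp only: fps_of_nat)
      show ?thesis unfolding n taylor_coeff.simps mult.assoc[symmetric] fps_const_mult by (simp del: of_nat_Suc)
    qed
    moreover have "(\<lambda>s. ?Q s n) = (\<lambda>s. fps_const (1 / of_nat n) * (fps_X * fps_deriv (F s)))"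
      unfolding Suc F_def by simp
    ultimately show ?thesis by (simp only:)
  qed
qed

text \<open>The function \<open>s \<mapsto> f\<^sub>0(s) + f\<^sub>1(s) (t - s) + \<dots> + f\<^sub>N(s) (t - s)\<^sup>N\<close> interpolates between the Taylor polynomial
  (\<open>s = t0\<close>) and the value (\<open>s = t\<close>), and its derivative telescopes to a single term.\<close>

lemma real_taylor_sums:
  fixes f :: "nat \<Rightarrow> real \<Rightarrow> complex"
  assumes der: "\<And>n s. s > 0 \<Longrightarrow> (f n has_vector_derivative of_nat (Suc n) * f (Suc n) s) (at s)"
    and bd: "\<And>n s. s > 0 \<Longrightarrow> norm (f n s) \<le> C * L ^ n"
    and t: "t > 0" "t0 > 0" and close: "L * \<bar>t - t0\<bar> < 1" and L: "L > 0"
  shows "(\<lambda>n. f n t0 * of_real (t - t0) ^ n) sums f 0 t"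
proof -
  have C: "C \<ge> 0" using bd[OF t(1), of 0] norm_ge_zero[of "f 0 t"] by (simp del: norm_ge_zero)
  define \<phi> where "\<phi> N s = (\<Sum>n<N. f n s * of_real (t - s) ^ n)" for N s
  have d: "(\<phi> (Suc N) has_vector_derivative of_nat (Suc N) * f (Suc N) s * of_real (t - s) ^ N) (at s)" if s: "s > 0" for N s
  proof (induction N)
    case 0
    have "\<phi> (Suc 0) = f 0" by (simp add: \<phi>_def fun_eq_iff)
    then show ?case using der[OF s, of 0] by simp
  next
    case (Suc N)
    have p: "((\<lambda>s. of_real (t - s) ^ Suc N :: complex) has_vector_derivative - (of_nat (Suc N) * of_real (t - s) ^ N)) (at s)"
    proof -
      have "((\<lambda>s. (t - s) ^ Suc N) has_real_derivative - (real (Suc N) * (t - s) ^ N)) (at s)"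
        by (auto intro!: derivative_eq_intros simp del: power_Suc)
      from has_vector_derivative_of_real[OF this] show ?thesis by (simp del: power_Suc)
    qed
    have "((\<lambda>s. \<phi> (Suc N) s + f (Suc N) s * of_real (t - s) ^ Suc N) has_vector_derivative
       of_nat (Suc N) * f (Suc N) s * of_real (t - s) ^ N +
       (f (Suc N) s * (- (of_nat (Suc N) * of_real (t - s) ^ N)) + of_nat (Suc (Suc N)) * f (Suc (Suc N)) s * of_real (t - s) ^ Suc N)) (at s)"
      by (intro has_vector_derivative_add Suc has_vector_derivative_mult der[OF s] p)
    also have "(\<lambda>s. \<phi> (Suc N) s + f (Suc N) s * of_real (t - s) ^ Suc N) = \<phi> (Suc (Suc N))"
      by (simp add: \<phi>_def fun_eq_iff)
    finally show ?case by (simp add: algebra_simps)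
  qed
  have err: "norm (\<phi> (Suc N) t - \<phi> (Suc N) t0) \<le> C * (real (Suc N) * (L * \<bar>t - t0\<bar>) ^ Suc N)" for N
  proof -
    have "norm (\<phi> (Suc N) t - \<phi> (Suc N) t0) \<le> (real (Suc N) * (C * L ^ Suc N) * \<bar>t - t0\<bar> ^ N) * norm (t - t0)"
    proof (rule differentiable_bound)
      show "convex (closed_segment t0 t)" "t \<in> closed_segment t0 t" "t0 \<in> closed_segment t0 t" by auto
      fix s assume s: "s \<in> closed_segment t0 t"
      then have s0: "s > 0" and st: "\<bar>t - s\<bar> \<le> \<bar>t - t0\<bar>"
        using t by (auto simp: closed_segment_eq_real_ivl split: if_splits)
      show "(\<phi> (Suc N) has_derivative (\<lambda>x. x *\<^sub>R (of_nat (Suc N) * f (Suc N) s * of_real (t - s) ^ N))) (at s within closed_segment t0 t)"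
        using d[OF s0, of N] unfolding has_vector_derivative_def by (rule has_derivative_at_withinI)
      have "norm (of_nat (Suc N) * f (Suc N) s * of_real (t - s) ^ N) = real (Suc N) * norm (f (Suc N) s) * \<bar>t - s\<bar> ^ N"
        by (simp only: norm_mult norm_of_nat norm_power norm_of_real)
      also have "\<dots> \<le> real (Suc N) * (C * L ^ Suc N) * \<bar>t - t0\<bar> ^ N"
        using bd[OF s0, of "Suc N"] st C L by (intro mult_mono power_mono) auto
      finally show "onorm (\<lambda>x. x *\<^sub>R (of_nat (Suc N) * f (Suc N) s * of_real (t - s) ^ N)) \<le> real (Suc N) * (C * L ^ Suc N) * \<bar>t - t0\<bar> ^ N"
        by (simp add: onorm_scaleR_left onorm_id)
    qed
    also have "\<dots> = C * (real (Suc N) * (L * \<bar>t - t0\<bar>) ^ Suc N)" by (simp add: power_mult_distrib)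
    finally show ?thesis .
  qed
  have "(\<lambda>n. real n * (L * \<bar>t - t0\<bar>) ^ n) \<longlonglongrightarrow> 0"
    by (rule powser_times_n_limit_0) (use close L in \<open>simp add: abs_mult\<close>)
  then have "(\<lambda>N. real (Suc N) * (L * \<bar>t - t0\<bar>) ^ Suc N) \<longlonglongrightarrow> 0" by (rule LIMSEQ_Suc)
  then have lim: "(\<lambda>N. C * (real (Suc N) * (L * \<bar>t - t0\<bar>) ^ Suc N)) \<longlonglongrightarrow> 0" by (rule tendsto_mult_right_zero)
  have "\<phi> (Suc N) t = f 0 t" for N
    unfolding \<phi>_def by (subst sum.lessThan_Suc_shift) simp
  then have "(\<lambda>N. f 0 t - \<phi> (Suc N) t0) \<longlonglongrightarrow> 0" using err by (intro Lim_null_comparison[OF _ lim]) auto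
  then have "(\<lambda>N. f 0 t - (f 0 t - \<phi> (Suc N) t0)) \<longlonglongrightarrow> f 0 t - 0" by (intro tendsto_diff tendsto_const)
  then have "(\<lambda>N. \<phi> (Suc N) t0) \<longlonglongrightarrow> f 0 t" by simp
  then show ?thesis unfolding sums_def \<phi>_def by (rule LIMSEQ_imp_Suc)
qed

section \<open>Moving the centre of a moment series\<close>

context fixes c :: complex begin

definition inv_lin :: "complex fps" where "inv_lin = inverse (1 + fps_const c * fps_X)"
definition mobius :: "complex fps" where "mobius = fps_X * inv_lin"
text \<open>If \<open>f\<close> has the coefficients \<open>\<nu>(x\<^sup>n)\<close> of some linear functional \<open>\<nu>\<close>, then \<open>X f\<close> is its resolvent at \<open>1/X\<close>. The
  resolvent at \<open>c + 1/X\<close> is obtained from \<open>1/(c + 1/X) = X/(1 + c X)\<close>, and its coefficients are \<open>\<nu>((x - c)\<^sup>n)\<close>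
  by the binomial theorem (\<open>shift_nth\<close>).\<close>

definition shift :: "complex fps \<Rightarrow> complex fps" where "shift f = inv_lin * (f oo mobius)"

lemma inv_lin_mult: "(1 + fps_const c * fps_X) * inv_lin = 1"
  unfolding inv_lin_def by (rule inverse_mult_eq_1') simp

lemma mobius_0 [simp]: "mobius $ 0 = 0" by (simp add: mobius_def)

lemma inv_lin_cancel: "f * (1 + fps_const c * fps_X) = g \<Longrightarrow> f = g * inv_lin"
  using inv_lin_mult by (metis mult.assoc mult.right_neutral)

lemma inv_lin_mob_power: "inv_lin * mobius ^ i = Abs_fps (\<lambda>n. of_nat (n choose i) * (- c) ^ (n - i))"
proof (induction i)
  case 0
  have "Abs_fps (\<lambda>n. (- c) ^ n) * (1 + fps_const c * fps_X) = 1"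
  proof (rule fps_ext)
    fix n show "(Abs_fps (\<lambda>n. (- c) ^ n) * (1 + fps_const c * fps_X)) $ n = 1 $ n"
      by (cases n) (simp_all add: distrib_left mult.assoc[symmetric])
  qed
  from inv_lin_cancel[OF this] show ?case by simp
next
  case (Suc i)
  let ?D = "\<lambda>i. Abs_fps (\<lambda>n. of_nat (n choose i) * (- c) ^ (n - i)) :: complex fps"
  have "?D (Suc i) * (1 + fps_const c * fps_X) = fps_X * ?D i"
  proof (rule fps_ext)
    fix n
    show "(?D (Suc i) * (1 + fps_const c * fps_X)) $ n = (fps_X * ?D i) $ n"
    proof (cases n)
      case 0 then show ?thesis by (simp add: distrib_left mult.assoc[symmetric])
    next
      case (Suc m)
      have "of_nat (m choose Suc i) * (- c) ^ (m - Suc i) * c = - (of_nat (m choose Suc i) * (- c) ^ (m - i))"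
      proof (cases "i < m")
        case True
        then have "m - i = Suc (m - Suc i)" by simp
        then show ?thesis by simp
      qed (simp add: binomial_eq_0)
      then show ?thesis using Suc by (simp add: distrib_left mult.assoc[symmetric] distrib_right)
    qed
  qed
  from inv_lin_cancel[OF this] have "?D (Suc i) = fps_X * ?D i * inv_lin" .
  also have "\<dots> = inv_lin * mobius ^ Suc i" by (subst Suc[symmetric]) (simp add: mobius_def mult_ac)
  finally show ?case ..
qed

lemma shift_nth: "shift f $ n = (\<Sum>i\<le>n. of_nat (n choose i) * (- c) ^ (n - i) * f $ i)"
proof -
  have pre: "(mobius ^ i) $ m = 0" if "m < i" for i m
    using startsby_zero_power_prefix[of mobius i] that by simp
  have "(f oo mobius) $ m = (\<Sum>i\<le>n. f $ i * (mobius ^ i) $ m)" if "m \<le> n" for m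
    unfolding fps_compose_nth using that pre
    by (intro sum.mono_neutral_left) auto
  then have "shift f $ n = (\<Sum>j=0..n. inv_lin $ j * (\<Sum>i\<le>n. f $ i * (mobius ^ i) $ (n - j)))"
    unfolding shift_def fps_mult_nth by (intro sum.cong refl) simp
  also have "\<dots> = (\<Sum>i\<le>n. f $ i * (\<Sum>j=0..n. inv_lin $ j * (mobius ^ i) $ (n - j)))"
    unfolding sum_distrib_left by (subst sum.swap) (simp add: mult_ac)
  also have "\<dots> = (\<Sum>i\<le>n. f $ i * (inv_lin * mobius ^ i) $ n)" by (simp only: fps_mult_nth)
  finally show ?thesis unfolding inv_lin_mob_power by (simp add: mult_ac)
qed

lemma shift_time_deriv: assumes "fps_time_deriv F F' t" shows "fps_time_deriv (\<lambda>s. shift (F s)) (shift F') t"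
  unfolding fps_time_deriv_def shift_nth
  using assms unfolding fps_time_deriv_def by (intro allI has_vector_derivative_sum has_vector_derivative_mult_right) blast

lemma deriv_geoc: "fps_deriv inv_lin = - (fps_const c * (inv_lin * inv_lin))"
proof -
  have "fps_deriv ((1 + fps_const c * fps_X) * inv_lin) = 0" unfolding inv_lin_mult by simp
  then have "fps_deriv inv_lin * (1 + fps_const c * fps_X) = - (fps_const c * inv_lin)"
    unfolding eq_neg_iff_add_eq_0 by (simp add: algebra_simps)
  from inv_lin_cancel[OF this] show ?thesis by (simp add: mult_ac)
qed

lemma deriv_mob: "fps_deriv mobius = inv_lin * inv_lin"
proof -
  have "fps_deriv mobius = inv_lin * 1 - fps_const c * fps_X * (inv_lin * inv_lin)" by (simp add: mobius_def deriv_geoc algebra_simps)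
  also have "\<dots> = inv_lin * ((1 + fps_const c * fps_X) * inv_lin) - fps_const c * fps_X * (inv_lin * inv_lin)" by (simp only: inv_lin_mult)
  also have "\<dots> = inv_lin * inv_lin" by (simp add: algebra_simps)
  finally show ?thesis .
qed

lemma shift_XD: "shift (fps_X * fps_deriv f) = fps_X * fps_deriv (f oo mobius)"
  unfolding shift_def by (simp add: fps_compose_mult_distrib fps_compose_deriv deriv_mob) (simp add: mobius_def mult_ac)

text \<open>In terms of \<open>z = c + 1/X\<close> the quadratic coefficient is \<open>- z (z - 1) X\<^sup>2\<close> and the linear one is
  \<open>(a z + b) X\<close>; for \<open>c = 0\<close> they are \<open>- (1 - X)\<close> and \<open>a + b X\<close>.\<close>

lemma shift_pde:
  fixes a b :: complex and E :: "complex fps"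
  defines "S \<equiv> shift E"
  shows "shift (fps_X * fps_deriv (- (1 - fps_X) * (E * E) + (fps_const a + fps_const b * fps_X) * E))
    = fps_X * fps_deriv (- ((1 + fps_const c * fps_X) * (1 + fps_const (c - 1) * fps_X)) * (S * S)
        + (fps_const a + fps_const (a * c + b) * fps_X) * S)"
proof -
  let ?u = "1 + fps_const c * fps_X"
  have ES: "E oo mobius = ?u * S" unfolding S_def shift_def mult.assoc[symmetric] inv_lin_mult by simp
  have um: "?u * mobius = fps_X" using inv_lin_mult by (simp add: mobius_def mult.left_commute)
  have "(- (1 - fps_X) * (E * E) + (fps_const a + fps_const b * fps_X) * E) oo mobius
    = - (1 - mobius) * ((?u * S) * (?u * S)) + (fps_const a + fps_const b * mobius) * (?u * S)"
    by (simp add: fps_compose_add_distrib fps_compose_sub_distrib fps_compose_uminus fps_compose_mult_distrib ES)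
  also have "\<dots> = - (?u - ?u * mobius) * ?u * (S * S) + (fps_const a * ?u + fps_const b * (?u * mobius)) * S"
    by (simp add: algebra_simps)
  also have "\<dots> = - ((?u - fps_X) * ?u) * (S * S) + (fps_const a * ?u + fps_const b * fps_X) * S"
    unfolding um by (simp only: mult_minus_left)
  also have "?u - fps_X = 1 + fps_const (c - 1) * fps_X"
    by (simp add: fps_const_sub[symmetric] algebra_simps del: fps_const_sub)
  also have "fps_const a * ?u + fps_const b * fps_X = fps_const a + fps_const (a * c + b) * fps_X"
    by (simp add: fps_const_add[symmetric] fps_const_mult[symmetric] algebra_simps del: fps_const_add fps_const_mult)
  finally show ?thesis unfolding shift_XD by (simp only: mult_ac)
qed

end

section \<open>Joint analyticity and the equation from a series\<close>

lemma local_solution: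
  fixes E :: "real \<Rightarrow> complex fps"
  assumes pde: "\<And>t. t > 0 \<Longrightarrow> fps_time_deriv E (fps_X * fps_deriv (A * (E t * E t) + B * E t)) t"
    and r: "r > 0" and K: "K > 0" and M: "M > 0"
    and A: "majorized A (fps_const M * geom r)" and B: "majorized B (fps_const M * geom r)"
    and E: "\<And>t. t > 0 \<Longrightarrow> majorized (E t) (fps_const K * geom r)"
    and y: "0 < y" "r * y < 1"
  obtains C L where "L > 0" "C \<ge> 0" "\<And>n k t. t > 0 \<Longrightarrow> norm (taylor_coeff A B (E t) n $ k) * y ^ k \<le> C * L ^ n"
    "\<And>k t t0. t > 0 \<Longrightarrow> t0 > 0 \<Longrightarrow> L * \<bar>t - t0\<bar> < 1 \<Longrightarrow>
       (\<lambda>n. taylor_coeff A B (E t0) n $ k * of_real (t - t0) ^ n) sums (E t $ k)"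
proof -
  define D where "D = 1 / (1 - r * y)"
  have D: "D > 0" using y by (simp add: D_def)
  define L where "L = 3 * M * (4 * K + 2) * D ^ 3"
  define C where "C = 2 * K * D"
  have L: "L > 0" and C: "C > 0" using M K D by (auto simp: L_def C_def)
  have bd: "norm (taylor_coeff A B (E t) n $ k) * y ^ k \<le> C * L ^ n" if t: "t > 0" for n k t
  proof -
    have "majorized (taylor_coeff A B (E t) n) (fps_const (majorant_coeff K M n) * geom r ^ (3 * n + 1))"
      by (rule taylor_coeff_majorized) (use r K M A B E t in auto)
    then have "norm (taylor_coeff A B (E t) n $ k) * y ^ k \<le> majorant_coeff K M n * geom r ^ (3 * n + 1) $ k * y ^ k"
      using y majorizedD by (intro mult_right_mono) fastforce+
    also have "\<dots> = majorant_coeff K M n * (geom r ^ (3 * n + 1) $ k * y ^ k)" by simp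
    also have "\<dots> \<le> (2 * K * (3 * M * (4 * K + 2)) ^ n) * D ^ (3 * n + 1)"
      unfolding D_def using r y K M
      by (intro mult_mono geom_power_bound majorant_coeff_bound mult_nonneg_nonneg geom_power_nonneg) auto
    also have "\<dots> = C * L ^ n" by (simp add: C_def L_def power_mult_distrib power_mult[symmetric] power_add mult_ac)
    finally show ?thesis .
  qed
  show ?thesis
  proof (rule that[OF L less_imp_le[OF C] bd])
    fix k t t0 assume t: "t > (0::real)" "t0 > 0" "L * \<bar>t - t0\<bar> < 1"
    have "(\<lambda>n. taylor_coeff A B (E t0) n $ k * of_real (t - t0) ^ n) sums (taylor_coeff A B (E t) 0 $ k)"
    proof (rule real_taylor_sums[where f = "\<lambda>n s. taylor_coeff A B (E s) n $ k" and L = L and C = "C / y ^ k"])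
      fix n and s :: real assume s: "s > 0"
      have n: "(of_nat (Suc n) :: complex fps) = fps_const (of_nat (Suc n))" by (simp only: fps_of_nat)
      show "((\<lambda>s. taylor_coeff A B (E s) n $ k) has_vector_derivative of_nat (Suc n) * taylor_coeff A B (E s) (Suc n) $ k) (at s)"
        using taylor_coeff_derivative[OF pde[OF s], of n] unfolding fps_time_deriv_def n fps_mult_left_const_nth by blast
      show "norm (taylor_coeff A B (E s) n $ k) \<le> C / y ^ k * L ^ n"
        using bd[OF s, of n k] y by (simp add: field_simps)
    qed (use t L in auto)
    then show "(\<lambda>n. taylor_coeff A B (E t0) n $ k * of_real (t - t0) ^ n) sums (E t $ k)" by simp
  qed
qed

lemma abs_summable_geometric2:
  fixes p q :: real
  assumes "0 \<le> p" "p < 1" "0 \<le> q" "q < 1"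
    and le: "\<And>n k. norm (f n k :: complex) \<le> C * p ^ n * q ^ k"
  shows "(\<lambda>(n,k). f n k) summable_on (UNIV :: (nat \<times> nat) set)"
proof (rule Infinite_Sum.abs_summable_summable, rule Infinite_Sum.abs_summable_on_comparison_test')
  have p: "((\<lambda>n. p ^ n) has_sum (1 / (1 - p))) UNIV" using assms by (intro sums_nonneg_imp_has_sum geometric_sums) auto
  have q: "((\<lambda>n. q ^ n) has_sum (1 / (1 - q))) UNIV" using assms by (intro sums_nonneg_imp_has_sum geometric_sums) auto
  have "(\<lambda>(n,k). p ^ n * q ^ k) summable_on (SIGMA n:(UNIV::nat set). (UNIV::nat set))"
  proof (rule summable_on_SigmaI)
    show "((\<lambda>k. (\<lambda>(n,k). p ^ n * q ^ k) (n, k)) has_sum (p ^ n * (1 / (1 - q)))) UNIV" for n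
      using has_sum_cmult_right[OF q, of "p ^ n"] by simp
    show "(\<lambda>n. p ^ n * (1 / (1 - q))) summable_on UNIV"
      using has_sum_cmult_left[OF p, of "1 / (1 - q)"] by (auto simp: summable_on_def)
  qed (use assms in auto)
  from summable_on_cmult_right[OF this, of C]
  show "(\<lambda>(n,k). C * p ^ n * q ^ k) summable_on (UNIV :: (nat \<times> nat) set)"
    by (simp add: case_prod_unfold mult.assoc)
  show "norm (case x of (n, k) \<Rightarrow> f n k) \<le> (case x of (n, k) \<Rightarrow> C * p ^ n * q ^ k)" for x
    using le by (cases x) simp
qed

lemma fps_conv_radius_bound:
  fixes f :: "complex fps"
  assumes y: "y > 0" and le: "\<And>k. norm (f $ k) * y ^ k \<le> C"
  shows "fps_conv_radius f \<ge> ereal y"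
  unfolding fps_conv_radius_def
proof (rule conv_radius_geI_ex')
  fix r assume r: "0 < r" "ereal r < ereal y"
  have "summable (\<lambda>k. C * (r / y) ^ k)" using r y by (intro summable_mult summable_geometric) auto
  then show "summable (\<lambda>k. f $ k * of_real r ^ k)"
  proof (rule summable_comparison_test'[where N = 0])
    fix k
    have "norm (f $ k * of_real r ^ k) = (norm (f $ k) * y ^ k) * (r / y) ^ k"
      using r y by (simp add: norm_mult norm_power power_divide)
    also have "\<dots> \<le> C * (r / y) ^ k" using r y le by (intro mult_right_mono) auto
    finally show "norm (f $ k * of_real r ^ k) \<le> C * (r / y) ^ k" .
  qed
qed

text \<open>Used in both directions of a double series, this exchanges the order of summation.\<close>

lemma has_sum_of_rows:
  fixes f :: "nat \<Rightarrow> nat \<Rightarrow> complex"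
  assumes s: "(\<lambda>(n,k). f n k) summable_on UNIV" and rows: "\<And>n. f n sums g n"
  shows "(g has_sum (infsum (\<lambda>(n,k). f n k) UNIV)) UNIV"
proof -
  have h: "((\<lambda>(n,k). f n k) has_sum (infsum (\<lambda>(n,k). f n k) UNIV)) (SIGMA n:UNIV. UNIV)"
    using s by simp
  show ?thesis
  proof (rule has_sum_SigmaD[OF h])
    fix n :: nat
    have "f n summable_on UNIV"
      using summable_on_SigmaD1[of f UNIV "\<lambda>_. UNIV" n] s by simp
    then have "(f n has_sum infsum (f n) UNIV) UNIV" by simp
    moreover have "infsum (f n) UNIV = g n" using has_sum_imp_sums[OF calculation] rows sums_unique2 by blast
    ultimately show "((\<lambda>k. (\<lambda>(n,k). f n k) (n, k)) has_sum g n) UNIV" by simp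
  qed
qed

definition conv_on :: "real \<Rightarrow> complex fps \<Rightarrow> bool" where
  "conv_on y f \<longleftrightarrow> ereal y \<le> fps_conv_radius f"

lemma conv_on_intros:
  "conv_on y (fps_const c)" "conv_on y fps_X" "conv_on y 1"
  "conv_on y f \<Longrightarrow> conv_on y g \<Longrightarrow> conv_on y (f + g)"
  "conv_on y f \<Longrightarrow> conv_on y g \<Longrightarrow> conv_on y (f * g)"
  "conv_on y f \<Longrightarrow> conv_on y (- f)"
  "conv_on y f \<Longrightarrow> conv_on y (fps_deriv f)"
  unfolding conv_on_def
  using fps_conv_radius_add[of f g] fps_conv_radius_mult[of f g] fps_conv_radius_deriv[of f]
  by (auto intro: order_trans[rotated])

lemma conv_onD: "conv_on y f \<Longrightarrow> norm z < y \<Longrightarrow> ereal (norm z) < fps_conv_radius f"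
  unfolding conv_on_def by (meson ereal_less(2) less_ereal.simps(1) less_le_trans)

lemma conv_on_eval:
  assumes "norm z < y"
  shows "conv_on y f \<Longrightarrow> conv_on y g \<Longrightarrow> eval_fps (f + g) z = eval_fps f z + eval_fps g z"
    and "conv_on y f \<Longrightarrow> conv_on y g \<Longrightarrow> eval_fps (f * g) z = eval_fps f z * eval_fps g z"
    and "conv_on y f \<Longrightarrow> eval_fps (- f) z = - eval_fps f z"
  using assms conv_onD by (auto intro!: eval_fps_add eval_fps_mult eval_fps_minus)

text \<open>The coefficients of the equation are polynomials of degree at most two, hence majorized by a multiple
  of any geometric series.\<close>

lemma majorized_poly2:
  fixes f :: "complex fps"
  assumes r: "r > 0" and z: "\<And>k. k > 2 \<Longrightarrow> f $ k = 0"
  shows "majorized f (fps_const (1 + norm (f $ 0) + norm (f $ 1) / r + norm (f $ 2) / r\<^sup>2) * geom r)"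
  unfolding majorized_def
proof
  fix k :: nat
  let ?M = "1 + norm (f $ 0) + norm (f $ 1) / r + norm (f $ 2) / r\<^sup>2"
  have pos: "norm (f $ 0) \<ge> 0" "norm (f $ 1) / r \<ge> 0" "norm (f $ 2) / r\<^sup>2 \<ge> 0" using r by auto
  consider "k = 0" | "k = 1" | "k = 2" | "k > 2" by linarith
  then have "norm (f $ k) \<le> ?M * r ^ k"
  proof cases
    case 1 then show ?thesis using pos by simp
  next
    case 2
    have "norm (f $ 1) = norm (f $ 1) / r * r" using r by simp
    also have "\<dots> \<le> ?M * r" using pos r by (intro mult_right_mono) linarith+
    finally show ?thesis using 2 by simp
  next
    case 3
    have "norm (f $ 2) = norm (f $ 2) / r\<^sup>2 * r\<^sup>2" using r by simp
    also have "\<dots> \<le> ?M * r\<^sup>2"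
    proof (rule mult_right_mono)
      show "norm (f $ 2) / r\<^sup>2 \<le> ?M" using pos by linarith
    qed simp
    finally show ?thesis using 3 by simp
  next
    case 4 
    have "0 \<le> ?M * r ^ k" using pos r by (intro mult_nonneg_nonneg) (linarith, simp)
    then show ?thesis using z[OF 4] by simp
  qed
  then show "norm (f $ k) \<le> (fps_const ?M * geom r) $ k" by simp
qed

lemma common_majorant:
  fixes f g :: "complex fps"
  assumes r: "r > 0" and f: "\<And>k. k > 2 \<Longrightarrow> f $ k = 0" and g: "\<And>k. k > 2 \<Longrightarrow> g $ k = 0"
  obtains M where "M > 0" "majorized f (fps_const M * geom r)" "majorized g (fps_const M * geom r)"
proof -
  let ?M = "\<lambda>f :: complex fps. 1 + norm (f $ 0) + norm (f $ 1) / r + norm (f $ 2) / r\<^sup>2"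
  have p: "?M h \<ge> 1" for h using r by simp
  show ?thesis
  proof (rule that[of "max (?M f) (?M g)"])
    show "max (?M f) (?M g) > 0" using p[of f] by linarith
    show "majorized f (fps_const (max (?M f) (?M g)) * geom r)"
      by (rule majorized_mono[OF majorized_poly2[OF r f]]) (use r in \<open>auto intro!: mult_right_mono\<close>)
    show "majorized g (fps_const (max (?M f) (?M g)) * geom r)"
      by (rule majorized_mono[OF majorized_poly2[OF r g]]) (use r in \<open>auto intro!: mult_right_mono\<close>)
  qed
qed

text \<open>Let \<open>q\<^sub>n(z) = \<zeta> Q\<^sub>n(\<zeta>)\<close> with \<open>\<zeta> = 1/(z - c)\<close>, where \<open>Q\<^sub>n\<close> is the \<open>n\<close>-th Taylor coefficient at time \<open>t0\<close>. These
  functions are holomorphic on a disc about \<open>z0\<close> and bounded there by a multiple of \<open>L\<^sup>n\<close>, so Cauchy's inequality gives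
  the double series for \<open>H(t, z)\<close>, the sum of \<open>q\<^sub>n(z) (t - t0)\<^sup>n\<close>. Its time derivative at \<open>t0\<close> is \<open>q\<^sub>1\<close>, and the recursion that
  defines \<open>Q\<^sub>1\<close> is the equation in the coordinate \<open>\<zeta>\<close>, since \<open>\<partial>\<^sub>z = - \<zeta>\<^sup>2 \<partial>\<^sub>\<zeta>\<close>.\<close>

lemma analytic_and_pde_at:
  fixes E :: "real \<Rightarrow> complex fps" and H :: "real \<Rightarrow> complex \<Rightarrow> complex" and a b c z0 :: complex and t0 :: real
  defines "A \<equiv> - ((1 + fps_const c * fps_X) * (1 + fps_const (c - 1) * fps_X))"
    and "B \<equiv> fps_const a + fps_const (a * c + b) * fps_X"
  assumes pde: "\<And>t. t > 0 \<Longrightarrow> fps_time_deriv E (fps_X * fps_deriv (A * (E t * E t) + B * E t)) t"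
    and r: "r > 0" and K: "K > 0" and E: "\<And>t. t > 0 \<Longrightarrow> majorized (E t) (fps_const K * geom r)"
    and H: "\<And>t z. t > 0 \<Longrightarrow> Im z > 0 \<Longrightarrow> r < cmod (z - c) \<Longrightarrow>
        (\<lambda>k. E t $ k * (1 / (z - c)) ^ Suc k) sums H t z"
    and t0: "t0 > 0" and z0: "Im z0 > 0" "r < cmod (z0 - c)"
  shows "jointly_analytic_at H t0 z0 \<and>
    ((\<lambda>s. H s z0) has_vector_derivative
       deriv (\<lambda>w. w * (w - 1) * (H t0 w)\<^sup>2 - (a * w + b) * H t0 w) z0) (at t0)"
proof -
  obtain M where M: "M > 0" "majorized A (fps_const M * geom r)" "majorized B (fps_const M * geom r)"
  proof (rule common_majorant[OF r])
    have A2: "A = - (1 + fps_const (c + (c - 1)) * fps_X + fps_const (c * (c - 1)) * fps_X ^ 2)"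
      by (simp add: A_def fps_const_add[symmetric] fps_const_mult[symmetric] fps_const_sub[symmetric] power2_eq_square algebra_simps
          del: fps_const_add fps_const_mult fps_const_sub)
    show "A $ k = 0" if "k > 2" for k using that by (simp add: A2 fps_X_power_nth)
    show "B $ k = 0" if "k > 2" for k using that by (simp add: B_def)
  qed
  define d where "d = cmod (z0 - c)"
  have d: "d > r" "d > 0" using z0 r by (auto simp: d_def)
  \<comment> \<open>the radius \<open>y\<close> lies strictly between \<open>|1/(z0 - c)|\<close> and the radius of convergence, which leaves room for
    the loss in \<open>local_solution\<close> and for a disc about \<open>z0\<close>\<close>
  obtain y where y: "1 / d < y" "y < 1 / r" using dense[of "1 / d" "1 / r"] d r by (auto simp: field_simps)
  have y0: "y > 0" using y(1) d by (smt (verit) divide_pos_pos)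
  have ry: "r * y < 1" using y(2) r by (simp add: field_simps)
  have yd: "1 / y < d" using y(1) y0 d by (simp add: field_simps)
  define R where "R = min (Im z0) (d - 1 / y) / 2"
  have R: "R > 0" "R < Im z0" "R < d - 1 / y" using z0 yd by (auto simp: R_def min_def)
  define y' where "y' = 1 / (d - R)"
  have dR: "d - R > 1 / y" using R by simp
  have dR0: "d - R > 0" using dR y0 by (smt (verit) divide_pos_pos)
  have y': "y' > 0" "y' < y" using dR dR0 y0 by (auto simp: y'_def field_simps)
  define \<zeta> where "\<zeta> z = 1 / (z - c)" for z
  have z_props: "Im z > 0" "r < cmod (z - c)" "cmod (\<zeta> z) \<le> y'" "z \<noteq> c" if "z \<in> cball z0 R" for z
  proof -
    have dz: "cmod (z - z0) \<le> R" using that by (simp add: dist_norm norm_minus_commute)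
    have "\<bar>Im (z - z0)\<bar> \<le> R" using abs_Im_le_cmod[of "z - z0"] dz by linarith
    then show "Im z > 0" using R by simp
    have "cmod (z0 - c) \<le> cmod (z - c) + cmod (z - z0)"
      using norm_triangle_ineq4[of "z - c" "z - z0"] by simp
    then have ge: "cmod (z - c) \<ge> d - R" using dz by (simp add: d_def)
    have "r < 1 / y" using y y0 r by (simp add: field_simps)
    then show "r < cmod (z - c)" using ge dR by linarith
    then show "z \<noteq> c" using r by auto
    show "cmod (\<zeta> z) \<le> y'" unfolding \<zeta>_def y'_def norm_divide norm_one
      using ge dR0 by (intro divide_left_mono mult_pos_pos) auto
  qed
  obtain C L where L: "L > 0" and C: "C \<ge> 0"
    and bd: "\<And>n k t. t > 0 \<Longrightarrow> norm (taylor_coeff A B (E t) n $ k) * y ^ k \<le> C * L ^ n"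
    and tay: "\<And>k t t0. t > 0 \<Longrightarrow> t0 > 0 \<Longrightarrow> L * \<bar>t - t0\<bar> < 1 \<Longrightarrow>
       (\<lambda>n. taylor_coeff A B (E t0) n $ k * of_real (t - t0) ^ n) sums (E t $ k)"
    by (rule local_solution[OF pde r K M E y0 ry]) (assumption | rule that)+
  define Q where "Q = taylor_coeff A B (E t0)"
  have Qbd: "norm (Q n $ k) * y ^ k \<le> C * L ^ n" for n k using bd[OF t0] by (simp add: Q_def)
  have Qconv: "conv_on y (Q n)" for n
    unfolding conv_on_def using fps_conv_radius_bound[OF y0 Qbd] .
  have \<zeta>y: "norm (\<zeta> z) < y" if "z \<in> cball z0 R" for z using z_props(3)[OF that] y' by linarith
  define qf where "qf n z = \<zeta> z * eval_fps (Q n) (\<zeta> z)" for n z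
  have qf_sums: "(\<lambda>k. Q n $ k * \<zeta> z ^ Suc k) sums qf n z" if z: "z \<in> cball z0 R" for n z
    using sums_mult[OF sums_eval_fps[OF conv_onD[OF Qconv[of n] \<zeta>y[OF z]]], of "\<zeta> z"]
    by (simp add: qf_def mult_ac)
  define q where "q = y' / y"
  have q: "0 \<le> q" "q < 1" using y' y0 by (auto simp: q_def)
  have Qz: "norm (Q n $ k * \<zeta> z ^ Suc k) \<le> C * L ^ n * y' * q ^ k" if z: "z \<in> cball z0 R" for n k z
  proof -
    have "norm (Q n $ k * \<zeta> z ^ Suc k) \<le> norm (Q n $ k) * y' ^ Suc k"
      unfolding norm_mult norm_power using z_props(3)[OF z] by (intro mult_left_mono power_mono) auto
    also have "\<dots> = (norm (Q n $ k) * y ^ k) * (y' * q ^ k)" using y0 by (simp add: q_def power_divide)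
    also have "\<dots> \<le> C * L ^ n * (y' * q ^ k)" using Qbd q y' by (intro mult_right_mono) auto
    finally show ?thesis by (simp add: mult_ac)
  qed
  define C2 where "C2 = C * y' / (1 - q)"
  have qf_bd: "norm (qf n z) \<le> C2 * L ^ n" if z: "z \<in> cball z0 R" for n z
  proof -
    have g: "(\<lambda>k. C * L ^ n * y' * q ^ k) sums (C * L ^ n * y' * (1 / (1 - q)))"
      using q by (intro sums_mult geometric_sums) auto
    have sn: "summable (\<lambda>k. norm (Q n $ k * \<zeta> z ^ Suc k))"
      by (rule summable_comparison_test'[OF sums_summable[OF g], of 0]) (use Qz[OF z] in auto)
    have "norm (qf n z) \<le> (\<Sum>k. norm (Q n $ k * \<zeta> z ^ Suc k))"
      unfolding sums_unique[OF qf_sums[OF z]] by (rule summable_norm[OF sn])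
    also have "\<dots> \<le> (\<Sum>k. C * L ^ n * y' * q ^ k)" by (rule suminf_le[OF Qz[OF z] sn sums_summable[OF g]])
    also have "\<dots> = C2 * L ^ n" unfolding sums_unique[OF g, symmetric] by (simp add: C2_def)
    finally show ?thesis .
  qed
  have qf_hol: "qf n holomorphic_on cball z0 R" for n
  proof -
    have \<zeta>h: "\<zeta> holomorphic_on cball z0 R" unfolding \<zeta>_def using z_props(4) by (intro holomorphic_intros) auto
    have "eval_fps (Q n) holomorphic_on ball 0 y"
      using conv_onD[OF Qconv] by (intro holomorphic_on_eval_fps) auto
    then have "eval_fps (Q n) \<circ> \<zeta> holomorphic_on cball z0 R"
      by (rule holomorphic_on_compose_gen[OF \<zeta>h]) (use \<zeta>y in auto)
    then have "(\<lambda>z. \<zeta> z * (eval_fps (Q n) \<circ> \<zeta>) z) holomorphic_on cball z0 R" by (intro holomorphic_intros \<zeta>h)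
    then show ?thesis by (simp add: qf_def[abs_def])
  qed
  define e where "e n j = (deriv ^^ j) (qf n) z0 / fact j" for n j
  have hb: "qf n holomorphic_on ball z0 R" for n using qf_hol holomorphic_on_subset ball_subset_cball by blast
  have e_bd: "norm (e n j) \<le> C2 * L ^ n / R ^ j" for n j
  proof -
    have "norm ((deriv ^^ j) (qf n) z0) \<le> fact j * (C2 * L ^ n) / R ^ j"
      by (rule Cauchy_inequality[OF hb holomorphic_on_imp_continuous_on[OF qf_hol] R(1)])
        (auto intro!: qf_bd simp: dist_norm)
    then show ?thesis by (simp add: e_def norm_divide field_simps)
  qed
  have e_sums: "(\<lambda>j. e n j * (z - z0) ^ j) sums qf n z" if "z \<in> ball z0 R" for n z
    unfolding e_def by (rule holomorphic_power_series[OF hb that])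
  have C2: "C2 \<ge> 0" using C y' q by (simp add: C2_def)
  define \<rho> where "\<rho> = min t0 (min (1 / (2 * L)) (R / 2))"
  have \<rho>: "\<rho> > 0" using t0 L R by (simp add: \<rho>_def)
  \<comment> \<open>resummation of the doubly indexed series in \<open>(t - t0, \<zeta>)\<close> by rows and by columns\<close>
  have rows: "((\<lambda>n. of_real (t - t0) ^ n * qf n z) has_sum H t z) UNIV"
    if t: "\<bar>t - t0\<bar> < \<rho>" and z: "z \<in> cball z0 R" for t z
  proof -
    have tp: "t > 0" using t by (auto simp: \<rho>_def)
    define p where "p = L * \<bar>t - t0\<bar>"
    have p: "0 \<le> p" "p < 1" using t L by (auto simp: p_def \<rho>_def field_simps)
    define f where "f n k = of_real (t - t0) ^ n * (Q n $ k * \<zeta> z ^ Suc k)" for n k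
    have fb: "norm (f n k) \<le> (C * y') * p ^ n * q ^ k" for n k
    proof -
      have "norm (f n k) = \<bar>t - t0\<bar> ^ n * norm (Q n $ k * \<zeta> z ^ Suc k)"
        unfolding f_def norm_mult norm_power norm_of_real ..
      also have "\<dots> \<le> \<bar>t - t0\<bar> ^ n * (C * L ^ n * y' * q ^ k)" by (intro mult_left_mono Qz z) auto
      finally show ?thesis by (simp add: p_def power_mult_distrib mult_ac)
    qed
    have s1: "(\<lambda>(n,k). f n k) summable_on UNIV" by (rule abs_summable_geometric2[OF p q fb])
    have s2: "(\<lambda>(k,n). f n k) summable_on UNIV"
      by (rule abs_summable_geometric2[OF q p, of _ "C * y'"]) (use fb in \<open>simp add: mult_ac\<close>)
    have r1: "((\<lambda>n. of_real (t - t0) ^ n * qf n z) has_sum (infsum (\<lambda>(n,k). f n k) UNIV)) UNIV"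
      by (rule has_sum_of_rows[OF s1]) (unfold f_def, intro sums_mult qf_sums z)
    have col: "(\<lambda>n. f n k) sums (E t $ k * \<zeta> z ^ Suc k)" for k
    proof -
      have "L * \<bar>t - t0\<bar> < 1" using p by (simp add: p_def)
      from sums_mult2[OF tay[OF tp t0 this, of k], of "\<zeta> z ^ Suc k"] show ?thesis by (simp add: f_def Q_def mult_ac)
    qed
    have r2: "((\<lambda>k. E t $ k * \<zeta> z ^ Suc k) has_sum (infsum (\<lambda>(k,n). f n k) UNIV)) UNIV"
      by (rule has_sum_of_rows[OF s2 col])
    have "((\<lambda>(n,k). f n k) has_sum (infsum (\<lambda>(n,k). f n k) UNIV)) (UNIV \<times> UNIV)" using s1 by simp
    from iffD1[OF has_sum_swap this] have "infsum (\<lambda>(k,n). f n k) UNIV = infsum (\<lambda>(n,k). f n k) UNIV"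
      by (intro infsumI) simp
    moreover have "(\<lambda>k. E t $ k * \<zeta> z ^ Suc k) sums H t z"
      using H[OF tp z_props(1,2)[OF z]] by (simp add: \<zeta>_def)
    ultimately have "infsum (\<lambda>(n,k). f n k) UNIV = H t z" using has_sum_imp_sums[OF r2] sums_unique2 by metis
    then show ?thesis using r1 by simp
  qed
  have joint: "jointly_analytic_at H t0 z0"
    unfolding jointly_analytic_at_def
  proof (intro exI[of _ \<rho>] exI[of _ e] conjI allI impI \<rho>)
    fix t z assume "\<bar>t - t0\<bar> < \<rho> \<and> cmod (z - z0) < \<rho>"
    then have t: "\<bar>t - t0\<bar> < \<rho>" and z: "cmod (z - z0) < R / 2" by (auto simp: \<rho>_def)
    have zb: "z \<in> ball z0 R" using z R by (simp add: dist_norm norm_minus_commute)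
    then have zc: "z \<in> cball z0 R" by simp
    define p where "p = L * \<bar>t - t0\<bar>"
    have p: "0 \<le> p" "p < 1" using t L by (auto simp: p_def \<rho>_def field_simps)
    define f where "f n j = of_real (t - t0) ^ n * (e n j * (z - z0) ^ j)" for n j
    have fb: "norm (f n j) \<le> C2 * p ^ n * (1 / 2) ^ j" for n j
    proof -
      have "norm (f n j) = \<bar>t - t0\<bar> ^ n * (norm (e n j) * cmod (z - z0) ^ j)"
        unfolding f_def norm_mult norm_power norm_of_real ..
      also have "\<dots> \<le> \<bar>t - t0\<bar> ^ n * ((C2 * L ^ n / R ^ j) * (R / 2) ^ j)"
        using z e_bd C2 L R by (intro mult_left_mono mult_mono power_mono) auto
      also have "\<dots> = C2 * p ^ n * (1 / 2) ^ j" using R by (simp add: p_def power_mult_distrib power_divide)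
      finally show ?thesis .
    qed
    have s: "(\<lambda>(n,j). f n j) summable_on UNIV" by (rule abs_summable_geometric2[OF p _ _ fb]) auto
    have "((\<lambda>n. of_real (t - t0) ^ n * qf n z) has_sum (infsum (\<lambda>(n,j). f n j) UNIV)) UNIV"
      by (rule has_sum_of_rows[OF s]) (unfold f_def, intro sums_mult e_sums zb)
    from has_sum_unique[OF this rows[OF t zc]] have "infsum (\<lambda>(n,j). f n j) UNIV = H t z" .
    then have "((\<lambda>(n,j). f n j) has_sum H t z) UNIV" using has_sum_infsum[OF s] by simp
    then show "((\<lambda>(j, k). e j k * of_real (t - t0) ^ j * (z - z0) ^ k) has_sum H t z) UNIV"
      by (simp add: f_def case_prod_unfold mult_ac)
  qed
  \<comment> \<open>the first Taylor coefficient in time\<close>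
  have z0c: "z0 \<in> cball z0 R" using R by simp
  define P where "P = Abs_fps (\<lambda>n. qf n z0)"
  have Pc: "fps_conv_radius P \<ge> ereal (1 / L)"
    by (rule fps_conv_radius_bound[of _ _ C2]) (use L qf_bd[OF z0c] in \<open>auto simp: P_def field_simps\<close>)
  have L1: "ereal (1 / L) > 0" using L by simp
  have "(eval_fps P has_field_derivative eval_fps (fps_deriv P) 0) (at 0)"
    by (rule has_field_derivative_eval_fps) (use less_le_trans[OF L1 Pc] in \<open>simp add: zero_ereal_def\<close>)
  then have "(eval_fps P has_field_derivative qf 1 z0) (at (of_real t0 - of_real t0))"
    by (simp add: eval_fps_at_0 P_def)
  moreover have "((\<lambda>w. w - of_real t0) has_field_derivative 1) (at (of_real t0 :: complex))"
    by (rule derivative_eq_intros refl)+ simp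
  ultimately have "((\<lambda>w. eval_fps P (w - of_real t0)) has_field_derivative qf 1 z0 * 1) (at (of_real t0))"
    by (rule DERIV_chain2)
  then have "((\<lambda>w. eval_fps P (w - of_real t0)) has_field_derivative qf 1 z0) (at (of_real t0))" by simp
  then have "((\<lambda>s. eval_fps P (of_real s - of_real t0)) has_vector_derivative qf 1 z0) (at t0)"
    by (rule has_vector_derivative_real_field)
  then have time: "((\<lambda>s. H s z0) has_vector_derivative qf 1 z0) (at t0)"
  proof (rule has_vector_derivative_transform_within_open)
    show "open (ball t0 \<rho>)" "t0 \<in> ball t0 \<rho>" using \<rho> by auto
    fix s assume "s \<in> ball t0 \<rho>"
    then have s: "\<bar>s - t0\<bar> < \<rho>" by (simp add: dist_real_def abs_minus_commute)
    have "(\<lambda>n. of_real (s - t0) ^ n * qf n z0) sums H s z0" by (rule has_sum_imp_sums[OF rows[OF s z0c]])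
    then show "eval_fps P (of_real s - of_real t0) = H s z0"
      by (simp add: eval_fps_def P_def sums_iff mult.commute)
  qed
  \<comment> \<open>the right-hand side of the equation in the coordinate \<open>\<zeta>\<close>\<close>
  define F where "F = A * (E t0 * E t0) + B * E t0"
  have Ec: "conv_on y (E t0)" using Qconv[of 0] by (simp add: Q_def)
  have Ac: "conv_on y A" "conv_on y B" unfolding A_def B_def by (intro conv_on_intros)+
  have Fc: "conv_on y F" unfolding F_def by (intro conv_on_intros Ec Ac)
  have rhs: "w * (w - 1) * (H t0 w)\<^sup>2 - (a * w + b) * H t0 w = - eval_fps F (\<zeta> w)" if w: "w \<in> cball z0 R" for w
  proof -
    have "(\<lambda>k. E t0 $ k * \<zeta> w ^ Suc k) sums H t0 w" using H[OF t0 z_props(1,2)[OF w]] by (simp add: \<zeta>_def)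
    then have Hw: "H t0 w = \<zeta> w * eval_fps (E t0) (\<zeta> w)"
      using qf_sums[OF w, of 0] by (simp add: qf_def Q_def sums_iff)
    have Ae: "eval_fps A (\<zeta> w) = - ((1 + c * \<zeta> w) * (1 + (c - 1) * \<zeta> w))"
      unfolding A_def by (simp add: conv_on_eval[OF \<zeta>y[OF w]] conv_on_intros)
    have Be: "eval_fps B (\<zeta> w) = a + (a * c + b) * \<zeta> w"
      unfolding B_def by (simp add: conv_on_eval[OF \<zeta>y[OF w]] conv_on_intros)
    have Fe: "eval_fps F (\<zeta> w) = eval_fps A (\<zeta> w) * (eval_fps (E t0) (\<zeta> w))\<^sup>2 + eval_fps B (\<zeta> w) * eval_fps (E t0) (\<zeta> w)"
      unfolding F_def by (simp add: conv_on_eval[OF \<zeta>y[OF w]] conv_on_intros Ec Ac power2_eq_square)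
    define x where "x = \<zeta> w"
    have wc: "w - c \<noteq> 0" using z_props(4)[OF w] by simp
    have wx: "w * x = 1 + c * x" unfolding x_def \<zeta>_def using wc by (simp add: field_simps)
    have wx1: "(w - 1) * x = 1 + (c - 1) * x" using wx by (simp add: algebra_simps)
    have "w * (w - 1) * (H t0 w)\<^sup>2 - (a * w + b) * H t0 w
       = (w * x) * ((w - 1) * x) * (eval_fps (E t0) x)\<^sup>2 - (a * (w * x) + b * x) * eval_fps (E t0) x"
      unfolding Hw x_def[symmetric] by (simp add: power2_eq_square algebra_simps)
    also have "\<dots> = - eval_fps F x" unfolding wx wx1 Fe[folded x_def] Ae[folded x_def] Be[folded x_def]
      by (simp add: algebra_simps)
    finally show ?thesis by (simp add: x_def)
  qed
  have z0ne: "z0 - c \<noteq> 0" using z_props(4)[OF z0c] by simp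
  have "((\<lambda>w. - eval_fps F (\<zeta> w)) has_field_derivative - (eval_fps (fps_deriv F) (\<zeta> z0) * - (\<zeta> z0)\<^sup>2)) (at z0)"
  proof -
    have "(\<zeta> has_field_derivative - (\<zeta> z0)\<^sup>2) (at z0)"
      unfolding \<zeta>_def using z0ne by (auto intro!: derivative_eq_intros simp: power2_eq_square field_simps)
    moreover have "(eval_fps F has_field_derivative eval_fps (fps_deriv F) (\<zeta> z0)) (at (\<zeta> z0))"
      by (rule has_field_derivative_eval_fps[OF conv_onD[OF Fc \<zeta>y[OF z0c]]])
    ultimately show ?thesis by (intro DERIV_minus DERIV_chain2)
  qed
  then have "((\<lambda>w. w * (w - 1) * (H t0 w)\<^sup>2 - (a * w + b) * H t0 w) has_field_derivative
      - (eval_fps (fps_deriv F) (\<zeta> z0) * - (\<zeta> z0)\<^sup>2)) (at z0)"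
    by (rule has_field_derivative_transform_within_open[of _ _ _ "ball z0 R"]) (use R rhs in auto)
  then have "deriv (\<lambda>w. w * (w - 1) * (H t0 w)\<^sup>2 - (a * w + b) * H t0 w) z0 = eval_fps (fps_deriv F) (\<zeta> z0) * (\<zeta> z0)\<^sup>2"
    by (simp add: DERIV_imp_deriv)
  also have "\<dots> = qf 1 z0"
  proof -
    have "Q 1 = fps_X * fps_deriv F" by (simp add: Q_def F_def)
    then show ?thesis unfolding qf_def
      using conv_on_eval(2)[OF \<zeta>y[OF z0c] conv_on_intros(2) conv_on_intros(7)[OF Fc]] by (simp add: power2_eq_square)
  qed
  finally show ?thesis using joint time by simp
qed

section \<open>Resolvents as moment series\<close>

lemma resolvent_expansion:
  fixes \<nu> :: "real measure" and c z :: complex and r :: real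
  assumes rd: "real_distribution \<nu>" and supp: "AE x in \<nu>. x \<in> {0..1}"
    and r: "\<And>x. x \<in> {0..1} \<Longrightarrow> cmod (of_real x - c) \<le> r" and z: "r < cmod (z - c)"
  shows "(\<lambda>k. (\<integral>x. (of_real x - c) ^ k \<partial>\<nu>) * (1 / (z - c)) ^ Suc k) sums (LINT x:{0..1}|\<nu>. 1 / (z - of_real x))"
proof -
  interpret real_distribution \<nu> by fact
  define \<zeta> where "\<zeta> = 1 / (z - c)"
  have r0: "r \<ge> 0" by (rule order_trans[OF norm_ge_zero r[of 0]]) simp
  have zc: "z \<noteq> c" using z r0 by auto
  have q: "r * cmod \<zeta> < 1" using z r0 by (simp add: \<zeta>_def norm_divide divide_less_eq)
  define f where "f k x = (of_real x - c) ^ k * \<zeta> ^ Suc k" for k and x :: real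
  have fm [measurable]: "f k \<in> borel_measurable \<nu>" for k unfolding f_def by measurable
  have fb: "cmod (f k x) \<le> cmod \<zeta> * (r * cmod \<zeta>) ^ k" if "x \<in> {0..1}" for k x
  proof -
    have "cmod (f k x) = cmod (of_real x - c) ^ k * (cmod \<zeta> ^ k * cmod \<zeta>)" by (simp add: f_def norm_mult norm_power)
    also have "\<dots> \<le> r ^ k * (cmod \<zeta> ^ k * cmod \<zeta>)" using r[OF that] by (intro mult_right_mono power_mono) auto
    finally show ?thesis by (simp add: power_mult_distrib mult_ac)
  qed
  have fi: "integrable \<nu> (f k)" for k
    by (rule integrable_const_bound[of _ "cmod \<zeta> * (r * cmod \<zeta>) ^ k"]) (use supp fb in auto)
  have geom: "summable (\<lambda>k. cmod \<zeta> * (r * cmod \<zeta>) ^ k)" using q r0 by (intro summable_mult summable_geometric) auto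
  have sn: "summable (\<lambda>k. norm (f k x))" if "x \<in> {0..1}" for x
    by (rule summable_comparison_test'[OF geom, of 0]) (use fb[OF that] in auto)
  have int_le: "(\<integral>x. norm (f k x) \<partial>\<nu>) \<le> cmod \<zeta> * (r * cmod \<zeta>) ^ k" for k
  proof -
    have "(\<integral>x. norm (f k x) \<partial>\<nu>) \<le> (\<integral>x. cmod \<zeta> * (r * cmod \<zeta>) ^ k \<partial>\<nu>)"
      by (rule integral_mono_AE) (use supp fb fi in auto)
    then show ?thesis using prob_space by simp
  qed
  have "(\<lambda>k. integral\<^sup>L \<nu> (f k)) sums (\<integral>x. (\<Sum>k. f k x) \<partial>\<nu>)"
  proof (rule sums_integral)
    show "AE x in \<nu>. summable (\<lambda>k. norm (f k x))" using supp by eventually_elim (rule sn)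
    show "summable (\<lambda>k. \<integral>x. norm (f k x) \<partial>\<nu>)"
      by (rule summable_comparison_test'[OF geom, of 0]) (use int_le in \<open>auto intro!: order_trans[OF _ int_le] integral_nonneg_AE\<close>)
  qed (rule fi)
  also have "(\<integral>x. (\<Sum>k. f k x) \<partial>\<nu>) = (LINT x:{0..1}|\<nu>. 1 / (z - of_real x))"
    unfolding set_lebesgue_integral_def
  proof (rule integral_cong_AE)
    show "AE x in \<nu>. (\<Sum>k. f k x) = indicat_real {0..1} x *\<^sub>R (1 / (z - of_real x))"
      using supp
    proof eventually_elim
      case (elim x)
      define w where "w = (of_real x - c) * \<zeta>"
      have "cmod w \<le> r * cmod \<zeta>" unfolding w_def norm_mult using r[OF elim] by (intro mult_right_mono) auto
      then have w: "cmod w < 1" using q by linarith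
      have "(\<lambda>k. \<zeta> * w ^ k) sums (\<zeta> * (1 / (1 - w)))" by (intro sums_mult geometric_sums w)
      then have "(\<Sum>k. f k x) = \<zeta> * (1 / (1 - w))" by (simp add: f_def w_def power_mult_distrib mult_ac sums_iff)
      also have "\<dots> = 1 / (z - of_real x)"
      proof -
        have "1 - w = (z - of_real x) * \<zeta>" using zc by (simp add: w_def \<zeta>_def field_simps)
        then show ?thesis using zc by (simp add: \<zeta>_def)
      qed
      finally show ?case using elim by simp
    qed
  qed measurable
  also have "(\<lambda>k. integral\<^sup>L \<nu> (f k)) = (\<lambda>k. (\<integral>x. (of_real x - c) ^ k \<partial>\<nu>) * (1 / (z - c)) ^ Suc k)"
    unfolding f_def \<zeta>_def by simp
  finally show ?thesis .
qed

text \<open>The moments of the signed measure \<open>\<nu> - (1 - g) \<delta>\<^sub>0\<close>: the point mass changes the zeroth moment from \<open>1\<close> to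
  \<open>g\<close> and the resolvent by \<open>(1 - g)/z\<close>.\<close>

definition moment_fps :: "real \<Rightarrow> real measure \<Rightarrow> complex fps" where
  "moment_fps g \<nu> = Abs_fps (\<lambda>n. of_real (\<integral>x. x ^ n \<partial>\<nu>) - of_real (1 - g) * 0 ^ n)"

lemma shift_moment_fps:
  assumes rd: "real_distribution \<nu>" and int: "\<And>n. integrable \<nu> (\<lambda>x. x ^ n)"
  shows "shift c (moment_fps g \<nu>) $ n = (\<integral>x. (of_real x - c) ^ n \<partial>\<nu>) - of_real (1 - g) * (- c) ^ n"
proof -
  have inc: "integrable \<nu> (\<lambda>x. (of_real x :: complex) ^ i)" for i
    using integrable_of_real[OF int[of i], where 'a = complex] by simp
  have mom: "of_real (\<integral>x. x ^ i \<partial>\<nu>) = (\<integral>x. (of_real x :: complex) ^ i \<partial>\<nu>)" for i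
    using integral_of_real[of \<nu> "\<lambda>x. x ^ i", where 'a = complex] int[of i] by (simp add: integral_complex_of_real)
  have b: "(x - c) ^ n = (\<Sum>i\<le>n. of_nat (n choose i) * (- c) ^ (n - i) * x ^ i)" for x
    using binomial_ring[of x "- c" n] by (simp add: mult_ac)
  have "(\<integral>x. (of_real x - c) ^ n \<partial>\<nu>) = (\<Sum>i\<le>n. of_nat (n choose i) * (- c) ^ (n - i) * (\<integral>x. (of_real x :: complex) ^ i \<partial>\<nu>))"
    unfolding b using inc by (subst Bochner_Integration.integral_sum) auto
  moreover have "(\<Sum>i\<le>n. of_nat (n choose i) * (- c) ^ (n - i) * (of_real (1 - g) * 0 ^ i)) = of_real (1 - g) * (- c) ^ n"
  proof -
    have "of_real (1 - g) * (- c) ^ n = of_real (1 - g) * (\<Sum>i\<le>n. of_nat (n choose i) * (- c) ^ (n - i) * 0 ^ i)"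
      using b[of 0] by simp
    then show ?thesis by (simp only: sum_distrib_left mult_ac)
  qed
  ultimately show ?thesis
    unfolding shift_nth moment_fps_def fps_nth_Abs_fps right_diff_distrib sum_subtractf mom by (simp only:)
qed

text \<open>The centre is \<open>c = - i Y\<close> with \<open>2 Y Im z0 = 1\<close>, so that
  \<open>|z0 - c|\<^sup>2 = |z0|\<^sup>2 + 1 + Y\<^sup>2 > 1 + Y\<^sup>2 = r\<^sup>2\<close>, while \<open>|x - c| \<le> r\<close> for \<open>x\<close> in \<open>[0, 1]\<close>.\<close>

lemma moment_family_analytic_pde:
  fixes \<mu> :: "real \<Rightarrow> real measure" and a b g :: real and H :: "real \<Rightarrow> complex \<Rightarrow> complex"
  assumes rd: "\<And>t. t > 0 \<Longrightarrow> real_distribution (\<mu> t)" and supp: "\<And>t. t > 0 \<Longrightarrow> AE x in \<mu> t. x \<in> {0..1}"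
    and int: "\<And>t n. t > 0 \<Longrightarrow> integrable (\<mu> t) (\<lambda>x. x ^ n)"
    and pde: "\<And>t. t > 0 \<Longrightarrow> fps_time_deriv (\<lambda>s. moment_fps g (\<mu> s)) (fps_X * fps_deriv
        (- (1 - fps_X) * (moment_fps g (\<mu> t) * moment_fps g (\<mu> t)) + (fps_const (of_real a) + fps_const (of_real b) * fps_X) * moment_fps g (\<mu> t))) t"
    and H: "\<And>t z. t > 0 \<Longrightarrow> Im z > 0 \<Longrightarrow> H t z = (LINT x:{0..1}|\<mu> t. 1 / (z - of_real x)) - of_real (1 - g) / z"
    and t0: "t0 > 0" and z0: "Im z0 > 0"
  shows "jointly_analytic_at H t0 z0 \<and>
    ((\<lambda>s. H s z0) has_vector_derivative
       deriv (\<lambda>w. w * (w - 1) * (H t0 w)\<^sup>2 - (of_real a * w + of_real b) * H t0 w) z0) (at t0)"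
proof -
  define Y where "Y = 1 / (2 * Im z0)"
  have Y: "Y > 0" "2 * Y * Im z0 = 1" using z0 by (auto simp: Y_def)
  define c where "c = - \<i> * of_real Y"
  define r where "r = sqrt (1 + Y\<^sup>2)"
  have r: "r > 0" by (simp add: r_def add_pos_nonneg)
  have xr: "cmod (of_real x - c) \<le> r" if "x \<in> {0..1}" for x
  proof -
    have "x\<^sup>2 \<le> 1" using that by (simp add: power_le_one)
    then show ?thesis by (simp add: cmod_def c_def r_def)
  qed
  have cr: "cmod c \<le> r" using xr[of 0] by simp
  have zr: "r < cmod (z0 - c)"
  proof -
    have "1 + Y\<^sup>2 < (Re z0)\<^sup>2 + (Im z0 + Y)\<^sup>2"
      using Y z0 by (simp add: power2_sum mult_ac add_nonneg_pos)
    then show ?thesis by (simp add: cmod_def c_def r_def)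
  qed
  define S where "S t = shift c (moment_fps g (\<mu> t))" for t
  have Sn: "S t $ n = (\<integral>x. (of_real x - c) ^ n \<partial>\<mu> t) - of_real (1 - g) * (- c) ^ n" if "t > 0" for t n
    unfolding S_def using that by (intro shift_moment_fps rd int) 
  show ?thesis
  proof (rule analytic_and_pde_at[where E = S and c = c and r = r and K = "1 + \<bar>1 - g\<bar>"])
    fix t :: real assume t: "t > 0"
    interpret real_distribution "\<mu> t" using t by (rule rd)
    show "fps_time_deriv S (fps_X * fps_deriv (- ((1 + fps_const c * fps_X) * (1 + fps_const (c - 1) * fps_X)) * (S t * S t) +
        (fps_const (of_real a) + fps_const (of_real a * c + of_real b) * fps_X) * S t)) t"
      using shift_time_deriv[OF pde[OF t], of c] unfolding shift_pde S_def[abs_def] .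
    show "majorized (S t) (fps_const (1 + \<bar>1 - g\<bar>) * geom r)"
      unfolding majorized_def
    proof
      fix n
      have "norm (\<integral>x. (of_real x - c) ^ n \<partial>\<mu> t) \<le> (\<integral>x. norm ((of_real x - c) ^ n) \<partial>\<mu> t)"
        by (rule integral_norm_bound)
      also have "\<dots> \<le> (\<integral>x. r ^ n \<partial>\<mu> t)"
      proof (rule integral_mono_AE')
        show "AE x in \<mu> t. norm ((of_real x - c) ^ n) \<le> r ^ n"
          using supp[OF t] by eventually_elim (auto simp: norm_power intro!: power_mono xr)
      qed (use r in auto)
      also have "\<dots> = r ^ n" using prob_space by simp
      finally have 1: "norm (\<integral>x. (of_real x - c) ^ n \<partial>\<mu> t) \<le> r ^ n" .
      have 2: "norm (of_real (1 - g) * (- c) ^ n) \<le> \<bar>1 - g\<bar> * r ^ n"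
        unfolding norm_mult norm_power norm_of_real norm_minus_cancel using cr by (intro mult_left_mono power_mono) auto
      have "norm (S t $ n) \<le> r ^ n + \<bar>1 - g\<bar> * r ^ n"
        unfolding Sn[OF t] using norm_triangle_ineq4 add_mono[OF 1 2] order_trans by blast
      then show "norm (S t $ n) \<le> (fps_const (1 + \<bar>1 - g\<bar>) * geom r) $ n" by (simp add: distrib_right)
    qed
    fix z :: complex assume z: "Im z > 0" "r < cmod (z - c)"
    have zc: "z \<noteq> c" "z \<noteq> 0" using z r by auto
    define \<zeta> where "\<zeta> = 1 / (z - c)"
    have A: "(\<lambda>k. (\<integral>x. (of_real x - c) ^ k \<partial>\<mu> t) * \<zeta> ^ Suc k) sums (LINT x:{0..1}|\<mu> t. 1 / (z - of_real x))"
      unfolding \<zeta>_def by (rule resolvent_expansion[OF rd[OF t] supp[OF t] xr z(2)])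
    have "cmod (- c * \<zeta>) < 1" using cr z(2) r by (simp add: \<zeta>_def norm_mult norm_divide divide_less_eq)
    then have "(\<lambda>k. (of_real (1 - g) * \<zeta>) * (- c * \<zeta>) ^ k) sums ((of_real (1 - g) * \<zeta>) * (1 / (1 - (- c * \<zeta>))))"
      by (intro sums_mult geometric_sums)
    also have "(of_real (1 - g) * \<zeta>) * (1 / (1 - (- c * \<zeta>))) = of_real (1 - g) / z"
    proof -
      have "1 - (- c * \<zeta>) = z * \<zeta>" using zc by (simp add: \<zeta>_def field_simps)
      then show ?thesis using zc by (simp add: \<zeta>_def)
    qed
    also have "(\<lambda>k. (of_real (1 - g) * \<zeta>) * (- c * \<zeta>) ^ k) = (\<lambda>k. of_real (1 - g) * (- c) ^ k * \<zeta> ^ Suc k)"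
      by (rule ext) (simp only: power_mult_distrib power_Suc mult_ac)
    finally have B: "(\<lambda>k. of_real (1 - g) * (- c) ^ k * \<zeta> ^ Suc k) sums (of_real (1 - g) / z)" .
    from sums_diff[OF A B] show "(\<lambda>k. S t $ k * (1 / (z - c)) ^ Suc k) sums H t z"
      unfolding H[OF t z(1)] Sn[OF t] \<zeta>_def left_diff_distrib .
  qed (use t0 z0 zr r in auto)
qed

section \<open>The moment equations as an equation for a power series\<close>

lemma triangle_sum: "(\<Sum>j<n. \<Sum>i<n - 1 - j. f i) = (\<Sum>i<n - 1. of_nat (n - 1 - i) * (f i :: complex))"
proof (induction n)
  case (Suc n)
  have "(\<Sum>j<Suc n. \<Sum>i<Suc n - 1 - j. f i) = (\<Sum>i<n. f i) + (\<Sum>j<n. \<Sum>i<n - 1 - j. f i)"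
    by (subst sum.lessThan_Suc_shift) simp
  also have "\<dots> = (\<Sum>i<n. f i) + (\<Sum>i<n - 1. of_nat (n - 1 - i) * f i)" by (simp only: Suc)
  also have "(\<Sum>i<n - 1. of_nat (n - 1 - i) * f i) = (\<Sum>i<n. of_nat (n - 1 - i) * f i)"
    by (cases n) simp_all
  also have "(\<Sum>i<n. f i) + \<dots> = (\<Sum>i<n. of_nat (n - i) * f i)"
    unfolding sum.distrib[symmetric]
  proof (rule sum.cong[OF refl])
    fix i assume "i \<in> {..<n}"
    then have "n - i = Suc (n - 1 - i)" by auto
    then show "f i + of_nat (n - 1 - i) * f i = of_nat (n - i) * f i" by (simp add: algebra_simps)
  qed
  finally show ?case by simp
qed simp

text \<open>Average over \<open>i\<close> and \<open>N - 1 - i\<close>: the two weights add up to \<open>N + 1\<close>.\<close>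

lemma symmetric_weight_sum:
  fixes f :: "nat \<Rightarrow> complex"
  assumes sym: "\<And>i. i < N \<Longrightarrow> f (N - 1 - i) = f i"
  shows "(\<Sum>i<N. of_nat (N - i) * f i) = of_nat (Suc N) / 2 * (\<Sum>i<N. f i)"
proof -
  have "(\<Sum>i<N. of_nat (N - i) * f i) = (\<Sum>i<N. of_nat (N - (N - Suc i)) * f (N - Suc i))"
    by (rule sum.nat_diff_reindex[symmetric])
  also have "\<dots> = (\<Sum>i<N. of_nat (Suc i) * f i)" using sym by (intro sum.cong) auto
  finally have eq: "(\<Sum>i<N. of_nat (N - i) * f i) = (\<Sum>i<N. of_nat (Suc i) * f i)" .
  have "2 * (\<Sum>i<N. of_nat (N - i) * f i) = (\<Sum>i<N. of_nat (N - i) * f i) + (\<Sum>i<N. of_nat (Suc i) * f i)"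
    by (simp only: eq[symmetric] mult_2)
  also have "\<dots> = (\<Sum>i<N. of_nat (Suc N) * f i)"
    unfolding sum.distrib[symmetric]
  proof (rule sum.cong[OF refl])
    fix i assume "i \<in> {..<N}"
    then have "N - i + Suc i = Suc N" by auto
    then show "of_nat (N - i) * f i + of_nat (Suc i) * f i = of_nat (Suc N) * f i"
      by (simp only: distrib_right[symmetric] of_nat_add[symmetric])
  qed
  also have "\<dots> = of_nat (Suc N) * (\<Sum>i<N. f i)" by (simp only: sum_distrib_left)
  finally have "2 * (\<Sum>i<N. of_nat (N - i) * f i) / 2 = of_nat (Suc N) * (\<Sum>i<N. f i) / 2" by (simp only:)
  then show ?thesis by simp
qed

text \<open>The moment equations involve \<open>\<tau>(p)\<close>, \<open>\<tau>(q)\<close> and the boundary value \<open>G\<^sub>0 = \<tau>(q)\<close>, the equation for \<open>E\<close> involves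
  \<open>g = min \<alpha> \<beta>\<close> and \<open>b = |\<alpha> - \<beta>|\<close>. Only the sum and the product of \<open>\<alpha>\<close> and \<open>\<beta>\<close> enter, and these are those of
  \<open>g\<close> and \<open>g + b\<close>.\<close>

lemma rate_identity:
  fixes e G :: "nat \<Rightarrow> complex" and \<alpha> \<beta> g b :: complex
  assumes G0: "G 0 = \<beta>" and GS: "\<And>m. G (Suc m) = e (Suc m)" and e0: "e 0 = g"
    and pr: "\<alpha> * \<beta> = g * (g + b)" and sm: "\<alpha> + \<beta> = 2 * g + b"
  shows "(\<Sum>j<Suc N. \<alpha> * G N - e (Suc N)) +
     (\<Sum>j<Suc N. \<Sum>i<N - j. G (N - 1 - i) * e (Suc i) + e (Suc (N - 1 - i)) * G i - 2 * (e (Suc (N - 1 - i)) * e (Suc i)))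
   = of_nat (Suc N) * (- (\<Sum>i\<le>Suc N. e i * e (Suc N - i)) + (\<Sum>i\<le>N. e i * e (N - i)) + (2 * g - 1) * e (Suc N) + b * e N)"
proof -
  define f where "f i = G (N - 1 - i) * e (Suc i) + e (Suc (N - 1 - i)) * G i - 2 * (e (Suc (N - 1 - i)) * e (Suc i))" for i
  define U where "U = (\<Sum>i<N. G (N - 1 - i) * e (Suc i))"
  define V where "V = (\<Sum>i<N. e (N - i) * e (Suc i))"
  have "(\<Sum>j<Suc N. \<Sum>i<N - j. f i) = (\<Sum>i<N. of_nat (N - i) * f i)" using triangle_sum[of f "Suc N"] by simp
  also have "\<dots> = of_nat (Suc N) / 2 * (\<Sum>i<N. f i)"
    by (rule symmetric_weight_sum) (auto simp: f_def mult_ac)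
  also have "(\<Sum>i<N. f i) = 2 * U - 2 * V"
  proof -
    have 1: "(\<Sum>i<N. e (Suc (N - 1 - i)) * G i) = U"
      unfolding U_def by (subst sum.nat_diff_reindex[symmetric]) (auto intro!: sum.cong simp: mult_ac)
    have 2: "(\<Sum>i<N. 2 * (e (Suc (N - 1 - i)) * e (Suc i))) = 2 * V"
      unfolding V_def sum_distrib_left by (intro sum.cong refl) (auto simp: Suc_diff_Suc)
    show ?thesis unfolding f_def sum_subtractf sum.distrib 1 2 U_def[symmetric] by simp
  qed
  also have "of_nat (Suc N) / 2 * (2 * U - 2 * V) = of_nat (Suc N) * (U - V)" by (simp add: field_simps)
  finally have F: "(\<Sum>j<Suc N. \<Sum>i<N - j. f i) = of_nat (Suc N) * (U - V)" .
  have big: "(\<Sum>i\<le>Suc N. e i * e (Suc N - i)) = 2 * g * e (Suc N) + V"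
  proof -
    have "(\<Sum>i\<le>Suc N. e i * e (Suc N - i)) = e 0 * e (Suc N) + (\<Sum>i\<le>N. e (Suc i) * e (N - i))"
      by (subst sum.atMost_Suc_shift) simp
    also have "(\<Sum>i\<le>N. e (Suc i) * e (N - i)) = V + e (Suc N) * e 0"
      unfolding V_def lessThan_Suc_atMost[symmetric] by (simp add: mult.commute)
    finally show ?thesis by (simp add: e0 algebra_simps)
  qed
  have key: "\<alpha> * G N + U = (\<Sum>i\<le>N. e i * e (N - i)) + b * e N"
  proof (cases N)
    case 0
    then show ?thesis using pr by (simp add: U_def G0 e0 algebra_simps)
  next
    case (Suc P)
    define W where "W = (\<Sum>i<P. e (Suc i) * e (P - i))"
    have "U = (\<Sum>i<P. G (P - i) * e (Suc i)) + G 0 * e (Suc P)" unfolding U_def Suc by simp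
    also have "(\<Sum>i<P. G (P - i) * e (Suc i)) = W"
      unfolding W_def
    proof (rule sum.cong[OF refl])
      fix i assume "i \<in> {..<P}"
      then have "P - i = Suc (P - Suc i)" by auto
      then show "G (P - i) * e (Suc i) = e (Suc i) * e (P - i)" by (simp only: GS mult.commute)
    qed
    finally have U: "U = W + \<beta> * e N" by (simp add: G0 Suc)
    have "(\<Sum>i\<le>Suc P. e i * e (Suc P - i)) = e 0 * e (Suc P) + (\<Sum>i\<le>P. e (Suc i) * e (P - i))"
      by (subst sum.atMost_Suc_shift) simp
    also have "(\<Sum>i\<le>P. e (Suc i) * e (P - i)) = W + e (Suc P) * e 0"
      unfolding W_def lessThan_Suc_atMost[symmetric] by simp
    finally have "(\<Sum>i\<le>N. e i * e (N - i)) = W + 2 * g * e N" by (simp add: e0 Suc algebra_simps)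
    moreover have "\<alpha> * G N + U = W + (\<alpha> + \<beta>) * e N" unfolding U by (simp add: Suc GS algebra_simps)
    ultimately show ?thesis unfolding sm by (simp add: algebra_simps)
  qed
  have "(\<Sum>j<Suc N. \<alpha> * G N - e (Suc N)) + (\<Sum>j<Suc N. \<Sum>i<N - j. f i)
     = of_nat (Suc N) * ((\<alpha> * G N + U) - e (Suc N) - V)" unfolding F by (simp add: algebra_simps)
  also have "\<dots> = of_nat (Suc N) * (- (\<Sum>i\<le>Suc N. e i * e (Suc N - i)) + (\<Sum>i\<le>N. e i * e (N - i)) + (2 * g - 1) * e (Suc N) + b * e N)"
    unfolding key big by (simp add: algebra_simps)
  finally show ?thesis unfolding f_def .
qed

context free_liberation begin

section \<open>Liberation of two projections\<close>

lemma moment_fps_pde: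
  fixes \<mu> :: "real \<Rightarrow> real measure" and \<alpha> \<beta> :: real
  assumes \<alpha>: "\<tau> p = of_real \<alpha>" and \<beta>: "\<tau> q = of_real \<beta>"
    and sp: "\<And>t. t > 0 \<Longrightarrow> spectral_measure \<tau> (Q t) (\<mu> t)" and t: "t > 0"
  defines "ms \<equiv> \<lambda>t. moment_fps (min \<alpha> \<beta>) (\<mu> t)"
  shows "fps_time_deriv ms (fps_X * fps_deriv (- (1 - fps_X) * (ms t * ms t) +
    (fps_const (of_real (2 * min \<alpha> \<beta> - 1)) + fps_const (of_real \<bar>\<alpha> - \<beta>\<bar>) * fps_X) * ms t)) t"
proof -
  define g where "g = min \<alpha> \<beta>"
  define e where "e t n = (if n = 0 then of_real g else \<tau> (X t ^ n))" for t n
  have ms_e: "ms s $ n = e s n" if s: "s > 0" for s n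
  proof (cases n)
    case 0
    interpret real_distribution "\<mu> s" using sp[OF s] by (simp add: spectral_measure_def)
    have "measure (\<mu> s) UNIV = 1" using prob_space by simp
    then show ?thesis using 0 by (simp add: ms_def e_def moment_fps_def g_def)
  next
    case (Suc m)
    have "of_real (\<integral>x. x ^ n \<partial>\<mu> s) = \<tau> (Q s ^ n)" using sp[OF s] unfolding spectral_measure_def by simp
    also have "\<dots> = \<tau> (X s ^ n)" using moment_Q[of s m] s Suc by simp
    finally show ?thesis using Suc by (simp add: ms_def e_def moment_fps_def)
  qed
  have ev: "((\<lambda>s. e s n) has_vector_derivative D) (at t) \<Longrightarrow> ((\<lambda>s. ms s $ n) has_vector_derivative D) (at t)" for n D
    by (rule has_vector_derivative_transform_within_open[of _ _ _ "{0<..}"]) (use t ms_e in auto)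
  show ?thesis
    unfolding fps_time_deriv_def
  proof
    fix n
    show "((\<lambda>s. ms s $ n) has_vector_derivative (fps_X * fps_deriv (- (1 - fps_X) * (ms t * ms t) +
      (fps_const (of_real (2 * min \<alpha> \<beta> - 1)) + fps_const (of_real \<bar>\<alpha> - \<beta>\<bar>) * fps_X) * ms t)) $ n) (at t)"
    proof (cases n)
      case 0
      then show ?thesis by (intro ev) (simp add: e_def)
    next
      case (Suc N)
      have t0: "0 \<le> t" using t by simp
      have rate: "(\<Sum>j<n. linear_rate t (n - 1)) + (\<Sum>j<n. \<Sum>i<n - 1 - j. pair_rate t (n - 2 - i) i)
        = of_nat (Suc N) * (- (\<Sum>i\<le>Suc N. e t i * e t (Suc N - i)) + (\<Sum>i\<le>N. e t i * e t (N - i))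
            + (2 * of_real g - 1) * e t (Suc N) + of_real \<bar>\<alpha> - \<beta>\<bar> * e t N)"
      proof (subst rate_identity[symmetric])
        show "G t 0 = of_real \<beta>" "\<And>m. G t (Suc m) = e t (Suc m)" "e t 0 = of_real g"
          using G_0[OF t0] G_Suc[OF t0] \<beta> by (auto simp: e_def)
        show "of_real \<alpha> * of_real \<beta> = (of_real g * (of_real g + of_real \<bar>\<alpha> - \<beta>\<bar>) :: complex)"
          unfolding of_real_mult[symmetric] of_real_add[symmetric] of_real_eq_iff
          by (auto simp: g_def min_def abs_if algebra_simps)
        show "of_real \<alpha> + of_real \<beta> = (2 * of_real g + of_real \<bar>\<alpha> - \<beta>\<bar> :: complex)"
        proof -
          have "\<alpha> + \<beta> = 2 * g + \<bar>\<alpha> - \<beta>\<bar>" by (auto simp: g_def min_def abs_if)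
          then show ?thesis by (metis of_real_add of_real_mult of_real_numeral)
        qed
        have \<gamma>e: "\<gamma> t m = e t (Suc m)" for m using \<gamma>_eq[OF t0] by (simp add: e_def)
        show "(\<Sum>j<n. linear_rate t (n - 1)) + (\<Sum>j<n. \<Sum>i<n - 1 - j. pair_rate t (n - 2 - i) i) =
          (\<Sum>j<Suc N. of_real \<alpha> * G t N - e t (Suc N)) +
          (\<Sum>j<Suc N. \<Sum>i<N - j. G t (N - 1 - i) * e t (Suc i) + e t (Suc (N - 1 - i)) * G t i
             - 2 * (e t (Suc (N - 1 - i)) * e t (Suc i)))"
          unfolding linear_rate_def pair_rate_def \<gamma>e \<alpha> Suc by simp
      qed
      have nth: "(- (1 - fps_X) * (ms t * ms t) +
        (fps_const (of_real (2 * min \<alpha> \<beta> - 1)) + fps_const (of_real \<bar>\<alpha> - \<beta>\<bar>) * fps_X) * ms t) $ Suc N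
        = - ((ms t * ms t) $ Suc N) + (ms t * ms t) $ N + of_real (2 * g - 1) * ms t $ Suc N + of_real \<bar>\<alpha> - \<beta>\<bar> * ms t $ N"
      proof -
        have "- (1 - fps_X) * (ms t * ms t) + (fps_const (of_real (2 * g - 1)) + fps_const (of_real \<bar>\<alpha> - \<beta>\<bar>) * fps_X) * ms t
          = - (ms t * ms t) + fps_X * (ms t * ms t) + fps_const (of_real (2 * g - 1)) * ms t + fps_const (of_real \<bar>\<alpha> - \<beta>\<bar>) * (fps_X * ms t)"
          by (simp add: algebra_simps)
        then show ?thesis unfolding g_def[symmetric] by simp
      qed
      have "((\<lambda>s. \<tau> (X s ^ n)) has_vector_derivative
        (\<Sum>j<n. linear_rate t (n - 1)) + (\<Sum>j<n. \<Sum>i<n - 1 - j. pair_rate t (n - 2 - i) i)) (at t)"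
        by (rule moment_ode[OF t])
      then have "((\<lambda>s. e s n) has_vector_derivative
        (\<Sum>j<n. linear_rate t (n - 1)) + (\<Sum>j<n. \<Sum>i<n - 1 - j. pair_rate t (n - 2 - i) i)) (at t)"
        by (simp add: e_def Suc)
      then show ?thesis
        unfolding rate XD_nth unfolding Suc nth fps_mult_nth ms_e[OF t] atLeast0AtMost
        by (intro ev[unfolded Suc]) simp
    qed
  qed
qed

end

theorem theorem1p4:
  fixes \<A> :: "'h::complex_hilbert bop set"
    and \<tau> :: "'h bop \<Rightarrow> complex"
    and p q :: "'h bop"
    and u :: "real \<Rightarrow> 'h bop"
    and \<alpha> \<beta> a b :: real
    and \<mu> :: "real \<Rightarrow> real measure"
    and G :: "real \<Rightarrow> complex \<Rightarrow> complex"
  assumes "II1_factor \<A> \<tau>"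
    and "p \<in> \<A>" and "projection p"
    and "q \<in> \<A>" and "projection q"
    and "free_unitary_brownian_motion \<A> \<tau> u"
    and "free \<tau> [star_alg (u ` {0..}), star_alg {p, q}]"
    and "\<tau> p = complex_of_real \<alpha>" and "\<tau> q = complex_of_real \<beta>"
    and "\<And>t. t > 0 \<Longrightarrow> spectral_measure \<tau> (q * (u t * p * adj (u t)) * q) (\<mu> t)"
    and "\<And>t (z::complex). t > 0 \<Longrightarrow> Im z > 0 \<Longrightarrow>
           G t z = (LINT x:{0..1}|\<mu> t. 1 / (z - complex_of_real x)) - complex_of_real (1 - min \<alpha> \<beta>) / z"
    and "a = 2 * min \<alpha> \<beta> - 1" and "b = \<bar>\<alpha> - \<beta>\<bar>"
  shows "(\<forall>t>0. \<forall>z. Im z > 0 \<longrightarrow> jointly_analytic_at G t z) \<and>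
         (\<forall>t>0. \<forall>z. Im z > 0 \<longrightarrow>
            ((\<lambda>s. G s z) has_vector_derivative
               deriv (\<lambda>w. w * (w - 1) * (G t w)\<^sup>2 - (complex_of_real a * w + complex_of_real b) * G t w) z) (at t))"
proof -
  have vN: "von_neumann_algebra \<A>" and tr: "tracial_state \<A> \<tau>"
    using assms(1) by (auto simp: II1_factor_def factor_def)
  obtain F x where Fx: "vn_filtration \<A> F" "free_brownian_motion \<tau> F x"
    "\<forall>t\<ge>0. unitary (u t) \<and> u t \<in> F t"
    "\<forall>t\<ge>0. ((\<lambda>s. norm2 \<tau> (u s - u t)) \<longlongrightarrow> 0) (at t within {0..})" "u 0 = 1"
    "\<forall>t\<ge>0. \<exists>I\<in>\<A>. \<exists>J\<in>\<A>. has_stoch_integral \<tau> u x t I \<and>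
           has_stoch_integral \<tau> u (\<lambda>s. complex_of_real s *\<^sub>C 1) t J \<and> u t - u 0 = \<i> *\<^sub>C I - (1/2) *\<^sub>C J"
    using assms(6) unfolding free_unitary_brownian_motion_def by blast
  interpret \<A>: unital_star_algebra \<A> by (rule unital_star_algebra_vN[OF vN])
  interpret free_liberation \<A> \<tau> F x u p q
  proof unfold_locales
    show "tracial_state \<A> \<tau>" by (rule tr)
    show "vn_filtration \<A> F" "free_brownian_motion \<tau> F x" using Fx by blast+
    show "p \<in> \<A>" "q \<in> \<A>" using assms by blast+
    show "adj p = p" "p * p = p" "adj q = q" "q * q = q"
      using assms(3,5) by (auto simp: projection_def intro: adj_eqI)
    show "free \<tau> [star_alg (u ` {0..}), star_alg {p, q}]" by (rule assms)
  qed (use Fx in blast)+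
  have sp: "spectral_measure \<tau> (Q t) (\<mu> t)" if "t > 0" for t
    using assms(10)[OF that] by (simp add: Q_def pt_def)
  have "jointly_analytic_at G t z \<and> ((\<lambda>s. G s z) has_vector_derivative
      deriv (\<lambda>w. w * (w - 1) * (G t w)\<^sup>2 - (complex_of_real a * w + complex_of_real b) * G t w) z) (at t)"
    if t: "t > 0" and z: "Im z > 0" for t z
  proof (rule moment_family_analytic_pde[where \<mu> = \<mu> and g = "min \<alpha> \<beta>"])
    fix s :: real assume s: "s > 0"
    show "real_distribution (\<mu> s)" "integrable (\<mu> s) (\<lambda>x. x ^ n)" for n
      using sp[OF s] unfolding spectral_measure_def by blast+
    show "AE x in \<mu> s. x \<in> {0..1}" by (rule spectral_support[OF less_imp_le[OF s] sp[OF s]])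
    show "fps_time_deriv (\<lambda>s. moment_fps (min \<alpha> \<beta>) (\<mu> s)) (fps_X * fps_deriv
        (- (1 - fps_X) * (moment_fps (min \<alpha> \<beta>) (\<mu> s) * moment_fps (min \<alpha> \<beta>) (\<mu> s)) +
          (fps_const (of_real a) + fps_const (of_real b) * fps_X) * moment_fps (min \<alpha> \<beta>) (\<mu> s))) s"
      unfolding assms(12,13) by (rule moment_fps_pde[OF assms(8,9) sp s])
  qed (use assms(11) t z in auto)
  then show ?thesis by blast
qed

end
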